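(* BMA on data words (resp. data $\omega$-words) and $\mathsf C$ (resp. $\mathsf C_\omega$) are equivalent: for every sentence of BMA there is a cascade in $\mathsf C$ (resp. $\mathsf C_\omega$) accepting exactly the data words (resp. data $\omega$-words) satisfying it, and for every cascade in $\mathsf C$ (resp. $\mathsf C_\omega$) there is a BMA sentence satisfied by exactly the data words (resp. data $\omega$-words) the cascade accepts.
   Context: Data words / data $\omega$-words: finite / infinite sequences $(a_1,d_1)(a_2,d_2)\cdots$ over $\Sigma\times\mathcal D$ ($\Sigma$ finite, $\mathcal D$ infinite); $i\sim j$ iff $d_i=d_j$; a class is a maximal set of positions with equal data value; class successor/predecessor of $i$: nearest later/earlier $j\sim i$. $\mu$-calculus: $\varphi::= x\mid A\mid\neg A\mid \mathsf M\varphi\mid\varphi\vee\varphi\mid\varphi\wedge\varphi\mid\mu x.\varphi\mid\nu x.\varphi$, atoms $A$: letters and $\mathsf S,\mathsf P,\mathsf{first}^g,\mathsf{last}^g,\mathsf{first}^c,\mathsf{last}^c$; $\mathsf M\in\{\mathtt X^g,\mathtt X^c,\mathtt Y^g,\mathtt Y^c\}$ evaluating the argument at successor, class successor, predecessor, class predecessor (false if nonexistent); $\mathsf{first}^g$/$\mathsf{last}^g$ at first/last position; $\mathsf{first}^c$/$\mathsf{last}^c$ where no class predecessor/successor; $\mathsf S$ at $i$ iff $i$ not last and $i+1$ is the class successor of $i$; $\mathsf P$ at $i$ iff $i\neq1$ and $i-1$ is the class predecessor of $i$; $\mu,\nu$ least/greatest fixpoints; $w\models\varphi$ iff $\varphi$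 holds at position 1. $\mathsf{Formulas}(M)$: formulas whose unary modalities lie in $M$. $\mathsf{Comp}^0(\Psi)=\emptyset$, $\mathsf{Comp}^{i+1}(\Psi)=\{\psi(\varphi_1,\dots,\varphi_n)\mid\psi(x_1,\dots,x_n)\in\Psi,\varphi_j\in\mathsf{Comp}^i(\Psi)\}$ (capture-avoiding), $\mathsf{Comp}(\Psi)=\bigcup_i\mathsf{Comp}^i(\Psi)$. BMA $=\mathsf{Comp}(\mathsf{Formulas}(\{\mathtt X^g,\mathtt Y^g\})\cup\mathsf{Formulas}(\{\mathtt X^c,\mathtt Y^c\}))$. Marking alphabet $\mathcal M=\{\mathsf P,\neg\mathsf P\}\times\{\mathsf S,\neg\mathsf S\}$; type of $i$: $(p,s)$ with $s=\mathsf S$ iff $i$ not last and $i+1$ is the class successor of $i$, $p=\mathsf P$ iff $i\neq 1$ and $i-1$ is the class predecessor of $i$. A functional letter-to-letter transducer is a nondeterministic finite-state (for $\omega$-words: Büchi) letter-to-letter transducer in which each input has at most one output. A global transducer $\mathcal G$ with input alphabet $\Sigma\times\mathcal M$ and output alphabet $\Sigma'$ is such a transducer run on $(a_1,\mathrm{tp}(1))(a_2,\mathrm{tp}(2))\cdots$; if it succeeds with output $b_1b_2\cdots$, the output data word is $(b_1,d_1)(b_2,d_2)\cdots$. A class transducer over data words is a functional transducer $\mathcal L$ run, for each class $\{i_1<i_2<\dots\}$, on $(a_{i_1},\mathrm{tp}(i_1))(a_{i_2},\mathrm{tp}(i_2))\cdots$; it succeeds if all these runs succeed, and the output data word has data values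 $d_i$ and at position $i_j$ the $j$-th output letter of the run on that class. Over data $\omega$-words, global transducers are functional Büchi transducers, and a class transducer is a pair $(\mathcal L,\mathcal L_\omega)$ with $\mathcal L$ used on finite classes and the functional Büchi transducer $\mathcal L_\omega$ on infinite classes. A cascade is $\langle\Sigma_0,\mathcal A_1,\Sigma_1,\dots,\mathcal A_n,\Sigma_n\rangle$ where each $\mathcal A_i$ is a global or class transducer with input alphabet $\Sigma_{i-1}\times\mathcal M$ and output alphabet $\Sigma_i$; $n$ is its height. It accepts $w$ iff $w_0=w$ and for each $i$, $\mathcal A_i$ succeeds on $w_{i-1}$ producing $w_i$. $\mathsf C$ ($\mathsf C_\omega$) is the set of such cascades over data words (data $\omega$-words). *)

theory Defs
  imports Main "HOL-Library.Extended_Nat" "HOL-Library.Infinite_Set"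
begin

text \<open>
  Positions are counted from 0, so position 1 of the literature is index 0 here.  Finite data
  words are lists and data omega-words are functions on \<open>nat\<close>.  What only depends on positions,
  letters and data values is defined once for both, from a length \<open>n\<close> (\<open>\<infinity>\<close> for omega-words), a
  letter map \<open>a\<close> and a data map \<open>d\<close>; only their values below \<open>n\<close> matter.

  Alphabets are finite subsets of the type \<open>'a\<close>.  Since the intermediate alphabets of a cascade
  may be arbitrarily large, \<open>'a\<close> has to be an infinite type.
\<close>

definition positions :: "enat \<Rightarrow> nat set" where
  "positions n = {i. enat i < n}"

definition class_of :: "enat \<Rightarrow> (nat \<Rightarrow> 'd) \<Rightarrow> nat \<Rightarrow> nat set" where
  "class_of n d i = {j \<in> positions n. d j = d i}"

definition class_succ :: "enat \<Rightarrow> (nat \<Rightarrow> 'd) \<Rightarrow> nat \<Rightarrow> nat \<Rightarrow> bool" where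
  "class_succ n d i j \<longleftrightarrow>
     i \<in> positions n \<and> j \<in> positions n \<and> i < j \<and> d j = d i \<and> (\<forall>k. i < k \<and> k < j \<longrightarrow> d k \<noteq> d i)"

definition class_pred :: "enat \<Rightarrow> (nat \<Rightarrow> 'd) \<Rightarrow> nat \<Rightarrow> nat \<Rightarrow> bool" where
  "class_pred n d i j \<longleftrightarrow>
     i \<in> positions n \<and> j \<in> positions n \<and> j < i \<and> d j = d i \<and> (\<forall>k. j < k \<and> k < i \<longrightarrow> d k \<noteq> d i)"

definition is_S :: "enat \<Rightarrow> (nat \<Rightarrow> 'd) \<Rightarrow> nat \<Rightarrow> bool" where
  "is_S n d i \<longleftrightarrow> Suc i \<in> positions n \<and> class_succ n d i (Suc i)"

definition is_P :: "enat \<Rightarrow> (nat \<Rightarrow> 'd) \<Rightarrow> nat \<Rightarrow> bool" where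
  "is_P n d i \<longleftrightarrow> i \<noteq> 0 \<and> class_pred n d i (i - 1)"

datatype (atom_letters: 'a) atom =
  Letter 'a | AtS | AtP | FirstG | LastG | FirstC | LastC

datatype modality = Xg | Xc | Yg | Yc

datatype (letters: 'a) fm =
    Var nat
  | Pos "'a atom"
  | Neg "'a atom"
  | Modal modality "'a fm"
  | Or "'a fm" "'a fm"
  | And "'a fm" "'a fm"
  | Mu nat "'a fm"
  | Nu nat "'a fm"

fun holds_atom :: "enat \<Rightarrow> (nat \<Rightarrow> 'a) \<Rightarrow> (nat \<Rightarrow> 'd) \<Rightarrow> 'a atom \<Rightarrow> nat \<Rightarrow> bool" where
  "holds_atom n a d (Letter c) i \<longleftrightarrow> a i = c"
| "holds_atom n a d AtS i \<longleftrightarrow> is_S n d i"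
| "holds_atom n a d AtP i \<longleftrightarrow> is_P n d i"
| "holds_atom n a d FirstG i \<longleftrightarrow> i = 0"
| "holds_atom n a d LastG i \<longleftrightarrow> Suc i \<notin> positions n"
| "holds_atom n a d FirstC i \<longleftrightarrow> \<not> (\<exists>j. class_pred n d i j)"
| "holds_atom n a d LastC i \<longleftrightarrow> \<not> (\<exists>j. class_succ n d i j)"

fun move :: "enat \<Rightarrow> (nat \<Rightarrow> 'd) \<Rightarrow> modality \<Rightarrow> nat \<Rightarrow> nat \<Rightarrow> bool" where
  "move n d Xg i j \<longleftrightarrow> j = Suc i \<and> j \<in> positions n"
| "move n d Xc i j \<longleftrightarrow> class_succ n d i j"
| "move n d Yg i j \<longleftrightarrow> i = Suc j \<and> i \<in> positions n"
| "move n d Yc i j \<longleftrightarrow> class_pred n d i j"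

text \<open>
  Intersecting with \<open>positions n\<close> in the variable case confines every denotation to sets of
  positions, so the fixpoints below coincide with those in the lattice of subsets of
  \<open>positions n\<close>.
\<close>

primrec sem ::
  "enat \<Rightarrow> (nat \<Rightarrow> 'a) \<Rightarrow> (nat \<Rightarrow> 'd) \<Rightarrow> 'a fm \<Rightarrow> (nat \<Rightarrow> nat set) \<Rightarrow> nat set" where
  "sem n a d (Var x) V = V x \<inter> positions n"
| "sem n a d (Pos A) V = {i \<in> positions n. holds_atom n a d A i}"
| "sem n a d (Neg A) V = {i \<in> positions n. \<not> holds_atom n a d A i}"
| "sem n a d (Modal M \<phi>) V = {i \<in> positions n. \<exists>j. move n d M i j \<and> j \<in> sem n a d \<phi> V}"
| "sem n a d (Or \<phi> \<psi>) V = sem n a d \<phi> V \<union> sem n a d \<psi> V"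
| "sem n a d (And \<phi> \<psi>) V = sem n a d \<phi> V \<inter> sem n a d \<psi> V"
| "sem n a d (Mu x \<phi>) V = lfp (\<lambda>X. sem n a d \<phi> (V(x := X)))"
| "sem n a d (Nu x \<phi>) V = gfp (\<lambda>X. sem n a d \<phi> (V(x := X)))"

lemma sem_subset_positions: "sem n a d \<phi> V \<subseteq> positions n"
proof (induction \<phi> arbitrary: V)
  case (Mu x \<phi>)
  then show ?case by (auto intro!: lfp_lowerbound)
next
  case (Nu x \<phi>)
  then have "X \<subseteq> sem n a d \<phi> (V(x := X)) \<Longrightarrow> X \<subseteq> positions n" for X
    by (meson order_trans)
  then show ?case by (auto intro!: gfp_least)
qed auto

lemma sem_mono: "(\<And>x. V x \<subseteq> W x) \<Longrightarrow> sem n a d \<phi> V \<subseteq> sem n a d \<phi> W"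
proof (induction \<phi> arbitrary: V W)
  case (Or \<phi> \<psi>)
  from Or.IH[of V W] Or.prems show ?case by auto
next
  case (And \<phi> \<psi>)
  from And.IH[of V W] And.prems show ?case by auto
next
  case (Modal M \<phi>)
  from Modal.IH[of V W] Modal.prems show ?case by auto
next
  case (Mu x \<phi>)
  have "sem n a d \<phi> (V(x := X)) \<subseteq> sem n a d \<phi> (W(x := X))" for X
    by (rule Mu.IH) (simp add: Mu.prems)
  then show ?case by (simp add: lfp_mono)
next
  case (Nu x \<phi>)
  have "sem n a d \<phi> (V(x := X)) \<subseteq> sem n a d \<phi> (W(x := X))" for X
    by (rule Nu.IH) (simp add: Nu.prems)
  then show ?case by (simp add: gfp_mono)
qed auto

primrec fv :: "'a fm \<Rightarrow> nat set" where
  "fv (Var x) = {x}"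
| "fv (Pos A) = {}"
| "fv (Neg A) = {}"
| "fv (Modal M \<phi>) = fv \<phi>"
| "fv (Or \<phi> \<psi>) = fv \<phi> \<union> fv \<psi>"
| "fv (And \<phi> \<psi>) = fv \<phi> \<union> fv \<psi>"
| "fv (Mu x \<phi>) = fv \<phi> - {x}"
| "fv (Nu x \<phi>) = fv \<phi> - {x}"

primrec modalities :: "'a fm \<Rightarrow> modality set" where
  "modalities (Var x) = {}"
| "modalities (Pos A) = {}"
| "modalities (Neg A) = {}"
| "modalities (Modal M \<phi>) = insert M (modalities \<phi>)"
| "modalities (Or \<phi> \<psi>) = modalities \<phi> \<union> modalities \<psi>"
| "modalities (And \<phi> \<psi>) = modalities \<phi> \<union> modalities \<psi>"
| "modalities (Mu x \<phi>) = modalities \<phi>"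
| "modalities (Nu x \<phi>) = modalities \<phi>"

definition Formulas :: "'a set \<Rightarrow> modality set \<Rightarrow> 'a fm set" where
  "Formulas \<Sigma> M = {\<phi>. letters \<phi> \<subseteq> \<Sigma> \<and> modalities \<phi> \<subseteq> M}"

primrec subst :: "'a fm \<Rightarrow> (nat \<Rightarrow> 'a fm) \<Rightarrow> 'a fm" where
  "subst (Var x) \<sigma> = \<sigma> x"
| "subst (Pos A) \<sigma> = Pos A"
| "subst (Neg A) \<sigma> = Neg A"
| "subst (Modal M \<phi>) \<sigma> = Modal M (subst \<phi> \<sigma>)"
| "subst (Or \<phi> \<psi>) \<sigma> = Or (subst \<phi> \<sigma>) (subst \<psi> \<sigma>)"
| "subst (And \<phi> \<psi>) \<sigma> = And (subst \<phi> \<sigma>) (subst \<psi> \<sigma>)"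
| "subst (Mu x \<phi>) \<sigma> = Mu x (subst \<phi> (\<sigma>(x := Var x)))"
| "subst (Nu x \<phi>) \<sigma> = Nu x (subst \<phi> (\<sigma>(x := Var x)))"

text \<open>
  \<open>\<psi>(\<phi>\<^sub>1, \<dots>, \<phi>\<^sub>n)\<close> replaces all free variables of \<open>\<psi>\<close>.  As the induction starts from the empty
  set, only closed formulas are ever substituted (lemma \<open>fv_Comp\<close>), so \<open>subst\<close>, which does not
  rename bound variables, is capture-avoiding here.
\<close>

primrec Comp_upto :: "nat \<Rightarrow> 'a fm set \<Rightarrow> 'a fm set" where
  "Comp_upto 0 \<Psi> = {}"
| "Comp_upto (Suc i) \<Psi> = {subst \<psi> \<sigma> | \<psi> \<sigma>. \<psi> \<in> \<Psi> \<and> (\<forall>x \<in> fv \<psi>. \<sigma> x \<in> Comp_upto i \<Psi>)}"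

definition Comp :: "'a fm set \<Rightarrow> 'a fm set" where
  "Comp \<Psi> = (\<Union>i. Comp_upto i \<Psi>)"

lemma fv_subst: "fv (subst \<phi> \<sigma>) \<subseteq> (\<Union>x \<in> fv \<phi>. fv (\<sigma> x))"
proof (induction \<phi> arbitrary: \<sigma>)
  case (Or \<phi> \<psi>)
  from Or.IH[of \<sigma>] show ?case by auto
next
  case (And \<phi> \<psi>)
  from And.IH[of \<sigma>] show ?case by auto
next
  case (Mu x \<phi>)
  show ?case
  proof
    fix z assume z: "z \<in> fv (subst (Mu x \<phi>) \<sigma>)"
    then have "z \<in> fv (subst \<phi> (\<sigma>(x := Var x)))" by simp
    with Mu.IH obtain y where y: "y \<in> fv \<phi>" "z \<in> fv ((\<sigma>(x := Var x)) y)" by blast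
    from y(2) z have "y \<noteq> x" by auto
    with y show "z \<in> (\<Union>x \<in> fv (Mu x \<phi>). fv (\<sigma> x))" by auto
  qed
next
  case (Nu x \<phi>)
  show ?case
  proof
    fix z assume z: "z \<in> fv (subst (Nu x \<phi>) \<sigma>)"
    then have "z \<in> fv (subst \<phi> (\<sigma>(x := Var x)))" by simp
    with Nu.IH obtain y where y: "y \<in> fv \<phi>" "z \<in> fv ((\<sigma>(x := Var x)) y)" by blast
    from y(2) z have "y \<noteq> x" by auto
    with y show "z \<in> (\<Union>x \<in> fv (Nu x \<phi>). fv (\<sigma> x))" by auto
  qed
qed auto

lemma fv_Comp:
  assumes "\<phi> \<in> Comp \<Psi>"
  shows "fv \<phi> = {}"
proof -
  have "\<phi> \<in> Comp_upto i \<Psi> \<Longrightarrow> fv \<phi> = {}" for i \<phi>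
  proof (induction i arbitrary: \<phi>)
    case (Suc i)
    then obtain \<psi> \<sigma> where "\<phi> = subst \<psi> \<sigma>" and "\<forall>x \<in> fv \<psi>. \<sigma> x \<in> Comp_upto i \<Psi>" by auto
    with Suc.IH fv_subst[of \<psi> \<sigma>] show ?case by auto
  qed simp
  with assms show ?thesis by (auto simp: Comp_def)
qed

definition BMA :: "'a set \<Rightarrow> 'a fm set" where
  "BMA \<Sigma> = Comp (Formulas \<Sigma> {Xg, Yg} \<union> Formulas \<Sigma> {Xc, Yc})"

definition sentence :: "'a fm \<Rightarrow> bool" where
  "sentence \<phi> \<longleftrightarrow> fv \<phi> = {}"

text \<open>Finite data words are non-empty, as satisfaction refers to the first position.\<close>

definition data_words :: "'a set \<Rightarrow> ('a \<times> 'd) list set" where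
  "data_words \<Sigma> = {w. w \<noteq> [] \<and> fst ` set w \<subseteq> \<Sigma>}"

definition data_omega_words :: "'a set \<Rightarrow> (nat \<Rightarrow> 'a \<times> 'd) set" where
  "data_omega_words \<Sigma> = {w. \<forall>i. fst (w i) \<in> \<Sigma>}"

definition models :: "('a \<times> 'd) list \<Rightarrow> 'a fm \<Rightarrow> bool" where
  "models w \<phi> \<longleftrightarrow>
     0 \<in> sem (enat (length w)) (\<lambda>i. fst (w ! i)) (\<lambda>i. snd (w ! i)) \<phi> (\<lambda>_. {})"

definition models_omega :: "(nat \<Rightarrow> 'a \<times> 'd) \<Rightarrow> 'a fm \<Rightarrow> bool" where
  "models_omega w \<phi> \<longleftrightarrow> 0 \<in> sem \<infinity> (fst \<circ> w) (snd \<circ> w) \<phi> (\<lambda>_. {})"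

text \<open>In \<open>(p, s)\<close> the component \<open>True\<close> stands for \<open>P\<close> resp. \<open>S\<close> and \<open>False\<close> for its negation.\<close>

type_synonym marking = "bool \<times> bool"

definition tp :: "enat \<Rightarrow> (nat \<Rightarrow> 'd) \<Rightarrow> nat \<Rightarrow> marking" where
  "tp n d i = (is_P n d i, is_S n d i)"

definition marked :: "('a \<times> 'd) list \<Rightarrow> nat \<Rightarrow> 'a \<times> marking" where
  "marked w i = (fst (w ! i), tp (enat (length w)) (\<lambda>j. snd (w ! j)) i)"

definition marked_omega :: "(nat \<Rightarrow> 'a \<times> 'd) \<Rightarrow> nat \<Rightarrow> 'a \<times> marking" where
  "marked_omega w i = (fst (w i), tp \<infinity> (snd \<circ> w) i)"

record ('i, 'o) transducer =
  states :: "nat set"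
  initial :: "nat set"
  delta :: "(nat \<times> 'i \<times> 'o \<times> nat) set"
  final :: "nat set"

definition is_transducer :: "'i set \<Rightarrow> 'o set \<Rightarrow> ('i, 'o) transducer \<Rightarrow> bool" where
  "is_transducer A B T \<longleftrightarrow>
     finite A \<and> finite B \<and> finite (states T) \<and> initial T \<subseteq> states T \<and> final T \<subseteq> states T \<and>
     delta T \<subseteq> states T \<times> A \<times> B \<times> states T"

definition word_rel :: "('i, 'o) transducer \<Rightarrow> ('i list \<times> 'o list) set" where
  "word_rel T = {(u, v). length v = length u \<and>
     (\<exists>r. r 0 \<in> initial T \<and> (\<forall>k < length u. (r k, u ! k, v ! k, r (Suc k)) \<in> delta T) \<and>
          r (length u) \<in> final T)}"

definition buchi_rel :: "('i, 'o) transducer \<Rightarrow> ((nat \<Rightarrow> 'i) \<times> (nat \<Rightarrow> 'o)) set" where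
  "buchi_rel T = {(u, v).
     \<exists>r. r 0 \<in> initial T \<and> (\<forall>k. (r k, u k, v k, r (Suc k)) \<in> delta T) \<and>
         (\<exists>\<^sub>\<infinity>k. r k \<in> final T)}"

definition functional_transducer :: "'i set \<Rightarrow> 'o set \<Rightarrow> ('i, 'o) transducer \<Rightarrow> bool" where
  "functional_transducer A B T \<longleftrightarrow> is_transducer A B T \<and> single_valued (word_rel T)"

definition functional_buchi :: "'i set \<Rightarrow> 'o set \<Rightarrow> ('i, 'o) transducer \<Rightarrow> bool" where
  "functional_buchi A B T \<longleftrightarrow> is_transducer A B T \<and> single_valued (buchi_rel T)"

type_synonym 'a letter_transducer = "('a \<times> marking, 'a) transducer"

datatype 'a layer =
    Global "'a letter_transducer"
  | Class "'a letter_transducer"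

datatype 'a layer_omega =
    Global_omega "'a letter_transducer"
  | Class_omega "'a letter_transducer" "'a letter_transducer"

fun is_layer :: "'a set \<Rightarrow> 'a set \<Rightarrow> 'a layer \<Rightarrow> bool" where
  "is_layer \<Sigma> \<Gamma> (Global T) \<longleftrightarrow> functional_transducer (\<Sigma> \<times> UNIV) \<Gamma> T"
| "is_layer \<Sigma> \<Gamma> (Class T) \<longleftrightarrow> functional_transducer (\<Sigma> \<times> UNIV) \<Gamma> T"

fun is_layer_omega :: "'a set \<Rightarrow> 'a set \<Rightarrow> 'a layer_omega \<Rightarrow> bool" where
  "is_layer_omega \<Sigma> \<Gamma> (Global_omega T) \<longleftrightarrow> functional_buchi (\<Sigma> \<times> UNIV) \<Gamma> T"
| "is_layer_omega \<Sigma> \<Gamma> (Class_omega L L\<^sub>\<omega>) \<longleftrightarrow>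
     functional_transducer (\<Sigma> \<times> UNIV) \<Gamma> L \<and> functional_buchi (\<Sigma> \<times> UNIV) \<Gamma> L\<^sub>\<omega>"

text \<open>\<open>produces A w w'\<close>: the layer \<open>A\<close> succeeds on \<open>w\<close> with output data word \<open>w'\<close>.\<close>

fun produces :: "'a layer \<Rightarrow> ('a \<times> 'd) list \<Rightarrow> ('a \<times> 'd) list \<Rightarrow> bool" where
  "produces (Global T) w w' \<longleftrightarrow>
     map snd w' = map snd w \<and> (map (marked w) [0..<length w], map fst w') \<in> word_rel T"
| "produces (Class T) w w' \<longleftrightarrow>
     map snd w' = map snd w \<and>
     (\<forall>i < length w.
        let C = sorted_list_of_set (class_of (enat (length w)) (\<lambda>j. snd (w ! j)) i)
        in (map (marked w) C, map (\<lambda>j. fst (w' ! j)) C) \<in> word_rel T)"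

fun produces_omega ::
  "'a layer_omega \<Rightarrow> (nat \<Rightarrow> 'a \<times> 'd) \<Rightarrow> (nat \<Rightarrow> 'a \<times> 'd) \<Rightarrow> bool" where
  "produces_omega (Global_omega T) w w' \<longleftrightarrow>
     snd \<circ> w' = snd \<circ> w \<and> (marked_omega w, fst \<circ> w') \<in> buchi_rel T"
| "produces_omega (Class_omega L L\<^sub>\<omega>) w w' \<longleftrightarrow>
     snd \<circ> w' = snd \<circ> w \<and>
     (\<forall>i. let C = class_of \<infinity> (snd \<circ> w) i in
        if finite C
        then (map (marked_omega w) (sorted_list_of_set C), map (fst \<circ> w') (sorted_list_of_set C))
               \<in> word_rel L
        else (marked_omega w \<circ> enumerate C, fst \<circ> w' \<circ> enumerate C) \<in> buchi_rel L\<^sub>\<omega>)"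

text \<open>
  The cascade \<open>\<langle>\<Sigma>\<^sub>0, A\<^sub>1, \<Sigma>\<^sub>1, \<dots>, A\<^sub>n, \<Sigma>\<^sub>n\<rangle>\<close> is represented by \<open>\<Sigma>\<^sub>0\<close> together with the list
  \<open>[(A\<^sub>1, \<Sigma>\<^sub>1), \<dots>, (A\<^sub>n, \<Sigma>\<^sub>n)]\<close>; its height is the length of that list.
\<close>

fun is_cascade :: "'a set \<Rightarrow> ('a layer \<times> 'a set) list \<Rightarrow> bool" where
  "is_cascade \<Sigma> [] \<longleftrightarrow> finite \<Sigma>"
| "is_cascade \<Sigma> ((A, \<Gamma>) # As) \<longleftrightarrow> finite \<Sigma> \<and> is_layer \<Sigma> \<Gamma> A \<and> is_cascade \<Gamma> As"

fun is_cascade_omega :: "'a set \<Rightarrow> ('a layer_omega \<times> 'a set) list \<Rightarrow> bool" where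
  "is_cascade_omega \<Sigma> [] \<longleftrightarrow> finite \<Sigma>"
| "is_cascade_omega \<Sigma> ((A, \<Gamma>) # As) \<longleftrightarrow>
     finite \<Sigma> \<and> is_layer_omega \<Sigma> \<Gamma> A \<and> is_cascade_omega \<Gamma> As"

fun accepts :: "('a layer \<times> 'a set) list \<Rightarrow> ('a \<times> 'd) list \<Rightarrow> bool" where
  "accepts [] w \<longleftrightarrow> True"
| "accepts ((A, \<Gamma>) # As) w \<longleftrightarrow> (\<exists>w'. produces A w w' \<and> accepts As w')"

fun accepts_omega :: "('a layer_omega \<times> 'a set) list \<Rightarrow> (nat \<Rightarrow> 'a \<times> 'd) \<Rightarrow> bool" where
  "accepts_omega [] w \<longleftrightarrow> True"
| "accepts_omega ((A, \<Gamma>) # As) w \<longleftrightarrow> (\<exists>w'. produces_omega A w w' \<and> accepts_omega As w')"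

end

theory Submission
  imports Defs "HOL-Library.Ramsey"
begin

text \<open>
  A formula over \<open>X\<^sup>g, Y\<^sup>g\<close> (resp. \<open>X\<^sup>c, Y\<^sup>c\<close>) only sees the whole word (resp. one class), read as
  a plain word of length at most \<open>\<omega>\<close> whose letters carry the truth values of all atoms and free
  variables.

  From formulas to cascades: on plain words the set denoted by a \<open>\<mu>\<close>-calculus formula is a
  regular function of the letters, because least and greatest fixpoints can be described by
  quantifying over (pre- and post-fixed) sets and regular properties are closed under complement
  and projection.  The relation "the output letter is the input letter together with the truth
  value of the formula" is therefore recognized by a transducer, which is functional although it
  is nondeterministic.  A formula in \<open>Comp\<close> is evaluated by adding one such layer for each of its
  components.

  From cascades to formulas: that a successful run outputs \<open>b\<close> at the current position says that
  for some transition with output \<open>b\<close> its source is reachable from an initial state in the past and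
  its target allows a successful run in the future.  Both are reachability properties of the
  transition graph, expressed by least fixpoints as in Kleene's theorem; a Buechi run adds one
  greatest fixpoint for the infinitely many visits to a final state.  By functionality a layer
  succeeds iff every position has some output letter in this sense.
\<close>

section \<open>Chains of positions and their words\<close>

text \<open>The argument is carried out for a length \<open>n :: enat\<close>, so data words and
  data omega-words share every construction. Even inside an omega-word a class may be finite, so
  finite and infinite chains have to be treated side by side anyway. Saying that a set is a least
  fixpoint takes a negated quantifier over sets, and nested fixpoints repeat this at every level;
  regularity is therefore phrased with congruences, for which negation costs nothing, rather than
  with Buechi automata. In the converse direction the obstacle is the shape of \<open>Comp\<close>:
  only closed formulas are substituted, and the letters of an intermediate alphabet are not letters
  of the input alphabet. The formula of a layer therefore has one free variable per letter, replaced
  later by the closed formula that defines this letter over the original word. The fixpoint binders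
  of Kleene's construction must leave these variables alone, which is the reason for separating even
  from odd variables.\<close>

definition csize :: "nat set \<Rightarrow> enat" where
  "csize C = (if finite C then enat (card C) else \<infinity>)"

text \<open>One increasing enumeration for finite and infinite sets. For finite \<open>C\<close> its
  values mean something only below \<open>csize C\<close>, hence the guards in the lemmas about
  it.\<close>

definition enum_set :: "nat set \<Rightarrow> nat \<Rightarrow> nat" where
  "enum_set C = (if finite C then (!) (sorted_list_of_set C) else enumerate C)"

lemma positions_iff [simp]: "i \<in> positions n \<longleftrightarrow> enat i < n"
  by (simp add: positions_def)

lemma enat_less_mono: "enat l < n \<Longrightarrow> k \<le> l \<Longrightarrow> enat k < n"
  by (meson enat_ord_simps(1) le_less_trans)

lemma enum_set_less:
  assumes "enat l < csize C" "k < l"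
  shows "enum_set C k < enum_set C l"
proof (cases "finite C")
  case True
  then show ?thesis
    using assms sorted_wrt_nth_less[OF strict_sorted_list_of_set, of k l C]
    by (simp add: csize_def enum_set_def)
next
  case False
  then show ?thesis using assms by (simp add: enum_set_def enumerate_mono)
qed

lemma enum_set_image: "enum_set C ` positions (csize C) = C"
proof (cases "finite C")
  case True
  then have "enum_set C ` positions (csize C) = set (sorted_list_of_set C)"
    by (auto simp: csize_def enum_set_def set_conv_nth image_iff)
  then show ?thesis using True by simp
next
  case False
  then show ?thesis by (simp add: csize_def enum_set_def positions_def range_enumerate)
qed

lemma enum_set_in: "enat k < csize C \<Longrightarrow> enum_set C k \<in> C"
  using enum_set_image[of C] by auto

lemma enum_set_obtain:
  assumes "i \<in> C"
  obtains k where "enat k < csize C" "i = enum_set C k"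
  using assms enum_set_image[of C] by (metis imageE positions_iff)

lemma enum_set_le:
  assumes "enat l < csize C" "enat k < csize C"
  shows "enum_set C k < enum_set C l \<longleftrightarrow> k < l" "enum_set C k = enum_set C l \<longleftrightarrow> k = l"
  using enum_set_less assms by (metis less_asym less_irrefl linorder_neqE_nat)+

text \<open>The left side has the shape of a class successor, "nearest later element of
  \<open>C\<close>"; on indices this is adding one. If \<open>j\<close> had index above
  \<open>Suc k\<close>, the element of index \<open>Suc k\<close> would lie strictly
  between.\<close>

lemma enum_set_succ:
  assumes k: "enat k < csize C"
  shows "j \<in> C \<and> enum_set C k < j \<and> (\<forall>q. enum_set C k < q \<and> q < j \<longrightarrow> q \<notin> C) \<longleftrightarrow>
         enat (Suc k) < csize C \<and> j = enum_set C (Suc k)" (is "?L \<longleftrightarrow> ?R")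
proof
  assume L: ?L
  then obtain l where l: "enat l < csize C" "j = enum_set C l" using enum_set_obtain by metis
  then have kl: "k < l" using L enum_set_le k by simp
  then have Sk: "enat (Suc k) < csize C" using l enat_less_mono by (metis Suc_leI)
  have "enum_set C (Suc k) \<in> C" by (rule enum_set_in[OF Sk])
  then have "\<not> Suc k < l" using L l Sk k enum_set_le by (metis lessI)
  then show ?R using kl l Sk by (metis Suc_lessI)
next
  assume R: ?R
  have "q \<notin> C" if "enum_set C k < q" "q < j" for q
  proof
    assume "q \<in> C"
    then obtain l where l: "enat l < csize C" "q = enum_set C l" using enum_set_obtain by metis
    with that R k enum_set_le have "k < l" "l < Suc k" by auto
    then show False by simp
  qed
  then show ?L using R k enum_set_in enum_set_less by auto
qed

lemma enum_set_pred:
  assumes k: "enat k < csize C"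
  shows "j \<in> C \<and> j < enum_set C k \<and> (\<forall>q. j < q \<and> q < enum_set C k \<longrightarrow> q \<notin> C) \<longleftrightarrow>
         0 < k \<and> j = enum_set C (k - 1)" (is "?L \<longleftrightarrow> ?R")
proof
  assume L: ?L
  then obtain l where l: "enat l < csize C" "j = enum_set C l" using enum_set_obtain by metis
  \<comment> \<open>That \<open>j\<close> is the nearest earlier element of
    \<open>enum_set C k\<close> means that \<open>enum_set C k\<close> is the nearest later element
    of \<open>j\<close>, so the successor lemma applies at index \<open>l\<close>.\<close>
  have "k = Suc l"
    using L l k enum_set_succ[OF l(1), of "enum_set C k"] enum_set_in[OF k] enum_set_le(2)
    by (metis (no_types, lifting))
  then show ?R using l by simp
next
  assume R: ?R
  then have l: "enat (k - 1) < csize C" using k enat_less_mono by (metis diff_le_self)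
  then show ?L using R k enum_set_succ[OF l, of "enum_set C k"] enum_set_in by auto
qed

section \<open>The whole word and the classes as chains\<close>

text \<open>The flag \<open>cl\<close> lets the global and the class modalities be treated by the
  same statements; the whole word is the single chain of the case \<open>cl = False\<close>.\<close>

definition chain_of :: "bool \<Rightarrow> enat \<Rightarrow> (nat \<Rightarrow> 'd) \<Rightarrow> nat \<Rightarrow> nat set" where
  "chain_of cl n d i = (if cl then class_of n d i else positions n)"

definition next_mod :: "bool \<Rightarrow> modality" where
  "next_mod cl = (if cl then Xc else Xg)"

definition prev_mod :: "bool \<Rightarrow> modality" where
  "prev_mod cl = (if cl then Yc else Yg)"

definition is_forward :: "modality \<Rightarrow> bool" where
  "is_forward M \<longleftrightarrow> M \<in> {Xg, Xc}"

lemma is_forward_simps [simp]: "is_forward (next_mod cl)" "\<not> is_forward (prev_mod cl)"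
  by (auto simp: is_forward_def next_mod_def prev_mod_def)

lemma chain_of_subset: "chain_of cl n d i \<subseteq> positions n"
  by (auto simp: chain_of_def class_of_def)

lemma self_in_chain: "enat i < n \<Longrightarrow> i \<in> chain_of cl n d i"
  by (auto simp: chain_of_def class_of_def)

lemma chain_of_eq: "j \<in> chain_of cl n d i \<Longrightarrow> chain_of cl n d j = chain_of cl n d i"
  by (auto simp: chain_of_def class_of_def)

lemma move_next_in_chain:
  assumes "p \<in> chain_of cl n d i"
  shows "move n d (next_mod cl) p j \<longleftrightarrow>
    j \<in> chain_of cl n d i \<and> p < j \<and> (\<forall>q. p < q \<and> q < j \<longrightarrow> q \<notin> chain_of cl n d i)"
proof (cases cl)
  case True
  then show ?thesis
    using assms by (auto simp: chain_of_def next_mod_def class_succ_def class_of_def)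
       (meson enat_less_mono less_imp_le)
next
  case False
  have "j = Suc p" if "enat j < n" "p < j" "\<forall>q. p < q \<and> q < j \<longrightarrow> \<not> enat q < n"
    using that by (metis Suc_lessI enat_less_mono lessI less_imp_le)
  then show ?thesis using assms False by (auto simp: chain_of_def next_mod_def)
qed

lemma move_prev_in_chain:
  assumes "p \<in> chain_of cl n d i"
  shows "move n d (prev_mod cl) p j \<longleftrightarrow>
    j \<in> chain_of cl n d i \<and> j < p \<and> (\<forall>q. j < q \<and> q < p \<longrightarrow> q \<notin> chain_of cl n d i)"
proof (cases cl)
  case True
  then show ?thesis
    using assms by (auto simp: chain_of_def prev_mod_def class_pred_def class_of_def)
       (meson enat_less_mono less_imp_le)
next
  case False
  have "p = Suc j" if "enat p < n" "j < p" "\<forall>q. j < q \<and> q < p \<longrightarrow> \<not> enat q < n"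
    using that by (metis Suc_lessI enat_less_mono lessI less_imp_le)
  then show ?thesis using assms False
    by (auto simp: chain_of_def prev_mod_def) (metis enat_less_mono lessI less_imp_le)
qed

lemma move_on_chain:
  assumes "enat k < csize (chain_of cl n d i)" and M: "M \<in> {next_mod cl, prev_mod cl}"
  shows "move n d M (enum_set (chain_of cl n d i) k) j \<longleftrightarrow>
    (if is_forward M
     then enat (Suc k) < csize (chain_of cl n d i) \<and> j = enum_set (chain_of cl n d i) (Suc k)
     else 0 < k \<and> j = enum_set (chain_of cl n d i) (k - 1))"
  using M move_next_in_chain[OF enum_set_in[OF assms(1)], of j]
    move_prev_in_chain[OF enum_set_in[OF assms(1)], of j]
    enum_set_succ[OF assms(1), of j] enum_set_pred[OF assms(1), of j] by auto

definition first_atom :: "bool \<Rightarrow> 'a atom" where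
  "first_atom cl = (if cl then FirstC else FirstG)"

definition last_atom :: "bool \<Rightarrow> 'a atom" where
  "last_atom cl = (if cl then LastC else LastG)"

text \<open>The first and last atoms say that the corresponding move is impossible, so on a chain
  they are determined by the index alone.\<close>

lemma holds_first_last:
  assumes "enat i < n"
  shows "holds_atom n a d (first_atom cl) i \<longleftrightarrow> \<not> (\<exists>j. move n d (prev_mod cl) i j)"
    and "holds_atom n a d (last_atom cl) i \<longleftrightarrow> \<not> (\<exists>j. move n d (next_mod cl) i j)"
  using assms not0_implies_Suc[of i]
  by (auto simp: first_atom_def last_atom_def prev_mod_def next_mod_def)

lemma first_on_chain:
  assumes "enat k < csize (chain_of cl n d i)"
  shows "holds_atom n a d (first_atom cl) (enum_set (chain_of cl n d i) k) \<longleftrightarrow> k = 0"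
proof -
  have "enat (enum_set (chain_of cl n d i) k) < n"
    using enum_set_in[OF assms] chain_of_subset[of cl n d i] by auto
  then show ?thesis
    using assms by (simp add: holds_first_last move_on_chain)
qed

lemma last_on_chain:
  assumes "enat k < csize (chain_of cl n d i)"
  shows "holds_atom n a d (last_atom cl) (enum_set (chain_of cl n d i) k) \<longleftrightarrow>
    \<not> enat (Suc k) < csize (chain_of cl n d i)"
proof -
  have "enat (enum_set (chain_of cl n d i) k) < n"
    using enum_set_in[OF assms] chain_of_subset[of cl n d i] by auto
  then show ?thesis
    using assms by (simp add: holds_first_last move_on_chain)
qed

lemma csize_chain_pos: "enat i < n \<Longrightarrow> 0 < csize (chain_of cl n d i)"
  by (metis enum_set_obtain gr_zeroI not_less_zero self_in_chain)

section \<open>Semantics on plain words and its transfer to chains\<close>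

text \<open>The atoms are valued by an arbitrary \<open>\<alpha>\<close>, and of a modality only the
  direction is left. The forward case does not test \<open>Suc k\<close> against \<open>m\<close>,
  because denotations contain positions below \<open>m\<close> only.\<close>

primrec wsem ::
  "enat \<Rightarrow> ('a atom \<Rightarrow> nat set) \<Rightarrow> 'a fm \<Rightarrow> (nat \<Rightarrow> nat set) \<Rightarrow> nat set" where
  "wsem m \<alpha> (Var x) V = V x \<inter> positions m"
| "wsem m \<alpha> (Pos A) V = \<alpha> A \<inter> positions m"
| "wsem m \<alpha> (Neg A) V = positions m - \<alpha> A"
| "wsem m \<alpha> (Modal M \<phi>) V =
     {k. enat k < m \<and> (if is_forward M then Suc k \<in> wsem m \<alpha> \<phi> V
         else 0 < k \<and> k - 1 \<in> wsem m \<alpha> \<phi> V)}"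
| "wsem m \<alpha> (Or \<phi> \<psi>) V = wsem m \<alpha> \<phi> V \<union> wsem m \<alpha> \<psi> V"
| "wsem m \<alpha> (And \<phi> \<psi>) V = wsem m \<alpha> \<phi> V \<inter> wsem m \<alpha> \<psi> V"
| "wsem m \<alpha> (Mu x \<phi>) V = lfp (\<lambda>X. wsem m \<alpha> \<phi> (V(x := X)))"
| "wsem m \<alpha> (Nu x \<phi>) V = gfp (\<lambda>X. wsem m \<alpha> \<phi> (V(x := X)))"

lemma wsem_subset_positions: "wsem m \<alpha> \<phi> V \<subseteq> positions m"
proof (induction \<phi> arbitrary: V)
  case (Mu x \<phi>)
  then show ?case by (simp only: wsem.simps) (meson lfp_lowerbound)
next
  case (Nu x \<phi>)
  then have "X \<subseteq> wsem m \<alpha> \<phi> (V(x := X)) \<Longrightarrow> X \<subseteq> positions m" for X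
    by (meson order_trans)
  then show ?case by (auto intro!: gfp_least)
qed auto

lemma wsem_less: "k \<in> wsem m \<alpha> \<phi> V \<Longrightarrow> enat k < m"
  using wsem_subset_positions[of m \<alpha> \<phi> V] by auto

lemma wsem_mono: "(\<And>x. V x \<subseteq> W x) \<Longrightarrow> wsem m \<alpha> \<phi> V \<subseteq> wsem m \<alpha> \<phi> W"
proof (induction \<phi> arbitrary: V W)
  case (Or \<phi> \<psi>)
  from Or.IH[of V W] Or.prems show ?case by auto
next
  case (And \<phi> \<psi>)
  from And.IH[of V W] And.prems show ?case by auto
next
  case (Modal M \<phi>)
  from Modal.IH[of V W] Modal.prems show ?case by auto
next
  case (Mu x \<phi>)
  have "wsem m \<alpha> \<phi> (V(x := X)) \<subseteq> wsem m \<alpha> \<phi> (W(x := X))" for X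
    by (rule Mu.IH) (simp add: Mu.prems)
  then show ?case by (simp add: lfp_mono)
next
  case (Nu x \<phi>)
  have "wsem m \<alpha> \<phi> (V(x := X)) \<subseteq> wsem m \<alpha> \<phi> (W(x := X))" for X
    by (rule Nu.IH) (simp add: Nu.prems)
  then show ?case by (simp add: gfp_mono)
qed auto

lemma mono_wsem: "mono (\<lambda>X. wsem m \<alpha> \<phi> (V(x := X)))"
  by (intro monoI wsem_mono) simp

lemma mono_sem: "mono (\<lambda>X. sem n a d \<phi> (V(x := X)))"
  by (intro monoI sem_mono) simp

lemma wsem_cong_fv:
  "(\<And>x. x \<in> fv \<phi> \<Longrightarrow> V x \<inter> positions m = W x \<inter> positions m) \<Longrightarrow>
   (\<And>A. \<alpha> A \<inter> positions m = \<beta> A \<inter> positions m) \<Longrightarrow>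
   wsem m \<alpha> \<phi> V = wsem m \<beta> \<phi> W"
proof (induction \<phi> arbitrary: V W)
  case (Neg A)
  then have "\<alpha> A \<inter> positions m = \<beta> A \<inter> positions m" by simp
  then show ?case by auto
next
  case (Modal M \<phi>)
  then have "wsem m \<alpha> \<phi> V = wsem m \<beta> \<phi> W" by simp
  then show ?case by simp
next
  case (Or \<phi> \<psi>)
  have "wsem m \<alpha> \<phi> V = wsem m \<beta> \<phi> W" "wsem m \<alpha> \<psi> V = wsem m \<beta> \<psi> W"
    using Or by auto
  then show ?case by simp
next
  case (And \<phi> \<psi>)
  have "wsem m \<alpha> \<phi> V = wsem m \<beta> \<phi> W" "wsem m \<alpha> \<psi> V = wsem m \<beta> \<psi> W"
    using And by auto
  then show ?case by simp
next
  case (Mu x \<phi>)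
  have "wsem m \<alpha> \<phi> (V(x := X)) = wsem m \<beta> \<phi> (W(x := X))" for X
    by (rule Mu.IH) (auto simp: Mu.prems(2) Mu.prems(1)[simplified])
  then show ?case by simp
next
  case (Nu x \<phi>)
  have "wsem m \<alpha> \<phi> (V(x := X)) = wsem m \<beta> \<phi> (W(x := X))" for X
    by (rule Nu.IH) (auto simp: Nu.prems(2) Nu.prems(1)[simplified])
  then show ?case by simp
qed auto

text \<open>Fixpoint fusion along the pullback of \<open>X\<close> to
  \<open>{k. P k \<and> e k \<in> X}\<close>. The pullback has adjoints on both sides: the right one
  transports least fixpoints, the left one greatest fixpoints.\<close>

lemma lfp_fusion_vimage:
  assumes f: "mono f" and g: "mono g"
    and fg: "\<And>X. {k. P k \<and> e k \<in> f X} = g {k. P k \<and> e k \<in> X}"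
  shows "{k. P k \<and> e k \<in> lfp f} = lfp g"
proof
  \<comment> \<open>The right adjoint: \<open>X \<subseteq> ?R Y\<close> holds iff the pullback of
    \<open>X\<close> is contained in \<open>Y\<close>.\<close>
  let ?R = "\<lambda>Y. {i. \<forall>k. P k \<and> e k = i \<longrightarrow> k \<in> Y}"
  have "{k. P k \<and> e k \<in> f (?R (lfp g))} = g {k. P k \<and> e k \<in> ?R (lfp g)}" by (rule fg)
  also have "\<dots> \<subseteq> g (lfp g)" using g by (rule monoD) auto
  also have "\<dots> = lfp g" by (rule lfp_unfold[OF g, symmetric])
  finally have "f (?R (lfp g)) \<subseteq> ?R (lfp g)" by auto
  then have "lfp f \<subseteq> ?R (lfp g)" by (rule lfp_lowerbound)
  then show "{k. P k \<and> e k \<in> lfp f} \<subseteq> lfp g" by auto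
next
  have "g {k. P k \<and> e k \<in> lfp f} \<subseteq> {k. P k \<and> e k \<in> lfp f}"
    using fg[of "lfp f"] lfp_unfold[OF f] by auto
  then show "lfp g \<subseteq> {k. P k \<and> e k \<in> lfp f}" by (rule lfp_lowerbound)
qed

text \<open>Here the left adjoint, the direct image under \<open>e\<close>, plays the part of
  \<open>?R\<close>. A set lies in the pullback of its image only if it is contained in
  \<open>Collect P\<close>, which is what \<open>gP\<close> provides.\<close>

lemma gfp_fusion_vimage:
  assumes f: "mono f" and g: "mono g" and gP: "\<And>X. g X \<subseteq> Collect P"
    and fg: "\<And>X. {k. P k \<and> e k \<in> f X} = g {k. P k \<and> e k \<in> X}"
  shows "{k. P k \<and> e k \<in> gfp f} = gfp g"
proof
  have "gfp g = g (gfp g)" by (rule gfp_unfold[OF g])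
  with gP have gg: "gfp g \<subseteq> Collect P" by blast
  have "gfp g = g (gfp g)" by fact
  also have "\<dots> \<subseteq> g {k. P k \<and> e k \<in> e ` gfp g}" using g by (rule monoD) (use gg in auto)
  also have "\<dots> = {k. P k \<and> e k \<in> f (e ` gfp g)}" by (rule fg[symmetric])
  finally have "e ` gfp g \<subseteq> f (e ` gfp g)" by auto
  then have "e ` gfp g \<subseteq> gfp f" by (rule gfp_upperbound)
  then show "gfp g \<subseteq> {k. P k \<and> e k \<in> gfp f}" using gg by auto
next
  have "{k. P k \<and> e k \<in> gfp f} \<subseteq> g {k. P k \<and> e k \<in> gfp f}"
    using fg[of "gfp f"] gfp_unfold[OF f] by auto
  then show "{k. P k \<and> e k \<in> gfp f} \<subseteq> gfp g" by (rule gfp_upperbound)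
qed

text \<open>The fixpoints of \<open>sem\<close> range over sets of positions of the entire data
  word, those of \<open>wsem\<close> over sets of indices. By induction the pullback along
  \<open>e\<close> commutes with the body for every \<open>X\<close>, and fusion passes this on to
  the fixpoints.\<close>

lemma sem_eq_wsem:
  assumes pos: "\<And>k. enat k < m \<Longrightarrow> enat (e k) < n"
    and mv: "\<And>k j M. enat k < m \<Longrightarrow> M \<in> modalities \<phi> \<Longrightarrow> move n d M (e k) j \<longleftrightarrow>
      (if is_forward M then enat (Suc k) < m \<and> j = e (Suc k) else 0 < k \<and> j = e (k - 1))"
  shows "{k. enat k < m \<and> e k \<in> sem n a d \<phi> V} =
    wsem m (\<lambda>A. {k. enat k < m \<and> holds_atom n a d A (e k)}) \<phi> (\<lambda>x. {k. enat k < m \<and> e k \<in> V x})"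
  using mv
proof (induction \<phi> arbitrary: V)
  case (Modal M \<phi>)
  let ?W = "wsem m (\<lambda>A. {k. enat k < m \<and> holds_atom n a d A (e k)}) \<phi>
    (\<lambda>x. {k. enat k < m \<and> e k \<in> V x})"
  have IH: "{k. enat k < m \<and> e k \<in> sem n a d \<phi> V} = ?W"
    by (rule Modal.IH) (simp add: Modal.prems)
  have "(\<exists>j. move n d M (e k) j \<and> j \<in> sem n a d \<phi> V) \<longleftrightarrow>
    (if is_forward M then Suc k \<in> ?W else 0 < k \<and> k - 1 \<in> ?W)" if "enat k < m" for k
    using Modal.prems[OF that] enat_less_mono[OF that, of "k - 1"] by (auto simp: IH[symmetric])
  then show ?case using pos by (simp add: set_eq_iff cong: conj_cong)
next
  case (Or \<phi> \<psi>)
  have "{k. enat k < m \<and> e k \<in> sem n a d (Or \<phi> \<psi>) V} =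
    {k. enat k < m \<and> e k \<in> sem n a d \<phi> V} \<union> {k. enat k < m \<and> e k \<in> sem n a d \<psi> V}" by auto
  then show ?case using Or by simp
next
  case (And \<phi> \<psi>)
  have "{k. enat k < m \<and> e k \<in> sem n a d (And \<phi> \<psi>) V} =
    {k. enat k < m \<and> e k \<in> sem n a d \<phi> V} \<inter> {k. enat k < m \<and> e k \<in> sem n a d \<psi> V}" by auto
  then show ?case using And by simp
next
  case (Mu x \<phi>)
  let ?\<alpha> = "\<lambda>A. {k. enat k < m \<and> holds_atom n a d A (e k)}"
  let ?V = "\<lambda>x. {k. enat k < m \<and> e k \<in> V x}"
  have upd: "(\<lambda>y. {k. enat k < m \<and> e k \<in> (V(x := X)) y}) =
    ?V(x := {k. enat k < m \<and> e k \<in> X})" for X by (auto simp: fun_eq_iff)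
  have "{k. enat k < m \<and> e k \<in> sem n a d \<phi> (V(x := X))} =
    wsem m ?\<alpha> \<phi> (?V(x := {k. enat k < m \<and> e k \<in> X}))" for X
    unfolding upd[symmetric] by (rule Mu.IH) (simp add: Mu.prems)
  from lfp_fusion_vimage[OF mono_sem mono_wsem, of "\<lambda>k. enat k < m", OF this]
  show ?case by simp
next
  case (Nu x \<phi>)
  let ?\<alpha> = "\<lambda>A. {k. enat k < m \<and> holds_atom n a d A (e k)}"
  let ?V = "\<lambda>x. {k. enat k < m \<and> e k \<in> V x}"
  have upd: "(\<lambda>y. {k. enat k < m \<and> e k \<in> (V(x := X)) y}) =
    ?V(x := {k. enat k < m \<and> e k \<in> X})" for X by (auto simp: fun_eq_iff)
  have *: "{k. enat k < m \<and> e k \<in> sem n a d \<phi> (V(x := X))} =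
    wsem m ?\<alpha> \<phi> (?V(x := {k. enat k < m \<and> e k \<in> X}))" for X
    unfolding upd[symmetric] by (rule Nu.IH) (simp add: Nu.prems)
  have "{k. enat k < m \<and> e k \<in> gfp (\<lambda>X. sem n a d \<phi> (V(x := X)))} =
    gfp (\<lambda>X. wsem m ?\<alpha> \<phi> (?V(x := X)))"
    by (rule gfp_fusion_vimage[OF mono_sem mono_wsem _ *])
      (use wsem_subset_positions in \<open>force simp: positions_def\<close>)
  then show ?case by simp
qed (auto simp: pos)

text \<open>Locality: a fixpoint computed over all classes at once splits into independent fixpoints
  on the single classes, each seeing only the labelling of its own class.\<close>

lemma sem_on_chain:
  assumes "modalities \<phi> \<subseteq> {next_mod cl, prev_mod cl}"
    and "C = chain_of cl n d i" and "enat k < csize C"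
  shows "enum_set C k \<in> sem n a d \<phi> V \<longleftrightarrow>
    k \<in> wsem (csize C) (\<lambda>A. {k. enat k < csize C \<and> holds_atom n a d A (enum_set C k)}) \<phi>
      (\<lambda>x. {k. enat k < csize C \<and> enum_set C k \<in> V x})"
proof -
  have "enat (enum_set C k) < n" if "enat k < csize C" for k
    using enum_set_in[OF that] chain_of_subset[of cl n d i] assms(2) by auto
  moreover have "move n d M (enum_set C k) j \<longleftrightarrow> (if is_forward M
      then enat (Suc k) < csize C \<and> j = enum_set C (Suc k)
      else 0 < k \<and> j = enum_set C (k - 1))"
    if "enat k < csize C" "M \<in> modalities \<phi>" for k j M
    unfolding assms(2) by (rule move_on_chain) (use that assms in auto)
  ultimately show ?thesis
    using sem_eq_wsem[of "csize C" "enum_set C" n \<phi> d a V] assms(3) by (auto simp: set_eq_iff)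
qed

section \<open>Regular properties of words\<close>

definition seg :: "(nat \<Rightarrow> 'c) \<Rightarrow> nat \<Rightarrow> nat \<Rightarrow> 'c list" where
  "seg u i j = map u [i..<j]"

lemma seg_simps:
  "length (seg u i j) = j - i"
  "k < j - i \<Longrightarrow> seg u i j ! k = u (i + k)"
  "i < j \<Longrightarrow> seg u i j \<noteq> []"
  "i < j \<Longrightarrow> hd (seg u i j) = u i"
  "i < j \<Longrightarrow> last (seg u i j) = u (j - 1)"
  by (auto simp: seg_def hd_map last_map)

lemma seg_eq_iff: "seg u i j = seg v i j \<longleftrightarrow> (\<forall>k. i \<le> k \<and> k < j \<longrightarrow> u k = v k)"
  by (auto simp: seg_def)

lemma successively_seg:
  "successively R (seg u i j) \<longleftrightarrow> (\<forall>k. i \<le> k \<and> Suc k < j \<longrightarrow> R (u k) (u (Suc k)))"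
proof -
  have "successively R (seg u i j) \<longleftrightarrow> (\<forall>k. Suc k < j - i \<longrightarrow> R (u (i + k)) (u (Suc (i + k))))"
    by (auto simp: successively_conv_nth seg_simps)
  also have "\<dots> \<longleftrightarrow> (\<forall>k. i \<le> k \<and> Suc k < j \<longrightarrow> R (u k) (u (Suc k)))"
    by (metis add_diff_cancel_left' diff_less_mono le_Suc_ex le_add1 less_diff_conv2 le_SucI
        add.commute less_diff_conv add_Suc)
  finally show ?thesis .
qed

section \<open>Factorizations of omega-words and finite congruences\<close>

definition factorization :: "(nat \<Rightarrow> nat) \<Rightarrow> bool" where
  "factorization f \<longleftrightarrow> strict_mono f \<and> f 0 = 0"

definition block :: "(nat \<Rightarrow> nat) \<Rightarrow> nat \<Rightarrow> nat" where
  "block f i = (LEAST l. i < f (Suc l))"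

lemma factorization_step: "factorization f \<Longrightarrow> f l < f (Suc l)"
  by (simp add: factorization_def strict_mono_Suc_iff)

lemma block_bounds:
  assumes "factorization f"
  shows "f (block f i) \<le> i" "i < f (Suc (block f i))"
proof -
  have "Suc i \<le> f (Suc i)"
    using assms by (simp add: factorization_def strict_mono_imp_increasing)
  then have "i < f (Suc i)" by simp
  then show "i < f (Suc (block f i))" unfolding block_def by (rule LeastI)
  show "f (block f i) \<le> i"
  proof (cases "block f i")
    case 0
    then show ?thesis using assms by (simp add: factorization_def)
  next
    case (Suc l)
    then have "\<not> i < f (Suc l)"
      using not_less_Least[of l "\<lambda>l. i < f (Suc l)"] by (simp add: block_def)
    then show ?thesis using Suc by simp
  qed
qed

lemma block_eq:
  assumes "factorization f" "f l \<le> i" "i < f (Suc l)"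
  shows "block f i = l"
proof -
  have "f (block f i) < f (Suc l)" "f l < f (Suc (block f i))"
    using block_bounds[OF assms(1), of i] assms(2,3) by linarith+
  then show ?thesis using assms(1) by (simp add: factorization_def strict_mono_less)
qed

definition recognizes :: "('c list \<Rightarrow> 's) \<Rightarrow> (enat \<Rightarrow> (nat \<Rightarrow> 'c) \<Rightarrow> bool) \<Rightarrow> bool" where
  "recognizes h Q \<longleftrightarrow> finite (range h) \<and>
     (\<forall>x x' y y'. h x = h x' \<longrightarrow> h y = h y' \<longrightarrow> h (x @ y) = h (x' @ y')) \<and>
     (\<forall>u u' k k'. 0 < k \<longrightarrow> 0 < k' \<longrightarrow> h (seg u 0 k) = h (seg u' 0 k') \<longrightarrow>
        Q (enat k) u = Q (enat k') u') \<and>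
     (\<forall>u u' f f'. factorization f \<longrightarrow> factorization f' \<longrightarrow>
        (\<forall>l. h (seg u (f l) (f (Suc l))) = h (seg u' (f' l) (f' (Suc l)))) \<longrightarrow>
        Q \<infinity> u = Q \<infinity> u')"

text \<open>
  Recognition by a finite congruence on finite words that saturates the property along every
  factorization.  In this form complement and projection are immediate; Ramsey's theorem is
  only needed to pass to Buechi automata.
\<close>

definition regular :: "(enat \<Rightarrow> (nat \<Rightarrow> 'c) \<Rightarrow> bool) \<Rightarrow> bool" where
  "regular Q \<longleftrightarrow> (\<exists>h :: 'c list \<Rightarrow> nat. recognizes h Q)"

text \<open>The premises are symmetric in the two words, so transferring \<open>Q\<close> in one
  direction is enough.\<close>

lemma recognizesI:
  assumes "finite (range h)"
    and "\<And>x x' y y'. h x = h x' \<Longrightarrow> h y = h y' \<Longrightarrow> h (x @ y) = h (x' @ y')"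
    and "\<And>u u' k k'. 0 < k \<Longrightarrow> 0 < k' \<Longrightarrow> h (seg u 0 k) = h (seg u' 0 k') \<Longrightarrow>
        Q (enat k) u \<Longrightarrow> Q (enat k') u'"
    and "\<And>u u' f f'. factorization f \<Longrightarrow> factorization f' \<Longrightarrow>
        (\<And>l. h (seg u (f l) (f (Suc l))) = h (seg u' (f' l) (f' (Suc l)))) \<Longrightarrow>
        Q \<infinity> u \<Longrightarrow> Q \<infinity> u'"
  shows "recognizes h Q"
proof -
  have "Q (enat k) u = Q (enat k') u'" if "0 < k" "0 < k'" "h (seg u 0 k) = h (seg u' 0 k')"
    for u u' k k'
    using assms(3)[OF that] assms(3)[OF that(2,1) that(3)[symmetric]] by blast
  moreover have "Q \<infinity> u = Q \<infinity> u'" if "factorization f" "factorization f'"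
    "\<And>l. h (seg u (f l) (f (Suc l))) = h (seg u' (f' l) (f' (Suc l)))" for u u' f f'
    using assms(4)[OF that] assms(4)[OF that(2,1) that(3)[symmetric]] by blast
  ultimately show ?thesis
    unfolding recognizes_def using assms(1,2) by blast
qed

lemma recognizesD:
  assumes "recognizes h Q"
  shows "finite (range h)"
    and "\<And>x x' y y'. h x = h x' \<Longrightarrow> h y = h y' \<Longrightarrow> h (x @ y) = h (x' @ y')"
    and "\<And>u u' k k'. 0 < k \<Longrightarrow> 0 < k' \<Longrightarrow> h (seg u 0 k) = h (seg u' 0 k') \<Longrightarrow>
        Q (enat k) u = Q (enat k') u'"
    and "\<And>u u' f f'. factorization f \<Longrightarrow> factorization f' \<Longrightarrow>
        (\<And>l. h (seg u (f l) (f (Suc l))) = h (seg u' (f' l) (f' (Suc l)))) \<Longrightarrow>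
        Q \<infinity> u = Q \<infinity> u'"
proof -
  note r = assms[unfolded recognizes_def]
  show "finite (range h)" by (rule conjunct1[OF r])
  show "h (x @ y) = h (x' @ y')" if "h x = h x'" "h y = h y'" for x x' y y'
    using conjunct1[OF conjunct2[OF r]] that by (elim allE impE)
  show "Q (enat k) u = Q (enat k') u'"
    if "0 < k" "0 < k'" "h (seg u 0 k) = h (seg u' 0 k')" for u u' k k'
    using conjunct1[OF conjunct2[OF conjunct2[OF r]]] that by (elim allE impE)
  show "Q \<infinity> u = Q \<infinity> u'" if "factorization f" "factorization f'"
    "\<And>l. h (seg u (f l) (f (Suc l))) = h (seg u' (f' l) (f' (Suc l)))" for u u' f f'
    using conjunct2[OF conjunct2[OF conjunct2[OF r]]] that(1,2) allI[OF that(3)]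
    by (elim allE impE)
qed

lemmas recognizes_cong = recognizesD(2)
lemmas recognizes_fin = recognizesD(3)
lemmas recognizes_inf = recognizesD(4)

text \<open>A definition cannot quantify over the type of the values of \<open>h\<close>, so
  \<open>regular\<close> fixes \<open>nat\<close>. Only the kernel of \<open>h\<close> matters, and
  finitely many values can be renumbered.\<close>

lemma regularI:
  fixes h :: "'c list \<Rightarrow> 's"
  assumes "recognizes h Q"
  shows "regular Q"
proof -
  have "finite (range h)" by (rule recognizesD(1)[OF assms])
  then obtain g :: "'s \<Rightarrow> nat" where g: "inj_on g (range h)"
    using finite_imp_inj_to_nat_seg by meson
  have eq: "g (h x) = g (h y) \<longleftrightarrow> h x = h y" for x y using g by (simp add: inj_on_eq_iff)
  have "finite (range (g \<circ> h))"
    unfolding image_comp[symmetric] using \<open>finite (range h)\<close> by (rule finite_imageI)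
  then have "recognizes (g \<circ> h) Q"
    using recognizesD[OF assms] by (intro recognizesI) (unfold comp_def eq, blast+)
  then show ?thesis by (auto simp: regular_def)
qed

lemma regularE:
  assumes "regular Q"
  obtains h :: "'c list \<Rightarrow> nat" where "recognizes h (Q :: enat \<Rightarrow> (nat \<Rightarrow> 'c) \<Rightarrow> bool)"
  using assms by (auto simp: regular_def)

text \<open>Lengths are positive in the definition of \<open>recognizes\<close>, so the two
  properties may differ on the empty word.\<close>

lemma regular_cong:
  assumes "regular Q" "\<And>n u. 0 < n \<Longrightarrow> Q n u \<longleftrightarrow> Q' n u"
  shows "regular Q'"
proof -
  obtain h :: "_ \<Rightarrow> nat" where h: "recognizes h Q" using assms(1) by (rule regularE)
  have "Q (enat k) u = Q' (enat k) u" if "0 < k" for k u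
    using assms(2) that by (simp add: zero_enat_def)
  moreover have "Q \<infinity> u = Q' \<infinity> u" for u using assms(2) by simp
  ultimately have "recognizes h Q'"
    using recognizesD[OF h] by (intro recognizesI) metis+
  then show ?thesis by (rule regularI)
qed

text \<open>Recognition looks at \<open>u\<close> through \<open>seg u 0 k\<close> only, which hides
  all letters from index \<open>k\<close> on.\<close>

lemma regular_depends:
  assumes "regular Q" "0 < n" "\<And>i. enat i < n \<Longrightarrow> u i = u' i"
  shows "Q n u = Q n u'"
proof (cases n)
  case (enat k)
  obtain h :: "_ \<Rightarrow> nat" where h: "recognizes h Q" using assms(1) by (rule regularE)
  have "seg u 0 k = seg u' 0 k" using assms(3) enat by (simp add: seg_eq_iff)
  moreover have "0 < k" using assms(2) enat by (simp add: zero_enat_def)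
  ultimately show ?thesis using recognizes_fin[OF h] enat by metis
next
  case infinity
  then have "u = u'" using assms(3) by auto
  then show ?thesis by simp
qed

section \<open>Closure properties\<close>

lemma regular_Not:
  assumes "regular Q"
  shows "regular (\<lambda>n u. \<not> Q n u)"
proof -
  obtain h :: "_ \<Rightarrow> nat" where h: "recognizes h Q" using assms by (rule regularE)
  then have "recognizes h (\<lambda>n u. \<not> Q n u)"
    using recognizesD[OF h] by (intro recognizesI) metis+
  then show ?thesis by (rule regularI)
qed

lemma regular_conj:
  assumes "regular Q" "regular Q'"
  shows "regular (\<lambda>n u. Q n u \<and> Q' n u)"
proof -
  obtain h h' :: "_ \<Rightarrow> nat" where h: "recognizes h Q" "recognizes h' Q'" using assms by (metis regularE)
  have "finite (range (\<lambda>x. (h x, h' x)))"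
    by (rule finite_subset[of _ "range h \<times> range h'"]) (use h[THEN recognizesD(1)] in auto)
  then have "recognizes (\<lambda>x. (h x, h' x)) (\<lambda>n u. Q n u \<and> Q' n u)"
  proof (rule recognizesI)
    show "(h (x @ y), h' (x @ y)) = (h (x' @ y'), h' (x' @ y'))"
      if "(h x, h' x) = (h x', h' x')" "(h y, h' y) = (h y', h' y')" for x x' y y'
      using that recognizes_cong[OF h(1), of x x' y y'] recognizes_cong[OF h(2), of x x' y y']
      unfolding prod.inject by blast
    show "Q (enat k') u' \<and> Q' (enat k') u'"
      if "0 < k" "0 < k'" "(h (seg u 0 k), h' (seg u 0 k)) = (h (seg u' 0 k'), h' (seg u' 0 k'))"
        "Q (enat k) u \<and> Q' (enat k) u" for u u' k k'
      using that recognizes_fin[OF h(1), of k k' u u'] recognizes_fin[OF h(2), of k k' u u']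
      unfolding prod.inject by blast
    show "Q \<infinity> u' \<and> Q' \<infinity> u'"
      if "factorization f" "factorization f'" and
        "\<And>l. (h (seg u (f l) (f (Suc l))), h' (seg u (f l) (f (Suc l)))) =
          (h (seg u' (f' l) (f' (Suc l))), h' (seg u' (f' l) (f' (Suc l))))"
        "Q \<infinity> u \<and> Q' \<infinity> u" for u u' f f'
      using that recognizes_inf[OF h(1), of f f' u u'] recognizes_inf[OF h(2), of f f' u u']
      unfolding prod.inject by blast
  qed
  then show ?thesis by (rule regularI)
qed

lemma map_seg: "map g (seg u i j) = seg (g \<circ> u) i j"
  by (simp add: seg_def)

lemma regular_map:
  assumes "regular Q"
  shows "regular (\<lambda>n u. Q n (\<lambda>i. g (u i)))"
proof -
  obtain h :: "_ \<Rightarrow> nat" where h: "recognizes h Q" using assms by (rule regularE)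
  have "finite (range (\<lambda>x. h (map g x)))"
    by (rule finite_subset[of _ "range h"]) (use recognizesD(1)[OF h] in auto)
  then have "recognizes (\<lambda>x. h (map g x)) (\<lambda>n u. Q n (\<lambda>i. g (u i)))"
  proof (rule recognizesI)
    show "h (map g (x @ y)) = h (map g (x' @ y'))"
      if "h (map g x) = h (map g x')" "h (map g y) = h (map g y')" for x x' y y'
      using recognizes_cong[OF h that] by simp
    show "Q (enat k') (\<lambda>i. g (u' i))"
      if "0 < k" "0 < k'" "h (map g (seg u 0 k)) = h (map g (seg u' 0 k'))"
        "Q (enat k) (\<lambda>i. g (u i))" for u u' k k'
      using recognizes_fin[OF h that(1,2) that(3)[unfolded map_seg]] that(4) by (simp add: comp_def)
    show "Q \<infinity> (\<lambda>i. g (u' i))"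
      if "factorization f" "factorization f'" and
        "\<And>l. h (map g (seg u (f l) (f (Suc l)))) = h (map g (seg u' (f' l) (f' (Suc l))))"
        "Q \<infinity> (\<lambda>i. g (u i))" for u u' f f'
      using recognizes_inf[OF h that(1,2) that(3)[unfolded map_seg]] that(4) by (simp add: comp_def)
  qed
  then show ?thesis by (rule regularI)
qed

text \<open>Powerset construction for congruences: \<open>H x\<close> collects the values of
  \<open>h\<close> over all labellings of \<open>x\<close>. On omega-words a labelling of
  \<open>u\<close> is transferred to \<open>u'\<close> block by block, and the pieces are glued
  along \<open>f'\<close>.\<close>

lemma regular_ex:
  fixes Q :: "enat \<Rightarrow> (nat \<Rightarrow> 'c \<times> 'b) \<Rightarrow> bool"
  assumes "regular Q"
  shows "regular (\<lambda>n u. \<exists>y. Q n (\<lambda>i. (u i, y i)))"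
proof -
  obtain h :: "_ \<Rightarrow> nat" where h: "recognizes h Q" using assms by (rule regularE)
  define H where "H x = {h (zip x y) | y. length y = length x}" for x
  have H_seg: "h (seg (\<lambda>i. (u i, y i)) i j) \<in> H (seg u i j)" for u and y :: "nat \<Rightarrow> 'b" and i j
  proof -
    have "seg (\<lambda>i. (u i, y i)) i j = zip (seg u i j) (seg y i j)"
      by (auto simp: seg_def zip_map_map intro!: nth_equalityI)
    then show ?thesis by (auto simp: H_def seg_simps)
  qed
  \<comment> \<open>The labelling is indexed relative to the start \<open>i\<close> of the segment,
    so that labellings of different blocks can be chosen independently.\<close>
  have H_segE: "\<exists>y. t = h (seg (\<lambda>k. (u k, y (k - i))) i j)" if t: "t \<in> H (seg u i j)" for t u i j
  proof -
    obtain y where y: "length y = j - i" "t = h (zip (seg u i j) y)"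
      using t unfolding H_def seg_simps by blast
    have "zip (seg u i j) y = seg (\<lambda>k. (u k, y ! (k - i))) i j"
      using y(1) by (auto simp: seg_def intro!: nth_equalityI)
    then show ?thesis using y(2) by (intro exI[of _ "(!) y"]) simp
  qed
  have "recognizes H (\<lambda>n u. \<exists>y. Q n (\<lambda>i. (u i, y i)))"
  proof (rule recognizesI)
    show "finite (range H)"
      by (rule finite_subset[of _ "Pow (range h)"]) (use recognizesD(1)[OF h] in \<open>auto simp: H_def\<close>)
  next
    \<comment> \<open>A labelling of \<open>x @ y\<close> is a labelling of \<open>x\<close>
      followed by one of \<open>y\<close>; this makes \<open>H\<close> a congruence.\<close>
    have app: "H (x @ y) = {h (zip x v @ zip y w) | v w. length v = length x \<and> length w = length y}"
      for x y
    proof -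
      have "h (zip (x @ y) z) = h (zip x (take (length x) z) @ zip y (drop (length x) z))"
        if "length z = length x + length y" for z
        by (simp add: zip_append1)
      then have "H (x @ y) \<subseteq> {h (zip x v @ zip y w) | v w. length v = length x \<and> length w = length y}"
        unfolding H_def by fastforce
      moreover have "h (zip x v @ zip y w) \<in> H (x @ y)"
        if "length v = length x" "length w = length y" for v w
        unfolding H_def using that by (intro CollectI exI[of _ "v @ w"]) simp
      ultimately show ?thesis by blast
    qed
    have sub: "H (x @ y) \<subseteq> H (x' @ y')" if "H x = H x'" "H y = H y'" for x x' y y'
    proof
      fix t assume "t \<in> H (x @ y)"
      then obtain v w where vw: "t = h (zip x v @ zip y w)" "length v = length x" "length w = length y"
        unfolding app by blast
      then have "h (zip x v) \<in> H x'" "h (zip y w) \<in> H y'" using that by (auto simp: H_def)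
      then obtain v' w' where "h (zip x v) = h (zip x' v')" "h (zip y w) = h (zip y' w')"
        "length v' = length x'" "length w' = length y'" by (auto simp: H_def)
      then show "t \<in> H (x' @ y')" unfolding app vw using recognizes_cong[OF h] by blast
    qed
    show "H (x @ y) = H (x' @ y')" if "H x = H x'" "H y = H y'" for x x' y y'
      using sub[OF that] sub[OF that[symmetric]] by blast
  next
    fix u u' :: "nat \<Rightarrow> 'c" and k k'
    assume k: "0 < k" "0 < k'" and eq: "H (seg u 0 k) = H (seg u' 0 k')"
      and "\<exists>y. Q (enat k) (\<lambda>i. (u i, y i))"
    then obtain y where y: "Q (enat k) (\<lambda>i. (u i, y i))" by blast
    have "h (seg (\<lambda>i. (u i, y i)) 0 k) \<in> H (seg u' 0 k')" using H_seg eq by metis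
    then obtain y' where "h (seg (\<lambda>i. (u i, y i)) 0 k) = h (seg (\<lambda>i. (u' i, y' i)) 0 k')"
      using H_segE[of _ u' 0 k'] by auto
    then show "\<exists>y. Q (enat k') (\<lambda>i. (u' i, y i))"
      using recognizes_fin[OF h k] y by blast
  next
    fix u u' :: "nat \<Rightarrow> 'c" and f f'
    assume f: "factorization f" "factorization f'"
      and eq: "\<And>l. H (seg u (f l) (f (Suc l))) = H (seg u' (f' l) (f' (Suc l)))"
      and "\<exists>y. Q \<infinity> (\<lambda>i. (u i, y i))"
    then obtain y where y: "Q \<infinity> (\<lambda>i. (u i, y i))" by blast
    have "\<exists>z. h (seg (\<lambda>i. (u i, y i)) (f l) (f (Suc l))) =
      h (seg (\<lambda>i. (u' i, z (i - f' l))) (f' l) (f' (Suc l)))" for l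
      by (rule H_segE) (use H_seg eq in metis)
    then obtain z where z: "\<And>l. h (seg (\<lambda>i. (u i, y i)) (f l) (f (Suc l))) =
      h (seg (\<lambda>i. (u' i, z l (i - f' l))) (f' l) (f' (Suc l)))" by metis
    \<comment> \<open>Gluing: position \<open>i\<close> looks up the labelling of its own block at
      its offset within that block.\<close>
    define y' where "y' i = z (block f' i) (i - f' (block f' i))" for i
    have "seg (\<lambda>i. (u' i, z l (i - f' l))) (f' l) (f' (Suc l)) =
      seg (\<lambda>i. (u' i, y' i)) (f' l) (f' (Suc l))" for l
      unfolding seg_eq_iff y'_def using block_eq[OF f(2)] by auto
    then have "Q \<infinity> (\<lambda>i. (u' i, y' i))" using recognizes_inf[OF h f] z y by metis
    then show "\<exists>y. Q \<infinity> (\<lambda>i. (u' i, y i))" by blast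
  qed
  then show ?thesis by (rule regularI)
qed

section \<open>Local properties\<close>

text \<open>First letter, last letter and validity of \<open>R\<close> inside the word form a
  congruence, since concatenation creates just one new adjacent pair, made of a last and a first
  letter. Finiteness of the alphabet makes its range finite; \<open>None\<close> stands for the
  empty word.\<close>

lemma regular_local_finite:
  fixes R :: "'s :: finite \<Rightarrow> 's \<Rightarrow> bool"
  shows "regular (\<lambda>n u. F (u 0) \<and> (\<forall>i. enat (Suc i) < n \<longrightarrow> R (u i) (u (Suc i))) \<and>
    (\<forall>k. n = enat (Suc k) \<longrightarrow> L (u k)))"
proof -
  define h where "h x = (if x = [] then None else Some (hd x, last x, successively R x))" for x
  have h_seg: "h (seg u i j) = Some (u i, u (j - 1), successively R (seg u i j))" if "i < j" for u i j
    using that by (simp add: h_def seg_simps)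
  have "recognizes h (\<lambda>n u. F (u 0) \<and> (\<forall>i. enat (Suc i) < n \<longrightarrow> R (u i) (u (Suc i))) \<and>
    (\<forall>k. n = enat (Suc k) \<longrightarrow> L (u k)))" (is "recognizes h ?Q")
  proof (rule recognizesI)
    show "finite (range h)" by (rule finite)
  next
    show "h (x @ y) = h (x' @ y')" if "h x = h x'" "h y = h y'" for x x' y y'
      using that by (auto simp: h_def successively_append_iff split: if_splits)
  next
    fix u u' k k'
    assume k: "0 < k" "0 < k'" and eq: "h (seg u 0 k) = h (seg u' 0 k')" and Q: "?Q (enat k) u"
    have "u 0 = u' 0" "u (k - 1) = u' (k' - 1)"
      "successively R (seg u 0 k) = successively R (seg u' 0 k')"
      using eq h_seg k by auto
    then show "?Q (enat k') u'" using Q k by (auto simp: successively_seg gr0_conv_Suc)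
  next
    fix u u' f f'
    assume f: "factorization f" "factorization f'"
      and eq: "\<And>l. h (seg u (f l) (f (Suc l))) = h (seg u' (f' l) (f' (Suc l)))"
      and Q: "?Q \<infinity> u"
    note step = factorization_step[OF f(1)] factorization_step[OF f(2)]
    have eqs: "u (f l) = u' (f' l)" "u (f (Suc l) - 1) = u' (f' (Suc l) - 1)"
      "successively R (seg u (f l) (f (Suc l))) = successively R (seg u' (f' l) (f' (Suc l)))" for l
      using eq[of l] h_seg[OF step(1)] h_seg[OF step(2)] by auto
    have "R (u' i) (u' (Suc i))" for i
    proof -
      let ?l = "block f' i"
      note b = block_bounds[OF f(2), of i]
      show ?thesis
      proof (cases "Suc i < f' (Suc ?l)")
        case True
        then show ?thesis using eqs(3)[of ?l] Q b by (auto simp: successively_seg)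
      next
        \<comment> \<open>The pair straddles two blocks. Its components are the last letter of one
          block and the first letter of the next, and \<open>h\<close> records both.\<close>
        case False
        then have i: "i = f' (Suc ?l) - 1" "Suc i = f' (Suc ?l)" using b by auto
        have "Suc (f (Suc ?l) - 1) = f (Suc ?l)" using step(1)[of ?l] by simp
        then have "R (u (f (Suc ?l) - 1)) (u (f (Suc ?l)))"
          using Q by (metis enat_ord_code(4))
        then have "R (u' (f' (Suc ?l) - 1)) (u' (f' (Suc ?l)))" unfolding eqs .
        then show ?thesis using i by metis
      qed
    qed
    moreover have "u 0 = u' 0" using eqs(1)[of 0] f by (simp add: factorization_def)
    ultimately show "?Q \<infinity> u'" using Q by simp
  qed
  then show ?thesis by (rule regularI)
qed

text \<open>The letters of \<open>u\<close> may come from an infinite type; only their images under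
  \<open>g\<close> have to be in a finite one.\<close>

lemma regular_local:
  fixes R :: "'s :: finite \<Rightarrow> 's \<Rightarrow> bool"
  shows "regular (\<lambda>n u. F (g (u 0)) \<and> (\<forall>i. enat (Suc i) < n \<longrightarrow> R (g (u i)) (g (u (Suc i)))) \<and>
    (\<forall>k. n = enat (Suc k) \<longrightarrow> L (g (u k))))"
  by (rule regular_map[OF regular_local_finite[of F R L], of g])

lemma not_Suc_less_iff: "enat i < n \<Longrightarrow> \<not> enat (Suc i) < n \<longleftrightarrow> n = enat (Suc i)"
  by (cases n) auto

text \<open>Splits off the last position, if there is one, to fit the clauses for adjacent pairs and
  for the last letter in \<open>regular_local\<close>.\<close>

lemma all_less_split:
  "(\<forall>i. enat i < n \<longrightarrow> P i) \<longleftrightarrow>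
   (\<forall>i. enat (Suc i) < n \<longrightarrow> P i) \<and> (\<forall>k. n = enat (Suc k) \<longrightarrow> P k)"
  using not_Suc_less_iff enat_less_mono[of "Suc _" n] by (metis enat_ord_simps(2) le_SucI le_refl lessI)

lemma all_less_split_first:
  assumes "0 < n"
  shows "(\<forall>i. enat i < n \<longrightarrow> P i) \<longleftrightarrow> P 0 \<and> (\<forall>i. enat (Suc i) < n \<longrightarrow> P (Suc i))"
  using assms by (metis not0_implies_Suc zero_enat_def)

lemma regular_first:
  fixes P :: "'c \<Rightarrow> bool"
  shows "regular (\<lambda>n u. P (u 0))"
  using regular_local[of "\<lambda>b. b" P "\<lambda>_ _. True" "\<lambda>_. True"] by simp

lemma regular_all:
  fixes P :: "'c \<Rightarrow> bool"
  shows "regular (\<lambda>n u. \<forall>i. enat i < n \<longrightarrow> P (u i))"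
proof (rule regular_cong[OF regular_local[of "\<lambda>b. b" P "\<lambda>_ b. b" "\<lambda>_. True"]])
  fix n :: enat and u :: "nat \<Rightarrow> 'c"
  assume "0 < n"
  then show "P (u 0) \<and> (\<forall>i. enat (Suc i) < n \<longrightarrow> P (u (Suc i))) \<and>
      (\<forall>k. n = enat (Suc k) \<longrightarrow> True) \<longleftrightarrow> (\<forall>i. enat i < n \<longrightarrow> P (u i))"
    by (simp add: all_less_split_first)
qed

section \<open>Regular set-valued operators\<close>

text \<open>Regularity of the graph of \<open>F\<close>: a second track of the word carries the
  characteristic function of the value. Composing operators then amounts to quantifying over a
  track.\<close>

definition regular_op :: "(enat \<Rightarrow> (nat \<Rightarrow> 'c) \<Rightarrow> nat set) \<Rightarrow> bool" where
  "regular_op F \<longleftrightarrow>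
     regular (\<lambda>n u. \<forall>i. enat i < n \<longrightarrow> (snd (u i) \<longleftrightarrow> i \<in> F n (\<lambda>i. fst (u i))))"

lemma regular_op_map:
  assumes "regular_op F"
  shows "regular_op (\<lambda>n u. F n (\<lambda>i. g (u i)))"
  using regular_map[OF assms[unfolded regular_op_def], of "\<lambda>c. (g (fst c), snd c)"]
  unfolding regular_op_def fst_conv snd_conv .

text \<open>Guess the value of \<open>F\<close> on an additional track, check it with the graph, and
  project it away. Below \<open>n\<close> the guess is forced, and by \<open>regular_depends\<close>
  its other bits have no influence on \<open>Q\<close>.\<close>

lemma regular_comp:
  assumes "regular_op F" "regular Q"
  shows "regular (\<lambda>n u. Q n (\<lambda>i. (u i, i \<in> F n u)))"
proof (rule regular_cong)
  let ?E = "\<lambda>n u. (\<forall>i. enat i < n \<longrightarrow> (snd (u i) \<longleftrightarrow> i \<in> F n (\<lambda>i. fst (u i)))) \<and> Q n u"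
  show "regular (\<lambda>n u. \<exists>y. ?E n (\<lambda>i. (u i, y i)))"
    by (rule regular_ex[OF regular_conj]) (use assms in \<open>auto simp: regular_op_def\<close>)
  fix n u assume n: "0 < (n :: enat)"
  have "Q n (\<lambda>i. (u i, y i)) \<longleftrightarrow> Q n (\<lambda>i. (u i, i \<in> F n u))"
    if "\<And>i. enat i < n \<Longrightarrow> y i \<longleftrightarrow> i \<in> F n u" for y
    by (rule regular_depends[OF assms(2) n]) (use that in auto)
  note dep = this
  show "(\<exists>y. ?E n (\<lambda>i. (u i, y i))) \<longleftrightarrow> Q n (\<lambda>i. (u i, i \<in> F n u))"
  proof
    assume "\<exists>y. ?E n (\<lambda>i. (u i, y i))"
    then obtain y where "\<forall>i. enat i < n \<longrightarrow> (y i \<longleftrightarrow> i \<in> F n u)" "Q n (\<lambda>i. (u i, y i))"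
      unfolding fst_conv snd_conv by (elim exE conjE) (rule that)
    then show "Q n (\<lambda>i. (u i, i \<in> F n u))" using dep[of y] by blast
  next
    assume "Q n (\<lambda>i. (u i, i \<in> F n u))"
    then have "?E n (\<lambda>i. (u i, i \<in> F n u))" by simp
    then show "\<exists>y. ?E n (\<lambda>i. (u i, y i))" by (rule exI[of _ "\<lambda>i. i \<in> F n u"])
  qed
qed

lemma regular_all_comp:
  assumes "regular_op F"
  shows "regular (\<lambda>n u. \<forall>i. enat i < n \<longrightarrow> P (u i) (i \<in> F n u))"
  using regular_comp[OF assms regular_all[of "\<lambda>c. P (fst c) (snd c)"]] by simp

lemma regular_op_pointwise: "regular_op (\<lambda>n u. {i. P (u i)})"
  unfolding regular_op_def using regular_all[of "\<lambda>c. snd c \<longleftrightarrow> P (fst c)"] by simp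

lemma regular_op_bool:
  assumes "regular_op F" "regular_op G"
  shows "regular_op (\<lambda>n u. {i. P (i \<in> F n u) (i \<in> G n u)})"
proof -
  have F: "regular_op (\<lambda>n u. F n (\<lambda>i. fst (fst (u i))))" and G: "regular_op (\<lambda>n u. G n (\<lambda>i. fst (u i)))"
    using assms by (auto intro: regular_op_map)
  from regular_comp[OF G regular_all_comp[OF F, of "\<lambda>c b. snd (fst c) \<longleftrightarrow> P b (snd c)"]]
  show ?thesis unfolding regular_op_def by simp
qed

lemma regular_op_first: "regular_op (\<lambda>n u. {0})"
  unfolding regular_op_def
proof (rule regular_cong[OF regular_local[of "\<lambda>b. b" snd "\<lambda>_ b. \<not> b" "\<lambda>_. True"]])
  fix n :: enat and u :: "nat \<Rightarrow> 'b \<times> bool"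
  assume "0 < n"
  then show "snd (u 0) \<and> (\<forall>i. enat (Suc i) < n \<longrightarrow> \<not> snd (u (Suc i))) \<and>
      (\<forall>k. n = enat (Suc k) \<longrightarrow> True) \<longleftrightarrow> (\<forall>i. enat i < n \<longrightarrow> snd (u i) = (i \<in> {0}))"
    by (simp add: all_less_split_first)
qed

lemma regular_op_last: "regular_op (\<lambda>n u. {i. \<not> enat (Suc i) < n})"
  unfolding regular_op_def
proof (rule regular_cong[OF regular_local[of "\<lambda>_. True" snd "\<lambda>b _. \<not> b" "\<lambda>b. b"]])
  fix n :: enat and u :: "nat \<Rightarrow> 'b \<times> bool"
  show "True \<and> (\<forall>i. enat (Suc i) < n \<longrightarrow> \<not> snd (u i)) \<and>
      (\<forall>k. n = enat (Suc k) \<longrightarrow> snd (u k)) \<longleftrightarrow>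
      (\<forall>i. enat i < n \<longrightarrow> snd (u i) = (i \<in> {i. \<not> enat (Suc i) < n}))"
    unfolding all_less_split by simp
qed

lemma regular_op_next:
  assumes "regular_op F"
  shows "regular_op (\<lambda>n u. {i. enat (Suc i) < n \<and> Suc i \<in> F n u})"
proof -
  \<comment> \<open>The bit \<open>snd (fst (u i))\<close> is the claimed value of the new operator,
    the bit \<open>snd (u i)\<close> the value of \<open>F\<close>. At a last position the claim has
    to be false.\<close>
  let ?Q = "\<lambda>n (u :: nat \<Rightarrow> ('a \<times> bool) \<times> bool). True \<and>
    (\<forall>i. enat (Suc i) < n \<longrightarrow> (snd (fst (u i)) \<longleftrightarrow> snd (u (Suc i)))) \<and>
    (\<forall>k. n = enat (Suc k) \<longrightarrow> \<not> snd (fst (u k)))"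
  have "regular ?Q"
    using regular_local[of "\<lambda>_. True" "\<lambda>c. (snd (fst c), snd c)" "\<lambda>c c'. fst c \<longleftrightarrow> snd c'"
        "\<lambda>c. \<not> fst c"] by simp
  from regular_comp[OF regular_op_map[OF assms, of fst] this]
  show ?thesis unfolding regular_op_def
    by (rule regular_cong) (simp add: all_less_split)
qed

lemma regular_op_prev:
  assumes "regular_op F"
  shows "regular_op (\<lambda>n u. {i. 0 < i \<and> i - 1 \<in> F n u})"
proof -
  let ?Q = "\<lambda>n (u :: nat \<Rightarrow> ('a \<times> bool) \<times> bool). \<not> snd (fst (u 0)) \<and>
    (\<forall>i. enat (Suc i) < n \<longrightarrow> (snd (fst (u (Suc i))) \<longleftrightarrow> snd (u i))) \<and>
    (\<forall>k. n = enat (Suc k) \<longrightarrow> True)"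
  have "regular ?Q"
    using regular_local[of "\<lambda>c. \<not> fst c" "\<lambda>c. (snd (fst c), snd c)" "\<lambda>c c'. fst c' \<longleftrightarrow> snd c"
        "\<lambda>c. True"] by simp
  from regular_comp[OF regular_op_map[OF assms, of fst] this]
  show ?thesis unfolding regular_op_def
    by (rule regular_cong) (simp add: all_less_split_first)
qed

section \<open>Fixpoints of regular operators\<close>

text \<open>A bit track is an arbitrary set \<open>Y\<close>, of which only the part inside
  \<open>P\<close> counts. The right side compares with all sets \<open>X\<close> and can thus be
  expressed by quantification over an unrestricted track.\<close>

lemma lfp_Int_eq_iff:
  assumes "mono f" "\<And>X. f X \<subseteq> P" "\<And>X. f (X \<inter> P) = f X"
  shows "Y \<inter> P = lfp f \<longleftrightarrow> f Y \<subseteq> Y \<and> (\<forall>X. f X \<subseteq> X \<longrightarrow> Y \<inter> P \<subseteq> X)"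
proof
  assume Y: "Y \<inter> P = lfp f"
  have "f Y = lfp f" using assms(3)[of Y] Y lfp_unfold[OF assms(1)] by simp
  then show "f Y \<subseteq> Y \<and> (\<forall>X. f X \<subseteq> X \<longrightarrow> Y \<inter> P \<subseteq> X)" using Y lfp_lowerbound by blast
next
  assume Y: "f Y \<subseteq> Y \<and> (\<forall>X. f X \<subseteq> X \<longrightarrow> Y \<inter> P \<subseteq> X)"
  have "f (lfp f) = lfp f" by (rule lfp_unfold[OF assms(1), symmetric])
  then have "Y \<inter> P \<subseteq> lfp f" "lfp f \<subseteq> P" using Y assms(2) by blast+
  moreover have "lfp f \<subseteq> Y" using Y lfp_lowerbound by blast
  ultimately show "Y \<inter> P = lfp f" by blast
qed

text \<open>Post-fixed is weakened to \<open>X \<inter> P \<subseteq> f X\<close>: a track with bits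
  outside \<open>P\<close> could never satisfy \<open>X \<subseteq> f X\<close>.\<close>

lemma gfp_Int_eq_iff:
  assumes "mono f" "\<And>X. f X \<subseteq> P" "\<And>X. f (X \<inter> P) = f X"
  shows "Y \<inter> P = gfp f \<longleftrightarrow> Y \<inter> P \<subseteq> f Y \<and> (\<forall>X. X \<inter> P \<subseteq> f X \<longrightarrow> X \<inter> P \<subseteq> Y)"
proof
  assume Y: "Y \<inter> P = gfp f"
  have "f Y = gfp f" using assms(3)[of Y] Y gfp_unfold[OF assms(1)] by simp
  moreover have "X \<inter> P \<subseteq> gfp f" if "X \<inter> P \<subseteq> f X" for X
    by (rule gfp_upperbound) (use that assms(3) in blast)
  ultimately show "Y \<inter> P \<subseteq> f Y \<and> (\<forall>X. X \<inter> P \<subseteq> f X \<longrightarrow> X \<inter> P \<subseteq> Y)" using Y by blast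
next
  assume Y: "Y \<inter> P \<subseteq> f Y \<and> (\<forall>X. X \<inter> P \<subseteq> f X \<longrightarrow> X \<inter> P \<subseteq> Y)"
  have g: "f (gfp f) = gfp f" by (rule gfp_unfold[OF assms(1), symmetric])
  then have gP: "gfp f \<subseteq> P" using assms(2) by blast
  have "gfp f \<inter> P \<subseteq> Y" using Y g by blast
  moreover have "Y \<inter> P \<subseteq> gfp f" by (rule gfp_upperbound) (use Y assms(3) in blast)
  ultimately show "Y \<inter> P = gfp f" using gP by blast
qed

definition set_var :: "nat \<Rightarrow> 'b \<times> nat set \<Rightarrow> bool \<Rightarrow> 'b \<times> nat set" where
  "set_var x c y = (fst c, if y then insert x (snd c) else snd c - {x})"

text \<open>The valuations of atoms and variables are moved into the letters, which turns a formula
  into an operator on words. Updating the valuation at \<open>x\<close> becomes rewriting every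
  letter by \<open>set_var x\<close>.\<close>

definition wsem_letters :: "'a fm \<Rightarrow> enat \<Rightarrow> (nat \<Rightarrow> 'a atom set \<times> nat set) \<Rightarrow> nat set" where
  "wsem_letters \<phi> n u = wsem n (\<lambda>A. {k. A \<in> fst (u k)}) \<phi> (\<lambda>x. {k. x \<in> snd (u k)})"

lemma wsem_letters_set_var:
  "wsem_letters \<phi> n (\<lambda>i. set_var x (u i) (i \<in> X)) =
   wsem n (\<lambda>A. {k. A \<in> fst (u k)}) \<phi> ((\<lambda>x. {k. x \<in> snd (u k)})(x := X))"
proof -
  have "(\<lambda>y. {k. y \<in> snd (set_var x (u k) (k \<in> X))}) = (\<lambda>x. {k. x \<in> snd (u k)})(x := X)"
    by (auto simp: set_var_def fun_eq_iff)
  then show ?thesis by (simp add: wsem_letters_def set_var_def)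
qed

text \<open>The two preceding characterizations with tracks \<open>y\<close> and \<open>z\<close> in
  place of sets. Minimality and maximality are written as negated existentials, the form that
  \<open>regular_ex\<close> and \<open>regular_Not\<close> handle.\<close>

lemma fixpoint_characterization:
  fixes u :: "nat \<Rightarrow> 'a atom set \<times> nat set"
  shows "(\<forall>i. enat i < n \<longrightarrow> (y i \<longleftrightarrow> i \<in> wsem_letters (Mu x \<phi>) n u)) \<longleftrightarrow>
     (\<forall>i. enat i < n \<longrightarrow> i \<in> wsem_letters \<phi> n (\<lambda>i. set_var x (u i) (y i)) \<longrightarrow> y i) \<and>
     \<not> (\<exists>z. (\<forall>i. enat i < n \<longrightarrow> i \<in> wsem_letters \<phi> n (\<lambda>i. set_var x (u i) (z i)) \<longrightarrow> z i) \<and>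
        \<not> (\<forall>i. enat i < n \<longrightarrow> y i \<longrightarrow> z i))"
    and "(\<forall>i. enat i < n \<longrightarrow> (y i \<longleftrightarrow> i \<in> wsem_letters (Nu x \<phi>) n u)) \<longleftrightarrow>
     (\<forall>i. enat i < n \<longrightarrow> y i \<longrightarrow> i \<in> wsem_letters \<phi> n (\<lambda>i. set_var x (u i) (y i))) \<and>
     \<not> (\<exists>z. (\<forall>i. enat i < n \<longrightarrow> z i \<longrightarrow> i \<in> wsem_letters \<phi> n (\<lambda>i. set_var x (u i) (z i))) \<and>
        \<not> (\<forall>i. enat i < n \<longrightarrow> z i \<longrightarrow> y i))"
proof -
  define f where "f X = wsem_letters \<phi> n (\<lambda>i. set_var x (u i) (i \<in> X))" for X
  have f_eq: "f = (\<lambda>X. wsem n (\<lambda>A. {k. A \<in> fst (u k)}) \<phi> ((\<lambda>x. {k. x \<in> snd (u k)})(x := X)))"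
    unfolding f_def wsem_letters_set_var ..
  have mono: "mono f" unfolding f_eq by (rule mono_wsem)
  have fP: "f X \<subseteq> positions n" for X unfolding f_eq by (rule wsem_subset_positions)
  have fI: "f (X \<inter> positions n) = f X" for X unfolding f_eq by (rule wsem_cong_fv) auto
  have fs: "f {i. y i} = wsem_letters \<phi> n (\<lambda>i. set_var x (u i) (y i))" for y by (simp add: f_def)
  have le: "i \<in> f X \<Longrightarrow> enat i < n" for i X using fP[of X] by auto
  have all: "(\<forall>X :: nat set. P X) \<longleftrightarrow> (\<forall>z. P {i. z i})" for P by (metis Collect_mem_eq)
  have mu: "wsem_letters (Mu x \<phi>) n u = lfp f" and nu: "wsem_letters (Nu x \<phi>) n u = gfp f"
    by (simp_all add: wsem_letters_def f_eq)
  have eq: "(\<forall>i. enat i < n \<longrightarrow> (y i \<longleftrightarrow> i \<in> X)) \<longleftrightarrow> {i. y i} \<inter> positions n = X"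
    if "X \<subseteq> positions n" for X using that by auto
  have A: "f {i. z i} \<subseteq> {i. z i} \<longleftrightarrow> (\<forall>i. enat i < n \<longrightarrow> i \<in> f {i. z i} \<longrightarrow> z i)" for z
    using le[of _ "{i. z i}"] by blast
  have B: "{i. y i} \<inter> positions n \<subseteq> {i. z i} \<longleftrightarrow> (\<forall>i. enat i < n \<longrightarrow> y i \<longrightarrow> z i)" for y z
    by auto
  have C: "{i. z i} \<inter> positions n \<subseteq> f {i. z i} \<longleftrightarrow> (\<forall>i. enat i < n \<longrightarrow> z i \<longrightarrow> i \<in> f {i. z i})" for z
    by auto
  have P: "lfp f \<subseteq> positions n" "gfp f \<subseteq> positions n"
    using fP[of "lfp f"] fP[of "gfp f"] lfp_unfold[OF mono] gfp_unfold[OF mono] by auto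
  show "(\<forall>i. enat i < n \<longrightarrow> (y i \<longleftrightarrow> i \<in> wsem_letters (Mu x \<phi>) n u)) \<longleftrightarrow>
     (\<forall>i. enat i < n \<longrightarrow> i \<in> wsem_letters \<phi> n (\<lambda>i. set_var x (u i) (y i)) \<longrightarrow> y i) \<and>
     \<not> (\<exists>z. (\<forall>i. enat i < n \<longrightarrow> i \<in> wsem_letters \<phi> n (\<lambda>i. set_var x (u i) (z i)) \<longrightarrow> z i) \<and>
        \<not> (\<forall>i. enat i < n \<longrightarrow> y i \<longrightarrow> z i))"
    unfolding mu eq[OF P(1)] lfp_Int_eq_iff[OF mono fP fI] all fs[symmetric]
    unfolding A B by blast
  show "(\<forall>i. enat i < n \<longrightarrow> (y i \<longleftrightarrow> i \<in> wsem_letters (Nu x \<phi>) n u)) \<longleftrightarrow>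
     (\<forall>i. enat i < n \<longrightarrow> y i \<longrightarrow> i \<in> wsem_letters \<phi> n (\<lambda>i. set_var x (u i) (y i))) \<and>
     \<not> (\<exists>z. (\<forall>i. enat i < n \<longrightarrow> z i \<longrightarrow> i \<in> wsem_letters \<phi> n (\<lambda>i. set_var x (u i) (z i))) \<and>
        \<not> (\<forall>i. enat i < n \<longrightarrow> z i \<longrightarrow> y i))"
    unfolding nu eq[OF P(2)] gfp_Int_eq_iff[OF mono fP fI] all fs[symmetric]
    unfolding B C by blast
qed

lemma regular_op_cong:
  assumes "regular_op F" "\<And>n u i. enat i < n \<Longrightarrow> i \<in> F n u \<longleftrightarrow> i \<in> G n u"
  shows "regular_op G"
  using assms unfolding regular_op_def by simp

lemma regular_op_wsem: "regular_op (wsem_letters \<phi>)"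
proof (induction \<phi>)
  case (Var x)
  show ?case by (rule regular_op_cong[OF regular_op_pointwise[of "\<lambda>c. x \<in> snd c"]])
      (simp add: wsem_letters_def)
next
  case (Pos A)
  show ?case by (rule regular_op_cong[OF regular_op_pointwise[of "\<lambda>c. A \<in> fst c"]])
      (simp add: wsem_letters_def)
next
  case (Neg A)
  show ?case by (rule regular_op_cong[OF regular_op_pointwise[of "\<lambda>c. A \<notin> fst c"]])
      (simp add: wsem_letters_def)
next
  case (Modal M \<phi>)
  show ?case
  proof (cases "is_forward M")
    case True
    show ?thesis by (rule regular_op_cong[OF regular_op_next[OF Modal.IH]])
        (use True in \<open>auto simp: wsem_letters_def dest: wsem_less\<close>)
  next
    case False
    show ?thesis by (rule regular_op_cong[OF regular_op_prev[OF Modal.IH]])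
        (use False in \<open>auto simp: wsem_letters_def\<close>)
  qed
next
  case (Or \<phi> \<psi>)
  show ?case by (rule regular_op_cong[OF regular_op_bool[OF Or.IH, of "(\<or>)"]])
      (simp add: wsem_letters_def)
next
  case (And \<phi> \<psi>)
  show ?case by (rule regular_op_cong[OF regular_op_bool[OF And.IH, of "(\<and>)"]])
      (simp add: wsem_letters_def)
next
  case (Mu x \<phi>)
  note F = regular_op_map[OF Mu.IH]
  have 1: "regular (\<lambda>n u. \<forall>i. enat i < n \<longrightarrow>
      i \<in> wsem_letters \<phi> n (\<lambda>i. set_var x (fst (u i)) (snd (u i))) \<longrightarrow> snd (u i))"
    by (rule regular_all_comp[OF F])
  \<comment> \<open>The letters are nested as ((letter, \<open>y\<close>), \<open>z\<close>), with
    the competitor \<open>z\<close> outermost so that \<open>regular_ex\<close> removes it.\<close>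
  have 2: "regular (\<lambda>n u. (\<forall>i. enat i < n \<longrightarrow>
      i \<in> wsem_letters \<phi> n (\<lambda>i. set_var x (fst (fst (u i))) (snd (u i))) \<longrightarrow> snd (u i)) \<and>
      \<not> (\<forall>i. enat i < n \<longrightarrow> (snd (fst (u i)) \<longrightarrow> snd (u i))))"
    by (intro regular_conj regular_Not regular_all regular_all_comp[OF F])
  from regular_conj[OF 1 regular_Not[OF regular_ex[OF 2]]]
  show ?case unfolding regular_op_def fixpoint_characterization by simp
next
  case (Nu x \<phi>)
  note F = regular_op_map[OF Nu.IH]
  have 1: "regular (\<lambda>n u. \<forall>i. enat i < n \<longrightarrow> snd (u i) \<longrightarrow>
      i \<in> wsem_letters \<phi> n (\<lambda>i. set_var x (fst (u i)) (snd (u i))))"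
    by (rule regular_all_comp[OF F])
  have 2: "regular (\<lambda>n u. (\<forall>i. enat i < n \<longrightarrow> snd (u i) \<longrightarrow>
      i \<in> wsem_letters \<phi> n (\<lambda>i. set_var x (fst (fst (u i))) (snd (u i)))) \<and>
      \<not> (\<forall>i. enat i < n \<longrightarrow> (snd (u i) \<longrightarrow> snd (fst (u i)))))"
    by (intro regular_conj regular_Not regular_all regular_all_comp[OF F])
  from regular_conj[OF 1 regular_Not[OF regular_ex[OF 2]]]
  show ?case unfolding regular_op_def fixpoint_characterization by simp
qed

section \<open>Transducers for regular properties\<close>

definition trans_rel ::
  "('i, 'o) transducer \<Rightarrow> ('i, 'o) transducer \<Rightarrow> enat \<Rightarrow> (nat \<Rightarrow> 'i) \<Rightarrow> (nat \<Rightarrow> 'o) \<Rightarrow> bool" where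
  "trans_rel T T\<^sub>\<omega> m u v \<longleftrightarrow>
     (case m of enat k \<Rightarrow> (seg u 0 k, seg v 0 k) \<in> word_rel T | \<infinity> \<Rightarrow> (u, v) \<in> buchi_rel T\<^sub>\<omega>)"

lemma word_rel_seg:
  "(seg u 0 k, seg v 0 k) \<in> word_rel T \<longleftrightarrow>
   (\<exists>r. r 0 \<in> initial T \<and> (\<forall>i < k. (r i, u i, v i, r (Suc i)) \<in> delta T) \<and> r k \<in> final T)"
  by (simp add: word_rel_def seg_def)

lemma seg_Suc: "i \<le> k \<Longrightarrow> seg w i (Suc k) = seg w i k @ [w k]"
  by (simp add: seg_def)

lemma seg_self [simp]: "seg w k k = []"
  by (simp add: seg_def)

text \<open>The states of a transducer are natural numbers; this permits the Buechi construction to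
  use tuples.\<close>

lemma rename_states:
  fixes S :: "'q set"
  assumes "finite A" "finite B" "finite S" "I \<subseteq> S" "F \<subseteq> S" "D \<subseteq> S \<times> A \<times> B \<times> S"
  obtains T where "is_transducer A B T"
    and "\<And>u v. (u, v) \<in> buchi_rel T \<longleftrightarrow>
      (\<exists>r. r 0 \<in> I \<and> (\<forall>k. (r k, u k, v k, r (Suc k)) \<in> D) \<and> (\<exists>\<^sub>\<infinity>k. r k \<in> F))"
proof -
  obtain g :: "'q \<Rightarrow> nat" where g: "inj_on g S"
    using finite_imp_inj_to_nat_seg assms(3) by meson
  define T where "T = \<lparr>states = g ` S, initial = g ` I,
    delta = (\<lambda>(p, a, b, q). (g p, a, b, g q)) ` D, final = g ` F\<rparr>"
  have dT: "(g p, a, b, g q) \<in> delta T \<longleftrightarrow> (p, a, b, q) \<in> D" if "p \<in> S" "q \<in> S" for p q a b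
  proof
    assume "(g p, a, b, g q) \<in> delta T"
    then obtain p' q' where "(p', a, b, q') \<in> D" "g p = g p'" "g q = g q'" by (auto simp: T_def)
    moreover from this have "p' \<in> S" "q' \<in> S" using assms(6) by auto
    ultimately show "(p, a, b, q) \<in> D" using g that by (auto dest: inj_onD)
  qed (force simp: T_def)
  have inI: "g p \<in> initial T \<longleftrightarrow> p \<in> I" and inF: "g p \<in> final T \<longleftrightarrow> p \<in> F" if "p \<in> S" for p
    using g that assms(4,5) by (auto simp: T_def inj_on_image_mem_iff)
  have "is_transducer A B T"
    using assms by (auto simp: is_transducer_def T_def)
  moreover have "(u, v) \<in> buchi_rel T \<longleftrightarrow>
      (\<exists>r. r 0 \<in> I \<and> (\<forall>k. (r k, u k, v k, r (Suc k)) \<in> D) \<and> (\<exists>\<^sub>\<infinity>k. r k \<in> F))" (is "_ \<longleftrightarrow> ?R") for u v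
  proof
    assume "(u, v) \<in> buchi_rel T"
    then obtain r where r: "r 0 \<in> initial T" "\<And>k. (r k, u k, v k, r (Suc k)) \<in> delta T"
      "\<exists>\<^sub>\<infinity>k. r k \<in> final T" by (auto simp: buchi_rel_def)
    have "r k \<in> g ` S" for k using r(2)[of k] assms(6) by (auto simp: T_def)
    then have "\<forall>k. \<exists>p. p \<in> S \<and> r k = g p" by blast
    then obtain r' where r': "\<And>k. r' k \<in> S" "\<And>k. r k = g (r' k)" by metis
    show ?R using r unfolding r'(2) dT[OF r'(1) r'(1)] inI[OF r'(1)] inF[OF r'(1)] by blast
  next
    assume ?R
    then obtain r where r: "r 0 \<in> I" "\<And>k. (r k, u k, v k, r (Suc k)) \<in> D" "\<exists>\<^sub>\<infinity>k. r k \<in> F" by auto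
    have "r k \<in> S" for k using r(2)[of k] assms(6) by auto
    then show "(u, v) \<in> buchi_rel T"
      using r dT inI inF unfolding buchi_rel_def by (auto intro!: exI[of _ "\<lambda>k. g (r k)"])
  qed
  ultimately show ?thesis by (rule that)
qed

text \<open>The elements of \<open>B\<close> become the cut points after the initial cut at 0, which
  has to be a new one.\<close>

lemma factorization_of_infinite:
  assumes "infinite B" "0 \<notin> (B :: nat set)"
  obtains f where "factorization f" "\<And>l. f (Suc l) \<in> B" "\<And>k. k \<in> B \<Longrightarrow> \<exists>l. k = f (Suc l)"
proof -
  define f where "f l = (case l of 0 \<Rightarrow> 0 | Suc l \<Rightarrow> enumerate B l)" for l
  have "0 < enumerate B 0" using assms enumerate_in_set[OF assms(1), of 0] by (metis gr0I)
  then have "f l < f (Suc l)" for l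
    using assms(1) by (auto simp: f_def enumerate_step split: nat.split)
  then have "factorization f" by (simp add: factorization_def strict_mono_Suc_iff f_def)
  moreover have "f (Suc l) \<in> B" for l using assms(1) by (simp add: f_def enumerate_in_set)
  moreover have "\<exists>l. k = f (Suc l)" if "k \<in> B" for k
    using enumerate_Ex[OF assms(1) that] by (auto simp: f_def)
  ultimately show ?thesis by (rule that)
qed

text \<open>Colour a pair of positions by the class of the segment between them and take the cut
  points from a homogeneous set. The first block starts at 0, outside that set, and may have another
  class, so the claim concerns the blocks from \<open>f (Suc l)\<close> on.\<close>

lemma ramsey_factorization:
  fixes h :: "'c list \<Rightarrow> nat"
  assumes "finite (range h)"
  obtains f e where "factorization f" "\<And>l. h (seg w (f (Suc l)) (f (Suc (Suc l)))) = e"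
proof -
  obtain N where N: "\<And>x. h x < N" using assms
    by (metis finite_nat_set_iff_bounded rangeI)
  let ?c = "\<lambda>X. h (seg w (Min X) (Max X))"
  have "\<exists>Y t. Y \<subseteq> UNIV - {0} \<and> infinite Y \<and> t < N \<and> (\<forall>x\<in>Y. \<forall>y\<in>Y. x \<noteq> y \<longrightarrow> ?c {x, y} = t)"
    by (rule Ramsey2) (use N in auto)
  then obtain Y t where Y: "0 \<notin> Y" "infinite Y" "\<forall>x\<in>Y. \<forall>y\<in>Y. x \<noteq> y \<longrightarrow> ?c {x, y} = t" by blast
  obtain f where f: "factorization f" "\<And>l. f (Suc l) \<in> Y"
    using factorization_of_infinite[OF Y(2,1)] by metis
  have "h (seg w (f (Suc l)) (f (Suc (Suc l)))) = t" for l
    using Y(3)[rule_format, OF f(2)[of l] f(2)[of "Suc l"]] factorization_step[OF f(1), of "Suc l"]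
    by (simp add: min_def max_def)
  with f(1) show ?thesis by (rule that)
qed

section \<open>Automata from congruences\<close>

text \<open>The congruence is itself the automaton: its states are the classes, and reading a letter
  appends it to any representative, all of which yield the same class. Saturation makes acceptance
  depend on the class of the whole word alone.\<close>

lemma nfa_of_regular:
  fixes h :: "('i \<times> 'o) list \<Rightarrow> nat"
  assumes h: "recognizes h Q" and AB: "finite A" "finite B"
  obtains T where "is_transducer A B T"
    and "\<And>k u v. 0 < k \<Longrightarrow> (seg u 0 k, seg v 0 k) \<in> word_rel T \<longleftrightarrow>
      (\<forall>i < k. u i \<in> A \<and> v i \<in> B) \<and> Q (enat k) (\<lambda>i. (u i, v i))"
proof -
  define T where "T = \<lparr>states = range h, initial = {h []},
    delta = {(t, a, b, t'). a \<in> A \<and> b \<in> B \<and> (\<exists>x. t = h x \<and> t' = h (x @ [(a, b)]))},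
    final = {h (seg w 0 k) | w k. 0 < k \<and> Q (enat k) w}\<rparr>"
  have "is_transducer A B T"
    using AB recognizesD(1)[OF h] by (auto simp: is_transducer_def T_def)
  moreover have "(seg u 0 k, seg v 0 k) \<in> word_rel T \<longleftrightarrow>
      (\<forall>i < k. u i \<in> A \<and> v i \<in> B) \<and> Q (enat k) (\<lambda>i. (u i, v i))" if k: "0 < k" for k u v
  proof -
    let ?w = "\<lambda>i. (u i, v i)"
    have fin: "h (seg ?w 0 k) \<in> final T \<longleftrightarrow> Q (enat k) ?w"
    proof
      assume "h (seg ?w 0 k) \<in> final T"
      then obtain w k' where "h (seg ?w 0 k) = h (seg w 0 k')" "0 < k'" "Q (enat k') w"
        by (auto simp: T_def)
      then show "Q (enat k) ?w" using recognizes_fin[OF h k, of k' ?w w] by blast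
    qed (use k in \<open>auto simp: T_def\<close>)
    show ?thesis unfolding word_rel_seg
    proof safe
      fix r assume r: "r 0 \<in> initial T" "\<forall>i<k. (r i, u i, v i, r (Suc i)) \<in> delta T" "r k \<in> final T"
      have "r i = h (seg ?w 0 i)" if "i \<le> k" for i
        using that
      proof (induction i)
        case 0
        then show ?case using r(1) by (simp add: T_def)
      next
        case (Suc i)
        have "(r i, u i, v i, r (Suc i)) \<in> delta T" using r(2) Suc.prems by auto
        then obtain x where x: "r i = h x" "r (Suc i) = h (x @ [?w i])" by (auto simp: T_def)
        then have "h x = h (seg ?w 0 i)" using Suc by simp
        then show ?case using x(2) recognizes_cong[OF h, of x "seg ?w 0 i" "[?w i]" "[?w i]"]
          by (simp add: seg_Suc)
      qed
      then show "Q (enat k) ?w" using r(3) fin by simp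
      show "u i \<in> A" "v i \<in> B" if "i < k" for i using r(2) that by (auto simp: T_def)
    next
      assume "\<forall>i<k. u i \<in> A \<and> v i \<in> B" "Q (enat k) ?w"
      then show "\<exists>r. r 0 \<in> initial T \<and> (\<forall>i<k. (r i, u i, v i, r (Suc i)) \<in> delta T) \<and> r k \<in> final T"
        using fin by (intro exI[of _ "\<lambda>i. h (seg ?w 0 i)"]) (auto simp: T_def seg_Suc)
    qed
  qed
  ultimately show ?thesis by (rule that)
qed

text \<open>
  The automaton guesses the classes \<open>s\<close> of the first block and \<open>e\<close> of all later blocks of a
  factorization.  In a state \<open>(s, e, j, t)\<close> the phase \<open>j\<close> is \<open>0\<close> inside the first block, \<open>2\<close> on
  the boundary between two blocks and \<open>1\<close> elsewhere; \<open>t\<close> is the class of the current block read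
  so far.
\<close>

lemma buchi_of_regular:
  fixes h :: "('i \<times> 'o) list \<Rightarrow> nat"
  assumes h: "recognizes h Q" and AB: "finite A" "finite B"
  obtains T where "is_transducer A B T"
    and "\<And>u v. (u, v) \<in> buchi_rel T \<longleftrightarrow>
      (\<forall>i. u i \<in> A \<and> v i \<in> B) \<and> Q \<infinity> (\<lambda>i. (u i, v i))"
proof -
  let ?H = "range h"
  define S where "S = ?H \<times> ?H \<times> {0, 1, 2 :: nat} \<times> ?H"
  \<comment> \<open>A pair is good if at least one omega-word with block classes \<open>s\<close>,
    \<open>e\<close>, \<open>e\<close>, ... satisfies \<open>Q\<close>; by saturation all such words
    then do. The guess is fixed in the initial state and never changed.\<close>
  define good where "good s e \<longleftrightarrow> (\<exists>w f. factorization f \<and> h (seg w (f 0) (f 1)) = s \<and>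
    (\<forall>l. h (seg w (f (Suc l)) (f (Suc (Suc l)))) = e) \<and> Q \<infinity> w)" for s e
  define I where "I = {(s, e, 0 :: nat, h []) | s e. good s e}"
  define F where "F = {(s, e, j, t) \<in> S. j = 2}"
  define D where "D = {((s, e, j, t), a, b, (s', e', j', t')) | s e j t a b s' e' j' t'.
    s' = s \<and> e' = e \<and> (s, e, j, t) \<in> S \<and> a \<in> A \<and> b \<in> B \<and> (\<exists>x. t = h x \<and>
      (j' = (if j = 0 then 0 else 1) \<and> t' = h (x @ [(a, b)]) \<or>
       j' = (2 :: nat) \<and> t' = h [] \<and> h (x @ [(a, b)]) = (if j = 0 then s else e)))}"
  have D_iff: "((s, e, j, t), a, b, (s', e', j', t')) \<in> D \<longleftrightarrow>
    s' = s \<and> e' = e \<and> (s, e, j, t) \<in> S \<and> a \<in> A \<and> b \<in> B \<and> (\<exists>x. t = h x \<and>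
      (j' = (if j = 0 then 0 else 1) \<and> t' = h (x @ [(a, b)]) \<or>
       j' = 2 \<and> t' = h [] \<and> h (x @ [(a, b)]) = (if j = 0 then s else e)))"
    for s e j t a b s' e' j' t' by (simp add: D_def)
  have "finite S" using recognizesD(1)[OF h] by (simp add: S_def)
  moreover have "s \<in> ?H \<and> e \<in> ?H" if "good s e" for s e
    using that unfolding good_def by (metis rangeI)
  then have "I \<subseteq> S" by (auto simp: I_def S_def)
  moreover have "F \<subseteq> S" by (auto simp: F_def)
  moreover have "D \<subseteq> S \<times> A \<times> B \<times> S" by (auto simp: D_def S_def split: if_splits)
  ultimately obtain T where T: "is_transducer A B T" "\<And>u v. (u, v) \<in> buchi_rel T \<longleftrightarrow>
      (\<exists>r. r 0 \<in> I \<and> (\<forall>k. (r k, u k, v k, r (Suc k)) \<in> D) \<and> (\<exists>\<^sub>\<infinity>k. r k \<in> F))"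
    by (rule rename_states[OF AB, of S I F D]) (rule that)
  have "(\<exists>r. r 0 \<in> I \<and> (\<forall>k. (r k, u k, v k, r (Suc k)) \<in> D) \<and> (\<exists>\<^sub>\<infinity>k. r k \<in> F)) \<longleftrightarrow>
      (\<forall>i. u i \<in> A \<and> v i \<in> B) \<and> Q \<infinity> (\<lambda>i. (u i, v i))" for u v
  proof safe
    fix r assume r: "r 0 \<in> I" "\<forall>k. (r k, u k, v k, r (Suc k)) \<in> D" "\<exists>\<^sub>\<infinity>k. r k \<in> F"
    let ?w = "\<lambda>i. (u i, v i)"
    show "u i \<in> A" "v i \<in> B" for i using r(2)[rule_format, of i] by (auto simp: D_def)
    obtain s e where se: "r 0 = (s, e, 0, h [])" "good s e" using r(1) by (auto simp: I_def)
    have "\<exists>j t. r k = (s, e, j, t)" for k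
    proof (induction k)
      case (Suc k)
      then show ?case using r(2)[rule_format, of k] by (auto simp: D_def)
    qed (use se in auto)
    then obtain j t where rk: "\<And>k. r k = (s, e, j k, t k)" by metis
    have jt0: "j 0 = 0" "t 0 = h []" using rk[of 0] se(1) by auto
    have step: "\<exists>x. t k = h x \<and>
      (j (Suc k) = (if j k = 0 then 0 else 1) \<and> t (Suc k) = h (x @ [?w k]) \<or>
       j (Suc k) = 2 \<and> t (Suc k) = h [] \<and> h (x @ [?w k]) = (if j k = 0 then s else e))" for k
      using r(2)[rule_format, of k] unfolding rk D_iff by blast
    \<comment> \<open>The visits to \<open>F\<close>. They become the cut points of the
      factorization that the run has guessed; 0 is none of them because a run starts in phase
      0.\<close>
    define B where "B = {k. j k = 2}"
    have "infinite B"
      using r(3) unfolding INFM_iff_infinite rk F_def B_def by (rule contrapos_nn) (erule rev_finite_subset, auto)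
    moreover have "0 \<notin> B" using jt0 by (simp add: B_def)
    ultimately obtain f where f: "factorization f" "\<And>l. f (Suc l) \<in> B"
      "\<And>k. k \<in> B \<Longrightarrow> \<exists>l. k = f (Suc l)" by (rule factorization_of_infinite) (rule that)
    have notB: "k \<notin> B" if "f l < k" "k < f (Suc l)" for k l
    proof
      assume "k \<in> B"
      then obtain l' where "k = f (Suc l')" using f(3) by blast
      then have "l < Suc l'" "Suc l' < Suc l"
        using that f(1) by (simp_all add: factorization_def strict_mono_less)
      then show False by simp
    qed
    \<comment> \<open>Inside block \<open>l\<close> the phase tells whether this is the first block,
      and \<open>t\<close> is the class of what has been read since the last cut.\<close>
    have inv: "(j k = 0 \<longleftrightarrow> l = 0) \<and> t k = h (seg ?w (f l) k)" if "f l \<le> k" "k < f (Suc l)" for k l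
      using that
    proof (induction k rule: dec_induct)
      case base
      show ?case
      proof (cases l)
        case 0
        then show ?thesis using jt0 f(1) by (simp add: factorization_def)
      next
        case (Suc l')
        then have j2: "j (f l) = 2" using f(2) by (auto simp: B_def)
        obtain k where k: "f l = Suc k" using j2 jt0 by (metis old.nat.exhaust zero_neq_numeral)
        then show ?thesis using step[of k] j2 Suc by (auto split: if_splits)
      qed
    next
      case (step k)
      then have IH: "j k = 0 \<longleftrightarrow> l = 0" "t k = h (seg ?w (f l) k)" by auto
      have "j (Suc k) \<noteq> 2" using notB[of l "Suc k"] step by (simp add: B_def)
      then obtain x where x: "t k = h x" "j (Suc k) = (if j k = 0 then 0 else 1)"
        "t (Suc k) = h (x @ [?w k])" using \<open>\<And>k. \<exists>x. _ k x\<close>[of k] by blast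
      then show ?case
        using IH recognizes_cong[OF h, of x "seg ?w (f l) k" "[?w k]" "[?w k]"] step(1)
        by (auto simp: seg_Suc)
    qed
    have blocks: "h (seg ?w (f l) (f (Suc l))) = (if l = 0 then s else e)" for l
    proof -
      obtain k where k: "f (Suc l) = Suc k" using factorization_step[OF f(1), of l]
        by (metis less_imp_Suc_add)
      then have kl: "f l \<le> k" "k < f (Suc l)" using factorization_step[OF f(1), of l] by auto
      have "j (Suc k) = 2" using f(2)[of l] k by (simp add: B_def)
      then obtain x where "t k = h x" "h (x @ [?w k]) = (if j k = 0 then s else e)"
        using step[of k] by (auto split: if_splits)
      then show ?thesis
        using inv[OF kl] recognizes_cong[OF h, of x "seg ?w (f l) k" "[?w k]" "[?w k]"] kl(1)
        unfolding k by (auto simp: seg_Suc)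
    qed
    obtain w' f' where w': "factorization f'" "h (seg w' (f' 0) (f' 1)) = s"
      "\<And>l. h (seg w' (f' (Suc l)) (f' (Suc (Suc l)))) = e" "Q \<infinity> w'"
      using se(2) by (auto simp: good_def)
    have "h (seg w' (f' l) (f' (Suc l))) = (if l = 0 then s else e)" for l
      using w'(2,3) by (cases l) auto
    then show "Q \<infinity> ?w" using recognizes_inf[OF h f(1) w'(1), of ?w w'] blocks w'(4) by simp
  next
    let ?w = "\<lambda>i. (u i, v i)"
    assume uv: "\<forall>i. u i \<in> A \<and> v i \<in> B" and Q: "Q \<infinity> ?w"
    obtain f e where f: "factorization f" "\<And>l. h (seg ?w (f (Suc l)) (f (Suc (Suc l)))) = e"
      using ramsey_factorization[OF recognizesD(1)[OF h]] by blast
    define s where "s = h (seg ?w (f 0) (f 1))"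
    have good: "good s e" using f Q by (auto simp: good_def s_def)
    \<comment> \<open>The test for the first block precedes the boundary test: position 0 equals
      \<open>f 0\<close>, yet its phase must be 0.\<close>
    define j where "j k = (if block f k = 0 then 0 else if k = f (block f k) then 2 else 1 :: nat)" for k
    define r where "r k = (s, e, j k, h (seg ?w (f (block f k)) k))" for k
    have f0: "f 0 = 0" using f(1) by (simp add: factorization_def)
    have b0: "block f 0 = 0" by (rule block_eq[OF f(1)]) (use f0 factorization_step[OF f(1), of 0] in auto)
    have "r 0 \<in> I" using good b0 f0 by (auto simp: r_def j_def I_def)
    moreover have inS: "r k \<in> S" for k
      using f(2)[of 0] by (auto simp: r_def j_def S_def s_def)
    have "(r k, u k, v k, r (Suc k)) \<in> D" for k
    proof -
      let ?l = "block f k"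
      note b = block_bounds[OF f(1), of k]
      have j0: "j k = 0 \<longleftrightarrow> ?l = 0" by (simp add: j_def)
      have "(j (Suc k) = (if j k = 0 then 0 else 1) \<and>
          h (seg ?w (f (block f (Suc k))) (Suc k)) = h (seg ?w (f ?l) k @ [(u k, v k)]) \<or>
         j (Suc k) = 2 \<and> h (seg ?w (f (block f (Suc k))) (Suc k)) = h [] \<and>
          h (seg ?w (f ?l) k @ [(u k, v k)]) = (if j k = 0 then s else e))"
      proof (cases "Suc k < f (Suc ?l)")
        case True
        then have "block f (Suc k) = ?l" using b by (intro block_eq[OF f(1)]) auto
        then show ?thesis using b unfolding j0 by (auto simp: j_def seg_Suc)
      next
        case False
        then have Sk: "Suc k = f (Suc ?l)" using b by simp
        then have "block f (Suc k) = Suc ?l"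
          using factorization_step[OF f(1), of "Suc ?l"] by (intro block_eq[OF f(1)]) auto
        moreover have "seg ?w (f ?l) k @ [(u k, v k)] = seg ?w (f ?l) (f (Suc ?l))"
          unfolding Sk[symmetric] using b by (simp add: seg_Suc)
        moreover have "h (seg ?w (f ?l) (f (Suc ?l))) = (if ?l = 0 then s else e)"
          using f(2)[of "?l - 1"] by (cases ?l) (auto simp: s_def)
        ultimately show ?thesis using Sk unfolding j0 by (auto simp: j_def)
      qed
      then show ?thesis using inS[of k] uv unfolding r_def D_iff
        by (intro conjI exI[of _ "seg ?w (f (block f k)) k"]) auto
    qed
    moreover have "\<exists>\<^sub>\<infinity>k. r k \<in> F"
      unfolding INFM_nat
    proof
      fix k
      let ?k = "f (Suc (Suc k))"
      have "block f ?k = Suc (Suc k)"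
        using factorization_step[OF f(1)] by (intro block_eq[OF f(1)]) auto
      then have "r ?k \<in> F" using inS[of ?k] by (simp add: F_def r_def j_def)
      moreover have "k < ?k"
        using f(1) strict_mono_imp_increasing[of f "Suc (Suc k)"] by (simp add: factorization_def)
      ultimately show "\<exists>k'>k. r k' \<in> F" by blast
    qed
    ultimately show "\<exists>r. r 0 \<in> I \<and> (\<forall>k. (r k, u k, v k, r (Suc k)) \<in> D) \<and> (\<exists>\<^sub>\<infinity>k. r k \<in> F)"
      by blast
  qed
  then show ?thesis using that[OF T(1)] T(2) by simp
qed

lemma transducers_of_regular:
  fixes Q :: "enat \<Rightarrow> (nat \<Rightarrow> 'i \<times> 'o) \<Rightarrow> bool"
  assumes "regular Q" "finite A" "finite B"
  obtains T T\<^sub>\<omega> where "is_transducer A B T" "is_transducer A B T\<^sub>\<omega>"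
    and "\<And>m u v. 0 < m \<Longrightarrow> trans_rel T T\<^sub>\<omega> m u v \<longleftrightarrow>
      (\<forall>i. enat i < m \<longrightarrow> u i \<in> A \<and> v i \<in> B) \<and> Q m (\<lambda>i. (u i, v i))"
proof -
  obtain h :: "('i \<times> 'o) list \<Rightarrow> nat" where h: "recognizes h Q" using assms(1) by (rule regularE)
  obtain T where T: "is_transducer A B T"
    "\<And>k u v. 0 < k \<Longrightarrow> (seg u 0 k, seg v 0 k) \<in> word_rel T \<longleftrightarrow>
      (\<forall>i < k. u i \<in> A \<and> v i \<in> B) \<and> Q (enat k) (\<lambda>i. (u i, v i))"
    using nfa_of_regular[OF h assms(2,3)] by blast
  obtain T\<^sub>\<omega> where T\<^sub>\<omega>: "is_transducer A B T\<^sub>\<omega>"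
    "\<And>u v. (u, v) \<in> buchi_rel T\<^sub>\<omega> \<longleftrightarrow> (\<forall>i. u i \<in> A \<and> v i \<in> B) \<and> Q \<infinity> (\<lambda>i. (u i, v i))"
    using buchi_of_regular[OF h assms(2,3)] by blast
  have "trans_rel T T\<^sub>\<omega> m u v \<longleftrightarrow>
      (\<forall>i. enat i < m \<longrightarrow> u i \<in> A \<and> v i \<in> B) \<and> Q m (\<lambda>i. (u i, v i))" if "0 < m" for m u v
    using that T(2)[of _ u v] T\<^sub>\<omega>(2)[of u v]
    by (cases m) (simp_all add: trans_rel_def zero_enat_def)
  with T(1) T\<^sub>\<omega>(1) show ?thesis by (rule that)
qed

section \<open>From formulas to cascades\<close>

lemma finite_fv: "finite (fv \<phi>)"
  by (induction \<phi>) auto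

lemma sem_cong_fv:
  "(\<And>x. x \<in> fv \<phi> \<Longrightarrow> V x \<inter> positions n = W x \<inter> positions n) \<Longrightarrow> sem n a d \<phi> V = sem n a d \<phi> W"
proof (induction \<phi> arbitrary: V W)
  case (Modal M \<phi>)
  have "sem n a d \<phi> V = sem n a d \<phi> W" by (rule Modal.IH) (simp add: Modal.prems)
  then show ?case by simp
next
  case (Or \<phi> \<psi>)
  have "sem n a d \<phi> V = sem n a d \<phi> W" by (rule Or.IH) (simp add: Or.prems)
  moreover have "sem n a d \<psi> V = sem n a d \<psi> W" by (rule Or.IH) (simp add: Or.prems)
  ultimately show ?case by simp
next
  case (And \<phi> \<psi>)
  have "sem n a d \<phi> V = sem n a d \<phi> W" by (rule And.IH) (simp add: And.prems)
  moreover have "sem n a d \<psi> V = sem n a d \<psi> W" by (rule And.IH) (simp add: And.prems)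
  ultimately show ?case by simp
next
  case (Mu x \<phi>)
  have "sem n a d \<phi> (V(x := X)) = sem n a d \<phi> (W(x := X))" for X
    by (rule Mu.IH) (auto simp: Mu.prems[simplified])
  then show ?case by simp
next
  case (Nu x \<phi>)
  have "sem n a d \<phi> (V(x := X)) = sem n a d \<phi> (W(x := X))" for X
    by (rule Nu.IH) (auto simp: Nu.prems[simplified])
  then show ?case by simp
qed auto

text \<open>The alternative \<open>\<sigma> x = Var x\<close> is what descending below a binder
  creates. The other substituted formulas are closed, so they do not notice that the binder changes
  the valuation.\<close>

lemma sem_subst:
  assumes "\<And>x. x \<in> fv \<psi> \<Longrightarrow> fv (\<sigma> x) = {} \<or> \<sigma> x = Var x"
    and "\<And>x. x \<in> fv \<psi> \<Longrightarrow> sem n a d (\<sigma> x) V = W x \<inter> positions n"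
  shows "sem n a d (subst \<psi> \<sigma>) V = sem n a d \<psi> W"
  using assms
proof (induction \<psi> arbitrary: \<sigma> V W)
  case (Modal M \<phi>)
  have "sem n a d (subst \<phi> \<sigma>) V = sem n a d \<phi> W"
    using Modal.prems by (intro Modal.IH) auto
  then show ?case by simp
next
  case (Or \<phi> \<psi>)
  have "sem n a d (subst \<phi> \<sigma>) V = sem n a d \<phi> W" "sem n a d (subst \<psi> \<sigma>) V = sem n a d \<psi> W"
    using Or.prems by (auto intro!: Or.IH)
  then show ?case by simp
next
  case (And \<phi> \<psi>)
  have "sem n a d (subst \<phi> \<sigma>) V = sem n a d \<phi> W" "sem n a d (subst \<psi> \<sigma>) V = sem n a d \<psi> W"
    using And.prems by (auto intro!: And.IH)
  then show ?case by simp
next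
  case (Mu x \<phi>)
  have "sem n a d (subst \<phi> (\<sigma>(x := Var x))) (V(x := X)) = sem n a d \<phi> (W(x := X))" for X
  proof (rule Mu.IH)
    fix y assume y: "y \<in> fv \<phi>"
    show "fv ((\<sigma>(x := Var x)) y) = {} \<or> (\<sigma>(x := Var x)) y = Var y"
      using y Mu.prems(1) by simp
    have "sem n a d (\<sigma> y) (V(x := X)) = sem n a d (\<sigma> y) V" if "y \<noteq> x"
      by (rule sem_cong_fv) (use that y Mu.prems(1)[of y] in auto)
    then show "sem n a d ((\<sigma>(x := Var x)) y) (V(x := X)) = (W(x := X)) y \<inter> positions n"
      using y Mu.prems(2)[of y] by simp
  qed
  then show ?case by simp
next
  case (Nu x \<phi>)
  have "sem n a d (subst \<phi> (\<sigma>(x := Var x))) (V(x := X)) = sem n a d \<phi> (W(x := X))" for X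
  proof (rule Nu.IH)
    fix y assume y: "y \<in> fv \<phi>"
    show "fv ((\<sigma>(x := Var x)) y) = {} \<or> (\<sigma>(x := Var x)) y = Var y"
      using y Nu.prems(1) by simp
    have "sem n a d (\<sigma> y) (V(x := X)) = sem n a d (\<sigma> y) V" if "y \<noteq> x"
      by (rule sem_cong_fv) (use that y Nu.prems(1)[of y] in auto)
    then show "sem n a d ((\<sigma>(x := Var x)) y) (V(x := X)) = (W(x := X)) y \<inter> positions n"
      using y Nu.prems(2)[of y] by simp
  qed
  then show ?case by simp
qed auto

lemma sem_subst_closed:
  assumes "\<And>x. x \<in> fv \<psi> \<Longrightarrow> fv (\<sigma> x) = {}"
  shows "sem n a d (subst \<psi> \<sigma>) V = sem n a d \<psi> (\<lambda>x. sem n a d (\<sigma> x) V)"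
  by (rule sem_subst) (use assms sem_subset_positions in blast)+

text \<open>
  Layers that run on words of any length, finite or infinite: \<open>(cl, T, T\<^sub>\<omega>)\<close> runs on the classes
  if \<open>cl\<close> holds and on the whole word otherwise, using \<open>T\<close> on finite and \<open>T\<^sub>\<omega>\<close> on infinite chains.
\<close>

type_synonym 'a uniform_layer = "bool \<times> 'a letter_transducer \<times> 'a letter_transducer"

definition is_uniform_layer :: "'a set \<Rightarrow> 'a set \<Rightarrow> 'a uniform_layer \<Rightarrow> bool" where
  "is_uniform_layer \<Sigma> \<Gamma> L \<longleftrightarrow>
     functional_transducer (\<Sigma> \<times> UNIV) \<Gamma> (fst (snd L)) \<and> functional_buchi (\<Sigma> \<times> UNIV) \<Gamma> (snd (snd L))"

definition chain_word ::
  "bool \<Rightarrow> enat \<Rightarrow> (nat \<Rightarrow> 'd) \<Rightarrow> nat \<Rightarrow> (nat \<Rightarrow> 'b) \<Rightarrow> nat \<Rightarrow> 'b" where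
  "chain_word cl n d i u = (\<lambda>k. u (enum_set (chain_of cl n d i) k))"

text \<open>The condition is indexed by positions rather than chains; positions of one chain repeat
  the same condition, by \<open>chain_of_eq\<close>.\<close>

definition layer_rel ::
  "enat \<Rightarrow> (nat \<Rightarrow> 'd) \<Rightarrow> 'a uniform_layer \<Rightarrow> (nat \<Rightarrow> 'a) \<Rightarrow> (nat \<Rightarrow> 'a) \<Rightarrow> bool" where
  "layer_rel n d L a b \<longleftrightarrow>
     (\<forall>i. enat i < n \<longrightarrow> trans_rel (fst (snd L)) (snd (snd L)) (csize (chain_of (fst L) n d i))
        (chain_word (fst L) n d i (\<lambda>j. (a j, tp n d j))) (chain_word (fst L) n d i b))"

fun is_uniform_cascade :: "'a set \<Rightarrow> ('a uniform_layer \<times> 'a set) list \<Rightarrow> bool" where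
  "is_uniform_cascade \<Sigma> [] \<longleftrightarrow> finite \<Sigma>"
| "is_uniform_cascade \<Sigma> ((L, \<Gamma>) # Ls) \<longleftrightarrow>
     finite \<Sigma> \<and> is_uniform_layer \<Sigma> \<Gamma> L \<and> is_uniform_cascade \<Gamma> Ls"

text \<open>In contrast to acceptance, the final output is kept, because later layers read truth
  values from it.\<close>

fun cascade_rel ::
  "enat \<Rightarrow> (nat \<Rightarrow> 'd) \<Rightarrow> ('a uniform_layer \<times> 'a set) list \<Rightarrow> (nat \<Rightarrow> 'a) \<Rightarrow> (nat \<Rightarrow> 'a) \<Rightarrow> bool" where
  "cascade_rel n d [] a b \<longleftrightarrow> b = a"
| "cascade_rel n d ((L, \<Gamma>) # Ls) a b \<longleftrightarrow> (\<exists>c. layer_rel n d L a c \<and> cascade_rel n d Ls c b)"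

fun output_alphabet :: "'a set \<Rightarrow> ('a uniform_layer \<times> 'a set) list \<Rightarrow> 'a set" where
  "output_alphabet \<Sigma> [] = \<Sigma>"
| "output_alphabet \<Sigma> ((L, \<Gamma>) # Ls) = output_alphabet \<Gamma> Ls"

text \<open>Cascades are defined by recursion from the input side but grow at the output side, where
  a new formula is evaluated after its components.\<close>

lemma cascade_rel_snoc:
  "cascade_rel n d (Ls @ [(L, \<Gamma>)]) a b \<longleftrightarrow> (\<exists>c. cascade_rel n d Ls a c \<and> layer_rel n d L c b)"
  by (induction Ls arbitrary: a) (auto, blast+)

lemma is_uniform_cascade_snoc:
  "is_uniform_cascade \<Sigma> (Ls @ [(L, \<Gamma>)]) \<longleftrightarrow>
   is_uniform_cascade \<Sigma> Ls \<and> is_uniform_layer (output_alphabet \<Sigma> Ls) \<Gamma> L \<and> finite \<Gamma>"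
  by (induction Ls arbitrary: \<Sigma>) (auto simp: is_uniform_layer_def functional_transducer_def is_transducer_def)

lemma output_alphabet_snoc: "output_alphabet \<Sigma> (Ls @ [(L, \<Gamma>)]) = \<Gamma>"
  by (induction Ls arbitrary: \<Sigma>) auto

lemma finite_output_alphabet: "is_uniform_cascade \<Sigma> Ls \<Longrightarrow> finite (output_alphabet \<Sigma> Ls)"
  by (induction \<Sigma> Ls rule: is_uniform_cascade.induct) auto

lemma seg_nth: "seg ((!) x) 0 (length x) = x"
  by (simp add: seg_def map_nth)

text \<open>The transducers relate exactly the pairs in \<open>Q\<close> over the given alphabets.
  Functionality is thus a property of \<open>Q\<close> and demands no determinism of the
  automata.\<close>

lemma layer_of_regular:
  fixes Q :: "enat \<Rightarrow> (nat \<Rightarrow> ('a \<times> marking) \<times> 'a) \<Rightarrow> bool"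
  assumes Q: "regular Q" and fin: "finite \<Gamma>" "finite \<Gamma>'"
    and functional: "\<And>m u v v' i. 0 < m \<Longrightarrow> Q m (\<lambda>i. (u i, v i)) \<Longrightarrow> Q m (\<lambda>i. (u i, v' i)) \<Longrightarrow>
      enat i < m \<Longrightarrow> v i = v' i"
  obtains L where "fst L = cl" "is_uniform_layer \<Gamma> \<Gamma>' L"
    and "\<And>n d a b. (\<And>i. enat i < n \<Longrightarrow> a i \<in> \<Gamma>) \<Longrightarrow> layer_rel n (d :: nat \<Rightarrow> 'd) L a b \<longleftrightarrow>
      (\<forall>i. enat i < n \<longrightarrow> b i \<in> \<Gamma>' \<and> Q (csize (chain_of cl n d i))
        (\<lambda>k. (chain_word cl n d i (\<lambda>j. (a j, tp n d j)) k, chain_word cl n d i b k)))"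
proof -
  let ?A = "\<Gamma> \<times> (UNIV :: marking set)"
  have "finite ?A" using fin by simp
  from transducers_of_regular[OF Q this fin(2)] obtain T T\<^sub>\<omega>
    where T: "is_transducer ?A \<Gamma>' T" "is_transducer ?A \<Gamma>' T\<^sub>\<omega>"
    and rel: "\<And>m u v. 0 < m \<Longrightarrow> trans_rel T T\<^sub>\<omega> m u v \<longleftrightarrow>
      (\<forall>i. enat i < m \<longrightarrow> u i \<in> ?A \<and> v i \<in> \<Gamma>') \<and> Q m (\<lambda>i. (u i, v i))" by blast
  have "x = y" if "(w, x) \<in> word_rel T" "(w, y) \<in> word_rel T" for w x y
  proof (cases "w = []")
    \<comment> \<open>The specification of \<open>T\<close> covers nonempty words only; on the empty
      input the output is empty by the length condition in \<open>word_rel\<close>.\<close>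
    case True
    then show ?thesis using that by (simp add: word_rel_def)
  next
    case False
    have len: "length x = length w" "length y = length w" using that by (simp_all add: word_rel_def)
    have "trans_rel T T\<^sub>\<omega> (enat (length w)) ((!) w) ((!) x)"
      "trans_rel T T\<^sub>\<omega> (enat (length w)) ((!) w) ((!) y)"
      using that seg_nth[of w] seg_nth[of x] seg_nth[of y] len by (simp_all add: trans_rel_def)
    moreover have "0 < enat (length w)" using False by (simp add: zero_enat_def)
    ultimately have "\<And>i. i < length w \<Longrightarrow> x ! i = y ! i"
      using functional[of "enat (length w)" "(!) w" "(!) x" "(!) y"] rel by auto
    then show ?thesis using len by (intro nth_equalityI) auto
  qed
  then have "functional_transducer ?A \<Gamma>' T"
    using T(1) by (auto simp: functional_transducer_def intro!: single_valuedI)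
  moreover have "x = y" if "(w, x) \<in> buchi_rel T\<^sub>\<omega>" "(w, y) \<in> buchi_rel T\<^sub>\<omega>" for w x y
    using functional[of \<infinity> w x y] rel[of \<infinity> w x] rel[of \<infinity> w y] that by (auto simp: trans_rel_def fun_eq_iff)
  then have "functional_buchi ?A \<Gamma>' T\<^sub>\<omega>"
    using T(2) by (auto simp: functional_buchi_def intro!: single_valuedI)
  ultimately have "is_uniform_layer \<Gamma> \<Gamma>' (cl, T, T\<^sub>\<omega>)" by (simp add: is_uniform_layer_def)
  moreover have "layer_rel n d (cl, T, T\<^sub>\<omega>) a b \<longleftrightarrow>
      (\<forall>i. enat i < n \<longrightarrow> b i \<in> \<Gamma>' \<and> Q (csize (chain_of cl n d i))
        (\<lambda>k. (chain_word cl n d i (\<lambda>j. (a j, tp n d j)) k, chain_word cl n d i b k)))"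
    if a: "\<And>i. enat i < n \<Longrightarrow> a i \<in> \<Gamma>" for n a b and d :: "nat \<Rightarrow> 'd"
  proof -
    have in_n: "enat (enum_set (chain_of cl n d i) k) < n" if "enat k < csize (chain_of cl n d i)" for i k
      using enum_set_in[OF that] chain_of_subset[of cl n d i] by auto
    let ?Q = "\<lambda>i. Q (csize (chain_of cl n d i))
      (\<lambda>k. (chain_word cl n d i (\<lambda>j. (a j, tp n d j)) k, chain_word cl n d i b k))"
    have "trans_rel T T\<^sub>\<omega> (csize (chain_of cl n d i)) (chain_word cl n d i (\<lambda>j. (a j, tp n d j)))
        (chain_word cl n d i b) \<longleftrightarrow>
      (\<forall>k. enat k < csize (chain_of cl n d i) \<longrightarrow> b (enum_set (chain_of cl n d i) k) \<in> \<Gamma>') \<and> ?Q i"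
      if i: "enat i < n" for i
      unfolding rel[OF csize_chain_pos[OF i]] chain_word_def using a in_n by blast
    then have "layer_rel n d (cl, T, T\<^sub>\<omega>) a b \<longleftrightarrow> (\<forall>i. enat i < n \<longrightarrow>
      (\<forall>k. enat k < csize (chain_of cl n d i) \<longrightarrow> b (enum_set (chain_of cl n d i) k) \<in> \<Gamma>') \<and> ?Q i)"
      unfolding layer_rel_def fst_conv snd_conv by blast
    \<comment> \<open>The chains cover the word, so checking output letters chain by chain is
      checking them at every position.\<close>
    moreover have "(\<forall>i. enat i < n \<longrightarrow> (\<forall>k. enat k < csize (chain_of cl n d i) \<longrightarrow>
        b (enum_set (chain_of cl n d i) k) \<in> \<Gamma>')) \<longleftrightarrow> (\<forall>i. enat i < n \<longrightarrow> b i \<in> \<Gamma>')"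
      using in_n self_in_chain enum_set_obtain by metis
    ultimately show ?thesis by blast
  qed
  ultimately show ?thesis using that[of "(cl, T, T\<^sub>\<omega>)"] by simp
qed

section \<open>Cascades that annotate a word with truth values\<close>

text \<open>The cascade rejects no word over \<open>\<Sigma>\<close>, and \<open>dec\<close> reads
  the truth value of every formula in \<open>\<Phi>\<close> from a letter of the last alphabet. The
  first argument fixes the type of data values, which occurs in no other argument.\<close>

definition annotates ::
  "'d itself \<Rightarrow> 'a set \<Rightarrow> ('a uniform_layer \<times> 'a set) list \<Rightarrow> 'a fm set \<Rightarrow> ('a fm \<Rightarrow> 'a \<Rightarrow> bool) \<Rightarrow> bool"
  where
  "annotates _ \<Sigma> Ls \<Phi> dec \<longleftrightarrow> is_uniform_cascade \<Sigma> Ls \<and>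
     (\<forall>n (d :: nat \<Rightarrow> 'd) a. (\<forall>i. enat i < n \<longrightarrow> a i \<in> \<Sigma>) \<longrightarrow>
        (\<exists>b. cascade_rel n d Ls a b) \<and>
        (\<forall>b. cascade_rel n d Ls a b \<longrightarrow> (\<forall>i. enat i < n \<longrightarrow> b i \<in> output_alphabet \<Sigma> Ls \<and>
           (\<forall>\<phi> \<in> \<Phi>. dec \<phi> (b i) \<longleftrightarrow> i \<in> sem n a d \<phi> (\<lambda>_. {})))))"

definition annotatable :: "'d itself \<Rightarrow> 'a set \<Rightarrow> 'a fm set \<Rightarrow> bool" where
  "annotatable D \<Sigma> \<Phi> \<longleftrightarrow> (\<exists>Ls dec. annotates D \<Sigma> Ls \<Phi> dec)"

lemma annotates_mono:
  assumes "annotates D \<Sigma> Ls \<Phi> dec" "\<Psi> \<subseteq> \<Phi>"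
  shows "annotates D \<Sigma> Ls \<Psi> dec"
  using assms(1) unfolding annotates_def
  using assms(2) by (intro conjI allI impI ballI) blast+

lemma annotatable_mono: "annotatable D \<Sigma> \<Phi> \<Longrightarrow> \<Psi> \<subseteq> \<Phi> \<Longrightarrow> annotatable D \<Sigma> \<Psi>"
  unfolding annotatable_def using annotates_mono by blast

lemma annotatable_letters: "finite \<Sigma> \<Longrightarrow> annotatable D \<Sigma> (range (\<lambda>c. Pos (Letter c)))"
  unfolding annotatable_def annotates_def
  by (intro exI[of _ "[]"] exI[of _ "\<lambda>\<phi> b. \<phi> = Pos (Letter b)"]) auto

text \<open>The new layer writes a code of the old letter together with the truth value of
  \<open>\<phi>\<close>, so everything known before stays readable. The premise \<open>sem\<close>
  asks that the regular operator \<open>F\<close> compute \<open>\<phi>\<close> on each chain from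
  the old letters and the marking.\<close>

lemma annotatable_insert:
  fixes \<Phi> :: "'a fm set"
  assumes inf: "infinite (UNIV :: 'a set)"
    and ann: "annotates TYPE('d) \<Sigma> Ls \<Phi> dec" and F: "regular_op F"
    and sem: "\<And>n (d :: nat \<Rightarrow> 'd) a b i k. (\<And>i. enat i < n \<Longrightarrow> a i \<in> \<Sigma>) \<Longrightarrow>
      (\<And>i \<psi>. enat i < n \<Longrightarrow> \<psi> \<in> \<Phi> \<Longrightarrow> dec \<psi> (b i) \<longleftrightarrow> i \<in> sem n a d \<psi> (\<lambda>_. {})) \<Longrightarrow>
      enat i < n \<Longrightarrow> enat k < csize (chain_of cl n d i) \<Longrightarrow>
      k \<in> F (csize (chain_of cl n d i)) (chain_word cl n d i (\<lambda>j. (b j, tp n d j))) \<longleftrightarrow>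
      enum_set (chain_of cl n d i) k \<in> sem n a d \<phi> (\<lambda>_. {})"
  shows "annotatable TYPE('d) \<Sigma> (insert \<phi> \<Phi>)"
proof -
  have casc: "is_uniform_cascade \<Sigma> Ls" using ann by (simp add: annotates_def)
  let ?\<Gamma> = "output_alphabet \<Sigma> Ls"
  have fin: "finite ?\<Gamma>" using casc by (rule finite_output_alphabet)
  then have fin2: "finite (?\<Gamma> \<times> (UNIV :: bool set))" by simp
  \<comment> \<open>Since \<open>'a\<close> is infinite, it has a finite subset with twice as many
    elements as the old alphabet, which leaves room for one more bit.\<close>
  obtain B :: "'a set" where "finite B" "card B = card (?\<Gamma> \<times> (UNIV :: bool set))"
    using infinite_arbitrarily_large[OF inf] by blast
  then obtain c :: "'a \<times> bool \<Rightarrow> 'a" where "bij_betw c (?\<Gamma> \<times> UNIV) B"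
    using finite_same_card_bij fin2 by metis
  then have c: "inj_on c (?\<Gamma> \<times> UNIV)" by (simp add: bij_betw_def)
  let ?\<Gamma>' = "c ` (?\<Gamma> \<times> UNIV)"
  define Q where "Q m w \<longleftrightarrow> (\<forall>i. enat i < m \<longrightarrow> snd (w i) = c (fst (fst (w i)), i \<in> F m (\<lambda>i. fst (w i))))"
    for m and w :: "nat \<Rightarrow> ('a \<times> marking) \<times> 'a"
  have "regular Q"
    unfolding Q_def by (rule regular_all_comp[OF regular_op_map[OF F]])
  moreover have "v i = v' i" if "Q m (\<lambda>i. (u i, v i))" "Q m (\<lambda>i. (u i, v' i))" "enat i < m" for m u v v' i
    using that by (simp add: Q_def)
  ultimately obtain L where L: "fst L = cl" "is_uniform_layer ?\<Gamma> ?\<Gamma>' L"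
    "\<And>n d a b. (\<And>i. enat i < n \<Longrightarrow> a i \<in> ?\<Gamma>) \<Longrightarrow> layer_rel n (d :: nat \<Rightarrow> 'd) L a b \<longleftrightarrow>
      (\<forall>i. enat i < n \<longrightarrow> b i \<in> ?\<Gamma>' \<and> Q (csize (chain_of cl n d i))
        (\<lambda>k. (chain_word cl n d i (\<lambda>j. (a j, tp n d j)) k, chain_word cl n d i b k)))"
    using layer_of_regular[of Q ?\<Gamma> ?\<Gamma>' cl thesis] fin fin2 by blast
  define dec' where "dec' \<psi> x = (let y = inv_into (?\<Gamma> \<times> UNIV) c x in
    if \<psi> = \<phi> then snd y else dec \<psi> (fst y))" for \<psi> x
  have "annotates TYPE('d) \<Sigma> (Ls @ [(L, ?\<Gamma>')]) (insert \<phi> \<Phi>) dec'"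
    unfolding annotates_def
  proof (intro conjI allI impI)
    show "is_uniform_cascade \<Sigma> (Ls @ [(L, ?\<Gamma>')])"
      using casc L(2) fin2 by (simp add: is_uniform_cascade_snoc)
  next
    fix n :: enat and d :: "nat \<Rightarrow> 'd" and a
    assume a: "\<forall>i. enat i < n \<longrightarrow> a i \<in> \<Sigma>"
    let ?sem = "\<lambda>\<psi>. sem n a d \<psi> (\<lambda>_. {})"
    have ex: "\<exists>b. cascade_rel n d Ls a b" and b: "\<And>b i. cascade_rel n d Ls a b \<Longrightarrow> enat i < n \<Longrightarrow>
      b i \<in> ?\<Gamma> \<and> (\<forall>\<psi> \<in> \<Phi>. dec \<psi> (b i) \<longleftrightarrow> i \<in> ?sem \<psi>)"
      using ann a unfolding annotates_def by blast+
    \<comment> \<open>Below \<open>n\<close> the output of the new layer is determined, which gives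
      both its success and the meaning of its letters.\<close>
    have key: "layer_rel n d L b b' \<longleftrightarrow> (\<forall>i. enat i < n \<longrightarrow> b' i = c (b i, i \<in> ?sem \<phi>))"
      if casc_b: "cascade_rel n d Ls a b" for b b'
    proof -
      note bb = b[OF casc_b]
      have QC: "Q (csize (chain_of cl n d i))
        (\<lambda>k. (chain_word cl n d i (\<lambda>j. (b j, tp n d j)) k, chain_word cl n d i b' k)) \<longleftrightarrow>
        (\<forall>j \<in> chain_of cl n d i. b' j = c (b j, j \<in> ?sem \<phi>))" if i: "enat i < n" for i
      proof -
        let ?C = "chain_of cl n d i"
        have "Q (csize ?C)
          (\<lambda>k. (chain_word cl n d i (\<lambda>j. (b j, tp n d j)) k, chain_word cl n d i b' k)) \<longleftrightarrow>
          (\<forall>k. enat k < csize ?C \<longrightarrow> b' (enum_set ?C k) = c (b (enum_set ?C k), enum_set ?C k \<in> ?sem \<phi>))"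
          unfolding Q_def fst_conv snd_conv
          using sem[of n a b d i] a bb i by (simp add: chain_word_def)
        also have "\<dots> \<longleftrightarrow> (\<forall>j \<in> ?C. b' j = c (b j, j \<in> ?sem \<phi>))"
          using enum_set_in enum_set_obtain by metis
        finally show ?thesis .
      qed
      have "layer_rel n d L b b' \<longleftrightarrow> (\<forall>i. enat i < n \<longrightarrow> b' i \<in> ?\<Gamma>' \<and>
          (\<forall>j \<in> chain_of cl n d i. b' j = c (b j, j \<in> ?sem \<phi>)))"
        using L(3)[of n b d b'] bb QC by blast
      also have "\<dots> \<longleftrightarrow> (\<forall>i. enat i < n \<longrightarrow> b' i = c (b i, i \<in> ?sem \<phi>))"
        using bb self_in_chain[of _ n cl d] chain_of_subset[of cl n d] by (auto simp: subset_iff)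
      finally show ?thesis .
    qed
    show "\<exists>b. cascade_rel n d (Ls @ [(L, ?\<Gamma>')]) a b"
    proof -
      obtain b0 where "cascade_rel n d Ls a b0" using ex by blast
      moreover from this have "layer_rel n d L b0 (\<lambda>i. c (b0 i, i \<in> ?sem \<phi>))" using key by simp
      ultimately show ?thesis unfolding cascade_rel_snoc by blast
    qed
    fix b' i assume b': "cascade_rel n d (Ls @ [(L, ?\<Gamma>')]) a b'" and i: "enat i < n"
    then obtain b0 where b0: "cascade_rel n d Ls a b0" "b' i = c (b0 i, i \<in> ?sem \<phi>)"
      unfolding cascade_rel_snoc using key by blast
    then have in\<Gamma>: "(b0 i, i \<in> ?sem \<phi>) \<in> ?\<Gamma> \<times> UNIV" using b i by simp
    then show "b' i \<in> output_alphabet \<Sigma> (Ls @ [(L, ?\<Gamma>')])"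
      unfolding output_alphabet_snoc b0(2) by (rule imageI)
    have "inv_into (?\<Gamma> \<times> UNIV) c (b' i) = (b0 i, i \<in> ?sem \<phi>)"
      unfolding b0(2) using c in\<Gamma> by (rule inv_into_f_f)
    then show "\<forall>\<psi> \<in> insert \<phi> \<Phi>. dec' \<psi> (b' i) \<longleftrightarrow> i \<in> ?sem \<psi>"
      using b[OF b0(1) i] by (auto simp: dec'_def)
  qed
  then show ?thesis unfolding annotatable_def by blast
qed

lemma chain_in_positions:
  assumes "enat k < csize (chain_of cl n d i)"
  shows "enat (enum_set (chain_of cl n d i) k) < n"
  using enum_set_in[OF assms] chain_of_subset[of cl n d i] by auto

text \<open>Atoms of both kinds are annotated in advance: a formula over the global modalities may
  test the class atoms, which a global layer cannot compute on its own, and conversely.\<close>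

lemma annotatable_atoms:
  fixes \<Sigma> :: "'a set"
  assumes inf: "infinite (UNIV :: 'a set)" and fin: "finite \<Sigma>"
  shows "annotatable TYPE('d) \<Sigma> (range Pos)"
proof -
  have first: "annotatable TYPE('d) \<Sigma> (insert (Pos (first_atom cl)) \<Phi>)"
    if ann: "annotatable TYPE('d) \<Sigma> \<Phi>" for \<Phi> cl
  proof -
    obtain Ls dec where "annotates TYPE('d) \<Sigma> Ls \<Phi> dec" using ann unfolding annotatable_def by blast
    from annotatable_insert[OF inf this regular_op_first, of cl "Pos (first_atom cl)"] show ?thesis
      by (simp add: first_on_chain chain_in_positions)
  qed
  have last: "annotatable TYPE('d) \<Sigma> (insert (Pos (last_atom cl)) \<Phi>)"
    if ann: "annotatable TYPE('d) \<Sigma> \<Phi>" for \<Phi> cl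
  proof -
    obtain Ls dec where "annotates TYPE('d) \<Sigma> Ls \<Phi> dec" using ann unfolding annotatable_def by blast
    from annotatable_insert[OF inf this regular_op_last, of cl "Pos (last_atom cl)"] show ?thesis
      by (simp add: last_on_chain chain_in_positions)
  qed
  have marking: "annotatable TYPE('d) \<Sigma> (insert (Pos A) \<Phi>)"
    if ann: "annotatable TYPE('d) \<Sigma> \<Phi>" and A: "A = AtS \<or> A = AtP" for \<Phi> A
  proof -
    obtain Ls dec where "annotates TYPE('d) \<Sigma> Ls \<Phi> dec" using ann unfolding annotatable_def by blast
    from annotatable_insert[OF inf this regular_op_pointwise[of
      "\<lambda>c. if A = AtS then snd (snd c) else fst (snd c)"], of False "Pos A"] A show ?thesis
      by (auto simp: chain_in_positions chain_word_def tp_def)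
  qed
  let ?\<Phi> = "insert (Pos AtS) (insert (Pos AtP) (insert (Pos (first_atom False))
    (insert (Pos (first_atom True)) (insert (Pos (last_atom False)) (insert (Pos (last_atom True))
    (range (\<lambda>c. Pos (Letter c))))))))"
  have "annotatable TYPE('d) \<Sigma> ?\<Phi>"
    by (intro marking first last annotatable_letters fin) auto
  moreover have "Pos A \<in> ?\<Phi>" for A
    by (cases A) (auto simp: first_atom_def last_atom_def)
  then have "range Pos \<subseteq> ?\<Phi>" by (rule image_subsetI)
  ultimately show ?thesis by (rule annotatable_mono)
qed

text \<open>The map \<open>g\<close> decodes a letter into the atoms and free variables of
  \<open>\<psi>\<close> that are true there, a variable \<open>x\<close> standing for the formula
  \<open>\<sigma> x\<close> evaluated earlier. On each chain \<open>\<psi>\<close> is then a formula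
  on a plain word.\<close>

lemma annotatable_subst:
  fixes \<Phi> :: "'a fm set"
  assumes inf: "infinite (UNIV :: 'a set)" and ann: "annotatable TYPE('d) \<Sigma> \<Phi>"
    and atoms: "range Pos \<subseteq> \<Phi>" and \<psi>: "modalities \<psi> \<subseteq> {next_mod cl, prev_mod cl}"
    and \<sigma>: "\<And>x. x \<in> fv \<psi> \<Longrightarrow> \<sigma> x \<in> \<Phi> \<and> fv (\<sigma> x) = {}"
  shows "annotatable TYPE('d) \<Sigma> (insert (subst \<psi> \<sigma>) \<Phi>)"
proof -
  obtain Ls dec where dec: "annotates TYPE('d) \<Sigma> Ls \<Phi> dec" using ann unfolding annotatable_def by blast
  define g :: "'a \<times> marking \<Rightarrow> 'a atom set \<times> nat set" where
    "g c = ({A. dec (Pos A) (fst c)}, {x. dec (\<sigma> x) (fst c)})" for c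
  show ?thesis
  proof (rule annotatable_insert[OF inf dec regular_op_map[OF regular_op_wsem[of \<psi>], of g], of cl])
    fix n i k a b and d :: "nat \<Rightarrow> 'd"
    let ?C = "chain_of cl n d i"
    assume dec_b: "\<And>i \<phi>. enat i < n \<Longrightarrow> \<phi> \<in> \<Phi> \<Longrightarrow> dec \<phi> (b i) \<longleftrightarrow> i \<in> sem n a d \<phi> (\<lambda>_. {})"
      and k: "enat k < csize ?C"
    have "wsem_letters \<psi> (csize ?C) (\<lambda>l. g (chain_word cl n d i (\<lambda>j. (b j, tp n d j)) l)) =
      wsem (csize ?C) (\<lambda>A. {k. enat k < csize ?C \<and> holds_atom n a d A (enum_set ?C k)}) \<psi>
        (\<lambda>x. {k. enat k < csize ?C \<and> enum_set ?C k \<in> sem n a d (\<sigma> x) (\<lambda>_. {})})"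
      unfolding wsem_letters_def
    proof (rule wsem_cong_fv)
      fix A
      have "Pos A \<in> \<Phi>" using atoms by auto
      then show "{k. A \<in> fst (g (chain_word cl n d i (\<lambda>j. (b j, tp n d j)) k))} \<inter> positions (csize ?C) =
        {k. enat k < csize ?C \<and> holds_atom n a d A (enum_set ?C k)} \<inter> positions (csize ?C)"
        using dec_b chain_in_positions[of _ cl n d i] by (auto simp: g_def chain_word_def)
    next
      fix x assume "x \<in> fv \<psi>"
      then have "\<sigma> x \<in> \<Phi>" using \<sigma> by blast
      then show "{k. x \<in> snd (g (chain_word cl n d i (\<lambda>j. (b j, tp n d j)) k))} \<inter> positions (csize ?C) =
        {k. enat k < csize ?C \<and> enum_set ?C k \<in> sem n a d (\<sigma> x) (\<lambda>_. {})} \<inter> positions (csize ?C)"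
        using dec_b chain_in_positions[of _ cl n d i] by (auto simp: g_def chain_word_def)
    qed
    then show "k \<in> wsem_letters \<psi> (csize ?C) (\<lambda>l. g (chain_word cl n d i (\<lambda>j. (b j, tp n d j)) l)) \<longleftrightarrow>
      enum_set ?C k \<in> sem n a d (subst \<psi> \<sigma>) (\<lambda>_. {})"
      using sem_on_chain[OF \<psi> refl k] \<sigma> by (simp add: sem_subst_closed)
  qed
qed

lemma modalities_cases:
  assumes "\<psi> \<in> Formulas \<Sigma> {Xg, Yg} \<union> Formulas \<Sigma> {Xc, Yc}"
  obtains cl where "modalities \<psi> \<subseteq> {next_mod cl, prev_mod cl}"
  using assms that[of True] that[of False]
  by (auto simp: Formulas_def next_mod_def prev_mod_def)

text \<open>A nested induction, on the level and on the finite set \<open>\<Psi>\<close>. The set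
  \<open>\<Phi>\<close> of formulas already annotated is kept general, since the arguments of one
  formula are annotated on top of everything found before.\<close>

lemma annotatable_Comp_upto:
  fixes \<Phi> :: "'a fm set"
  assumes inf: "infinite (UNIV :: 'a set)"
  shows "finite \<Psi> \<Longrightarrow> \<Psi> \<subseteq> Comp_upto m (Formulas \<Sigma> {Xg, Yg} \<union> Formulas \<Sigma> {Xc, Yc}) \<Longrightarrow>
    range Pos \<subseteq> \<Phi> \<Longrightarrow> annotatable TYPE('d) \<Sigma> \<Phi> \<Longrightarrow> annotatable TYPE('d) \<Sigma> (\<Psi> \<union> \<Phi>)"
proof (induction m arbitrary: \<Psi> \<Phi>)
  case 0
  then show ?case by simp
next
  case (Suc m)
  note outer = Suc.IH
  from Suc.prems show ?case
  proof (induction \<Psi> rule: finite_induct)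
    case empty
    then show ?case by simp
  next
    case (insert \<phi> \<Psi>)
    let ?U = "Formulas \<Sigma> {Xg, Yg} \<union> Formulas \<Sigma> {Xc, Yc}"
    obtain \<psi> \<sigma> where \<psi>: "\<phi> = subst \<psi> \<sigma>" "\<psi> \<in> ?U" "\<forall>x \<in> fv \<psi>. \<sigma> x \<in> Comp_upto m ?U"
      using insert.prems(1) by auto
    obtain cl where cl: "modalities \<psi> \<subseteq> {next_mod cl, prev_mod cl}"
      using \<psi>(2) by (rule modalities_cases)
    \<comment> \<open>The finitely many arguments of the new formula are of lower level and are
      annotated first.\<close>
    let ?\<Phi> = "\<sigma> ` fv \<psi> \<union> (\<Psi> \<union> \<Phi>)"
    have "annotatable TYPE('d) \<Sigma> (\<Psi> \<union> \<Phi>)" using insert by blast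
    then have "annotatable TYPE('d) \<Sigma> ?\<Phi>"
      by (rule outer[rotated -1]) (use \<psi>(3) finite_fv insert.prems in auto)
    moreover have "fv (\<sigma> x) = {}" if "x \<in> fv \<psi>" for x
      using \<psi>(3) that fv_Comp[of "\<sigma> x" ?U] by (auto simp: Comp_def)
    ultimately have "annotatable TYPE('d) \<Sigma> (insert \<phi> ?\<Phi>)"
      unfolding \<psi>(1) by (intro annotatable_subst[OF inf _ _ cl]) (use insert.prems in auto)
    then show ?case by (rule annotatable_mono) auto
  qed
qed

theorem cascade_of_BMA:
  fixes \<Sigma> :: "'a set"
  assumes inf: "infinite (UNIV :: 'a set)" and fin: "finite \<Sigma>" and \<phi>: "\<phi> \<in> BMA \<Sigma>"
  obtains Ls where "is_uniform_cascade \<Sigma> Ls"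
    and "\<And>n (d :: nat \<Rightarrow> 'd) a. 0 < n \<Longrightarrow> (\<And>i. enat i < n \<Longrightarrow> a i \<in> \<Sigma>) \<Longrightarrow>
      (\<exists>b. cascade_rel n d Ls a b) \<longleftrightarrow> 0 \<in> sem n a d \<phi> (\<lambda>_. {})"
proof -
  let ?U = "Formulas \<Sigma> {Xg, Yg} \<union> Formulas \<Sigma> {Xc, Yc}"
  obtain m where "{\<phi>} \<subseteq> Comp_upto m ?U" using \<phi> by (auto simp: BMA_def Comp_def)
  then have "annotatable TYPE('d) \<Sigma> ({\<phi>} \<union> range Pos)"
    by (intro annotatable_Comp_upto[OF inf]) (auto intro: annotatable_atoms[OF inf fin])
  then obtain Ls dec where ann: "annotates TYPE('d) \<Sigma> Ls ({\<phi>} \<union> range Pos) dec"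
    unfolding annotatable_def by blast
  let ?\<Gamma> = "output_alphabet \<Sigma> Ls"
  have casc: "is_uniform_cascade \<Sigma> Ls" using ann by (simp add: annotates_def)
  have fin\<Gamma>: "finite ?\<Gamma>" using casc by (rule finite_output_alphabet)
  \<comment> \<open>The annotating cascade never rejects. One final global layer copies the word and
    succeeds only if the first letter carries the truth of \<open>\<phi>\<close>.\<close>
  define Q where "Q m w \<longleftrightarrow> dec \<phi> (fst (fst (w 0))) \<and> (\<forall>i. enat i < m \<longrightarrow> snd (w i) = fst (fst (w i)))"
    for m :: enat and w :: "nat \<Rightarrow> ('a \<times> marking) \<times> 'a"
  have "regular Q"
    unfolding Q_def by (intro regular_conj regular_first regular_all)
  moreover have "v i = v' i" if "Q m (\<lambda>i. (u i, v i))" "Q m (\<lambda>i. (u i, v' i))" "enat i < m" for m u v v' i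
    using that by (simp add: Q_def)
  ultimately obtain L where L: "fst L = False" "is_uniform_layer ?\<Gamma> ?\<Gamma> L"
    "\<And>n d a b. (\<And>i. enat i < n \<Longrightarrow> a i \<in> ?\<Gamma>) \<Longrightarrow> layer_rel n (d :: nat \<Rightarrow> 'd) L a b \<longleftrightarrow>
      (\<forall>i. enat i < n \<longrightarrow> b i \<in> ?\<Gamma> \<and> Q (csize (chain_of False n d i))
        (\<lambda>k. (chain_word False n d i (\<lambda>j. (a j, tp n d j)) k, chain_word False n d i b k)))"
    using layer_of_regular[of Q ?\<Gamma> ?\<Gamma> False thesis] fin\<Gamma> by blast
  have "is_uniform_cascade \<Sigma> (Ls @ [(L, ?\<Gamma>)])"
    using casc L(2) fin\<Gamma> by (simp add: is_uniform_cascade_snoc)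
  moreover have "(\<exists>b. cascade_rel n d (Ls @ [(L, ?\<Gamma>)]) a b) \<longleftrightarrow> 0 \<in> sem n a d \<phi> (\<lambda>_. {})"
    if n: "0 < n" and a: "\<And>i. enat i < n \<Longrightarrow> a i \<in> \<Sigma>" for n a and d :: "nat \<Rightarrow> 'd"
  proof -
    have n0: "enat 0 < n" using n by (simp add: zero_enat_def)
    have ex: "\<exists>b. cascade_rel n d Ls a b" and b: "\<And>b i. cascade_rel n d Ls a b \<Longrightarrow> enat i < n \<Longrightarrow>
      b i \<in> ?\<Gamma> \<and> (dec \<phi> (b i) \<longleftrightarrow> i \<in> sem n a d \<phi> (\<lambda>_. {}))"
      using ann a unfolding annotates_def by blast+
    have e0: "enum_set (chain_of False n d i) 0 = 0" if "enat i < n" for i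
      using first_on_chain[of 0 False n d i] csize_chain_pos[OF that, of False d]
      by (simp add: first_atom_def flip: zero_enat_def)
    have "(\<exists>b'. layer_rel n d L b b') \<longleftrightarrow> 0 \<in> sem n a d \<phi> (\<lambda>_. {})"
      if casc_b: "cascade_rel n d Ls a b" for b
    proof -
      note bb = b[OF casc_b]
      note rel = L(3)[of n b d, OF conjunct1[OF bb]]
      show ?thesis
      proof
        assume "\<exists>b'. layer_rel n d L b b'"
        then have "dec \<phi> (b 0)" using rel n0 e0[OF n0] by (auto simp: Q_def chain_word_def)
        then show "0 \<in> sem n a d \<phi> (\<lambda>_. {})" using bb[OF n0] by simp
      next
        assume "0 \<in> sem n a d \<phi> (\<lambda>_. {})"
        then have "dec \<phi> (b 0)" using bb[OF n0] by simp
        then have "layer_rel n d L b b" using rel bb e0 by (auto simp: Q_def chain_word_def)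
        then show "\<exists>b'. layer_rel n d L b b'" by blast
      qed
    qed
    then show ?thesis unfolding cascade_rel_snoc using ex by blast
  qed
  ultimately show ?thesis by (rule that)
qed

section \<open>From transducers to formulas\<close>

text \<open>The empty disjunction is a contradiction built from an atom without letters, so that it
  is available over every alphabet. The choice of a list ordering \<open>S\<close> has no effect on
  the denotation.\<close>

definition big_or :: "('b \<Rightarrow> 'a fm) \<Rightarrow> 'b set \<Rightarrow> 'a fm" where
  "big_or f S = foldr (\<lambda>x. Or (f x)) (SOME xs. set xs = S) (And (Pos FirstG) (Neg FirstG))"

lemma wsem_big_or:
  assumes "finite S"
  shows "wsem m \<alpha> (big_or f S) V = (\<Union>x \<in> S. wsem m \<alpha> (f x) V)"
proof -
  have "set (SOME xs. set xs = S) = S" by (rule someI_ex) (rule finite_list[OF assms])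
  moreover have "wsem m \<alpha> (foldr (\<lambda>x. Or (f x)) xs (And (Pos FirstG) (Neg FirstG))) V =
    (\<Union>x \<in> set xs. wsem m \<alpha> (f x) V)" for xs
    by (induction xs) auto
  ultimately show ?thesis by (simp add: big_or_def)
qed

lemma sem_big_or:
  assumes "finite S"
  shows "sem n a d (big_or f S) V = (\<Union>x \<in> S. sem n a d (f x) V)"
proof -
  have "set (SOME xs. set xs = S) = S" by (rule someI_ex) (rule finite_list[OF assms])
  moreover have "sem n a d (foldr (\<lambda>x. Or (f x)) xs (And (Pos FirstG) (Neg FirstG))) V =
    (\<Union>x \<in> set xs. sem n a d (f x) V)" for xs
    by (induction xs) auto
  ultimately show ?thesis by (simp add: big_or_def)
qed

text \<open>Letters are excluded because those of an intermediate alphabet need not belong to the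
  input alphabet; they occur as variables in \<open>L\<close>. A pure formula has modalities of one
  kind and may therefore be used as an outermost component in \<open>Comp\<close>.\<close>

definition pure_fm :: "bool \<Rightarrow> nat set \<Rightarrow> 'a fm \<Rightarrow> bool" where
  "pure_fm cl L \<phi> \<longleftrightarrow> fv \<phi> \<subseteq> L \<and> modalities \<phi> \<subseteq> {next_mod cl, prev_mod cl} \<and> letters \<phi> = {}"

lemma pure_fm_simps [simp]:
  "pure_fm cl L (Var x) \<longleftrightarrow> x \<in> L"
  "pure_fm cl L (Pos A) \<longleftrightarrow> atom_letters A = {}"
  "pure_fm cl L (Neg A) \<longleftrightarrow> atom_letters A = {}"
  "pure_fm cl L (Modal M \<phi>) \<longleftrightarrow> M \<in> {next_mod cl, prev_mod cl} \<and> pure_fm cl L \<phi>"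
  "pure_fm cl L (Or \<phi> \<psi>) \<longleftrightarrow> pure_fm cl L \<phi> \<and> pure_fm cl L \<psi>"
  "pure_fm cl L (And \<phi> \<psi>) \<longleftrightarrow> pure_fm cl L \<phi> \<and> pure_fm cl L \<psi>"
  "pure_fm cl L (Mu x \<phi>) \<longleftrightarrow> pure_fm cl (insert x L) \<phi>"
  "pure_fm cl L (Nu x \<phi>) \<longleftrightarrow> pure_fm cl (insert x L) \<phi>"
  by (auto simp: pure_fm_def)

lemma pure_fm_big_or:
  assumes "finite S" "\<And>x. x \<in> S \<Longrightarrow> pure_fm cl L (f x)"
  shows "pure_fm cl L (big_or f S)"
proof -
  have "set (SOME xs. set xs = S) = S" by (rule someI_ex) (rule finite_list[OF assms(1)])
  moreover have "(\<And>x. x \<in> set xs \<Longrightarrow> pure_fm cl L (f x)) \<Longrightarrow>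
    pure_fm cl L (foldr (\<lambda>x. Or (f x)) xs (And (Pos FirstG) (Neg FirstG)))" for xs
    by (induction xs) auto
  ultimately show ?thesis using assms(2) unfolding big_or_def by metis
qed

lemma first_last_no_letters [simp]: "atom_letters (first_atom cl) = {}" "atom_letters (last_atom cl) = {}"
  by (simp_all add: first_atom_def last_atom_def)

section \<open>Paths and Kleene's decomposition\<close>

text \<open>Nodes are pairs of a state and a position. Only intermediate states are confined to
  \<open>S\<close>, and a path has at least one step.\<close>

inductive path :: "('s \<times> 't \<Rightarrow> 's \<times> 't \<Rightarrow> bool) \<Rightarrow> 's set \<Rightarrow> 's \<times> 't \<Rightarrow> 's \<times> 't \<Rightarrow> bool"
  for st S where
  path_base: "st x y \<Longrightarrow> path st S x y"
| path_step: "path st S x y \<Longrightarrow> fst y \<in> S \<Longrightarrow> st y z \<Longrightarrow> path st S x z"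

lemma path_trans:
  assumes "path st S y z" "path st S x y" "fst y \<in> S"
  shows "path st S x z"
  using assms by induction (auto intro: path.intros)

lemma path_mono: "path st S x y \<Longrightarrow> S \<subseteq> S' \<Longrightarrow> path st S' x y"
  by (induction rule: path.induct) (auto intro: path.intros)

text \<open>Cut a path at its visits to \<open>s\<close>: \<open>i\<close> and \<open>i'\<close> are
  the positions of the first and the last visit, and between them lie returns to \<open>s\<close>
  that use only states of \<open>S\<close> on the way.\<close>

lemma path_insert:
  "path st (insert s S) x y \<longleftrightarrow> path st S x y \<or>
   (\<exists>i i'. path st S x (s, i) \<and> (i, i') \<in> {(k, j). path st S (s, k) (s, j)}\<^sup>* \<and> path st S (s, i') y)"
   (is "?L \<longleftrightarrow> ?R x y")
proof
  assume ?L
  then show "?R x y"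
  proof induction
    case (path_base x y)
    then show ?case by (auto intro: path.path_base)
  next
    case (path_step x y z)
    show ?case
    proof (cases "fst y \<in> S")
      case True
      then show ?thesis using path_step by (meson path.path_step)
    next
      case False
      then have y: "y = (s, snd y)" using path_step.hyps(2) by (metis insertE prod.collapse)
      have z: "path st S (s, snd y) z" using path_step.hyps(3) y by (metis path.path_base)
      from path_step.IH show ?thesis
      proof
        assume "path st S x y"
        then show ?thesis using y z by (metis rtrancl.rtrancl_refl)
      next
        assume "\<exists>i i'. path st S x (s, i) \<and> (i, i') \<in> {(k, j). path st S (s, k) (s, j)}\<^sup>* \<and>
          path st S (s, i') y"
        then obtain i i' where i: "path st S x (s, i)" "(i, i') \<in> {(k, j). path st S (s, k) (s, j)}\<^sup>*"
          "path st S (s, i') (s, snd y)" using y by metis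
        then have "(i, snd y) \<in> {(k, j). path st S (s, k) (s, j)}\<^sup>*"
          by (auto intro: rtrancl.rtrancl_into_rtrancl)
        then show ?thesis using i z by blast
      qed
    qed
  qed
next
  have mono: "path st S x y \<Longrightarrow> path st (insert s S) x y" for x y by (rule path_mono) auto
  assume "?R x y"
  then show ?L
  proof
    assume "\<exists>i i'. path st S x (s, i) \<and> (i, i') \<in> {(k, j). path st S (s, k) (s, j)}\<^sup>* \<and>
      path st S (s, i') y"
    then obtain i i' where i: "path st S x (s, i)" "path st S (s, i') y"
      "(i, i') \<in> {(k, j). path st S (s, k) (s, j)}\<^sup>*" by blast
    from i(3) have "path st (insert s S) x (s, i')"
    proof (induction rule: rtrancl_induct)
      case base
      then show ?case using i(1) mono by blast
    next
      case (step j l)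
      then show ?case using path_trans[of st "insert s S" "(s, j)" "(s, l)" x] mono by auto
    qed
    then show ?L using path_trans[of st "insert s S" "(s, i')" y x] mono i(2) by auto
  qed (rule mono)
qed

lemma Suc_less_enatD: "enat (Suc k) < m \<Longrightarrow> enat k < m"
  by (rule enat_less_mono) auto

text \<open>The least fixpoint in \<open>path_fm\<close> is the star of Kleene's construction, with
  \<open>R\<close> one return to the eliminated state and \<open>A\<close> the positions from which
  the path can be completed.\<close>

lemma lfp_reach: "lfp (\<lambda>Y. A \<union> {k. \<exists>j. (k, j) \<in> R \<and> j \<in> Y}) = {k. \<exists>j. (k, j) \<in> R\<^sup>* \<and> j \<in> A}"
  (is "lfp ?f = ?X")
proof
  have "?f ?X \<subseteq> ?X" by (auto intro: converse_rtrancl_into_rtrancl)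
  then show "lfp ?f \<subseteq> ?X" by (rule lfp_lowerbound)
  have m: "mono ?f" by (auto intro!: monoI)
  show "?X \<subseteq> lfp ?f"
  proof
    fix k assume "k \<in> ?X"
    then obtain j where "(k, j) \<in> R\<^sup>*" "j \<in> A" by blast
    then show "k \<in> lfp ?f"
    proof (induction rule: converse_rtrancl_induct)
      case base
      then show ?case using lfp_unfold[OF m] by blast
    next
      case (step y z)
      then show ?case using lfp_unfold[OF m] by blast
    qed
  qed
qed

text \<open>
  Kleene's construction: \<open>path_fm E ss p q \<phi>\<close> says that some nonempty path from state \<open>p\<close> at the
  current position to state \<open>q\<close> at a position satisfying \<open>\<phi>\<close> has all its intermediate states in
  \<open>ss\<close>.  Every level binds its own odd variable; even variables are reserved for letters.
\<close>

fun path_fm ::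
  "('s \<Rightarrow> 's \<Rightarrow> 'a fm \<Rightarrow> 'a fm) \<Rightarrow> 's list \<Rightarrow> 's \<Rightarrow> 's \<Rightarrow> 'a fm \<Rightarrow> 'a fm" where
  "path_fm E [] p q \<phi> = E p q \<phi>"
| "path_fm E (s # ss) p q \<phi> = Or (path_fm E ss p q \<phi>)
     (path_fm E ss p s (Mu (2 * length ss + 1)
        (Or (path_fm E ss s q \<phi>) (path_fm E ss s s (Var (2 * length ss + 1))))))"

lemma pure_path_fm:
  assumes "\<And>p q \<phi> L. L\<^sub>0 \<subseteq> L \<Longrightarrow> pure_fm cl L \<phi> \<Longrightarrow> pure_fm cl L (E p q \<phi>)"
  shows "L\<^sub>0 \<subseteq> L \<Longrightarrow> pure_fm cl L \<phi> \<Longrightarrow> pure_fm cl L (path_fm E ss p q \<phi>)"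
proof (induction ss arbitrary: p q \<phi> L)
  case Nil
  then show ?case using assms by simp
next
  case (Cons s ss)
  have "pure_fm cl (insert x L) \<phi>" for x using Cons.prems(2) by (auto simp: pure_fm_def)
  then show ?case using Cons by (auto intro!: Cons.IH)
qed

section \<open>Formulas for the past and the future of a run\<close>

definition rpath_fm ::
  "('s \<Rightarrow> 's \<Rightarrow> 'a fm \<Rightarrow> 'a fm) \<Rightarrow> 's list \<Rightarrow> 's \<Rightarrow> 's \<Rightarrow> 'a fm \<Rightarrow> 'a fm" where
  "rpath_fm E ss p q \<phi> = (if p = q then Or \<phi> (path_fm E ss p q \<phi>) else path_fm E ss p q \<phi>)"

definition literal :: "'a atom \<Rightarrow> bool \<Rightarrow> 'a fm" where
  "literal A b = (if b then Pos A else Neg A)"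

definition letter_fm :: "('a \<Rightarrow> nat) \<Rightarrow> 'a \<times> marking \<Rightarrow> 'a fm" where
  "letter_fm g x = And (Var (2 * g (fst x)))
     (And (literal AtP (fst (snd x))) (literal AtS (snd (snd x))))"

definition edges :: "('i, 'o) transducer \<Rightarrow> (nat \<times> 'i \<times> nat) set" where
  "edges T = {(p, x, q). \<exists>b. (p, x, b, q) \<in> delta T}"

definition next_fm ::
  "('a \<Rightarrow> nat) \<Rightarrow> bool \<Rightarrow> 'a letter_transducer \<Rightarrow> nat \<Rightarrow> nat \<Rightarrow> 'a fm \<Rightarrow> 'a fm" where
  "next_fm g cl T p q \<phi> =
     big_or (\<lambda>x. And (letter_fm g x) (Modal (next_mod cl) \<phi>)) {x. (p, x, q) \<in> edges T}"

text \<open>A transition reads the letter at its earlier position. Going backwards, the move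
  therefore comes before the letter test, the opposite order to \<open>next_fm\<close>.\<close>

definition prev_fm ::
  "('a \<Rightarrow> nat) \<Rightarrow> bool \<Rightarrow> 'a letter_transducer \<Rightarrow> nat \<Rightarrow> nat \<Rightarrow> 'a fm \<Rightarrow> 'a fm" where
  "prev_fm g cl T p q \<phi> =
     Modal (prev_mod cl) (big_or (\<lambda>x. And (letter_fm g x) \<phi>) {x. (q, x, p) \<in> edges T})"

definition state_list :: "('i, 'o) transducer \<Rightarrow> nat list" where
  "state_list T = sorted_list_of_set (states T)"

definition before_fm :: "('a \<Rightarrow> nat) \<Rightarrow> bool \<Rightarrow> 'a letter_transducer \<Rightarrow> nat \<Rightarrow> 'a fm" where
  "before_fm g cl T p =
     big_or (\<lambda>p'. rpath_fm (prev_fm g cl T) (state_list T) p p' (Pos (first_atom cl))) (initial T)"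

text \<open>A run has one state more than the word has positions, and its final state lies beyond
  the last position. The last transition is therefore tested at the last position.\<close>

definition end_fm :: "('a \<Rightarrow> nat) \<Rightarrow> bool \<Rightarrow> 'a letter_transducer \<Rightarrow> nat \<Rightarrow> 'a fm" where
  "end_fm g cl T p = And (Pos (last_atom cl))
     (big_or (letter_fm g) {x. \<exists>q \<in> final T. (p, x, q) \<in> edges T})"

text \<open>The state \<open>q\<close> belongs to the position after the current one. If there is no
  such position, \<open>q\<close> itself has to be final; the set
  \<open>{q} \<inter> final T\<close> expresses this case distinction as an empty or singleton
  disjunction.\<close>

definition after_fin_fm :: "('a \<Rightarrow> nat) \<Rightarrow> bool \<Rightarrow> 'a letter_transducer \<Rightarrow> nat \<Rightarrow> 'a fm" where
  "after_fin_fm g cl T q = Or (big_or (\<lambda>_. Pos (last_atom cl)) ({q} \<inter> final T))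
     (Modal (next_mod cl)
       (big_or (\<lambda>p. rpath_fm (next_fm g cl T) (state_list T) q p (end_fm g cl T p)) (states T)))"

text \<open>A greatest fixpoint of returns from \<open>f\<close> to \<open>f\<close>, that is,
  infinitely many visits. The bound variable is the first odd one that \<open>path_fm\<close> does
  not bind on the list of states.\<close>

definition recur_fm :: "('a \<Rightarrow> nat) \<Rightarrow> bool \<Rightarrow> 'a letter_transducer \<Rightarrow> nat \<Rightarrow> 'a fm" where
  "recur_fm g cl T f = (let x = 2 * length (state_list T) + 1 in
     Nu x (path_fm (next_fm g cl T) (state_list T) f f (Var x)))"

text \<open>There are finitely many final states, so a Buechi run visits a single one of them
  infinitely often; the disjunction guesses it.\<close>

definition after_inf_fm :: "('a \<Rightarrow> nat) \<Rightarrow> bool \<Rightarrow> 'a letter_transducer \<Rightarrow> nat \<Rightarrow> 'a fm" where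
  "after_inf_fm g cl T q = Modal (next_mod cl)
     (big_or (\<lambda>f. rpath_fm (next_fm g cl T) (state_list T) q f (recur_fm g cl T f)) (final T))"

definition output_fm ::
  "(nat \<Rightarrow> 'a fm) \<Rightarrow> ('a \<Rightarrow> nat) \<Rightarrow> bool \<Rightarrow> 'a letter_transducer \<Rightarrow> 'a \<Rightarrow> 'a fm" where
  "output_fm after g cl T b =
     big_or (\<lambda>(p, x, q). And (letter_fm g x) (And (before_fm g cl T p) (after q)))
       {(p, x, q). (p, x, b, q) \<in> delta T}"

lemma finite_delta:
  assumes "is_transducer A B T"
  shows "finite (delta T)" "finite (edges T)"
proof -
  have "finite (states T \<times> A \<times> B \<times> states T)" using assms by (simp add: is_transducer_def)
  then show "finite (delta T)" using assms by (auto simp: is_transducer_def intro: finite_subset)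
  moreover have "edges T \<subseteq> (\<lambda>(p, x, b, q). (p, x, q)) ` delta T"
    by (force simp: edges_def)
  ultimately show "finite (edges T)" by (meson finite_imageI finite_subset)
qed

lemma finite_edge_labels:
  assumes "is_transducer A B T"
  shows "finite {x. (p, x, q) \<in> edges T}"
proof -
  have "{x. (p, x, q) \<in> edges T} \<subseteq> (\<lambda>(p, x, q). x) ` edges T" by force
  then show ?thesis using finite_delta(2)[OF assms] by (meson finite_imageI finite_subset)
qed

section \<open>Paths as runs on intervals\<close>

definition run_on :: "('i, 'o) transducer \<Rightarrow> (nat \<Rightarrow> 'i) \<Rightarrow> (nat \<Rightarrow> nat) \<Rightarrow> nat \<Rightarrow> nat \<Rightarrow> bool" where
  "run_on T u r i j \<longleftrightarrow> (\<forall>l. i \<le> l \<and> l < j \<longrightarrow> (r l, u l, r (Suc l)) \<in> edges T)"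

definition next_step ::
  "enat \<Rightarrow> ('i, 'o) transducer \<Rightarrow> (nat \<Rightarrow> 'i) \<Rightarrow> nat \<times> nat \<Rightarrow> nat \<times> nat \<Rightarrow> bool" where
  "next_step m T u x y \<longleftrightarrow> (fst x, u (snd x), fst y) \<in> edges T \<and> snd y = Suc (snd x) \<and> enat (snd y) < m"

definition prev_step ::
  "enat \<Rightarrow> ('i, 'o) transducer \<Rightarrow> (nat \<Rightarrow> 'i) \<Rightarrow> nat \<times> nat \<Rightarrow> nat \<times> nat \<Rightarrow> bool" where
  "prev_step m T u x y \<longleftrightarrow> (fst y, u (snd y), fst x) \<in> edges T \<and> snd x = Suc (snd y) \<and> enat (snd x) < m"

text \<open>Every step advances the position by one, so a path visits each position of an interval
  once and is a run on it. Its states lie in \<open>states T\<close> as endpoints of edges.\<close>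

lemma path_next_iff:
  assumes T: "is_transducer A B T"
  shows "path (next_step m T u) (states T) (p, k) (q, j) \<longleftrightarrow>
    k < j \<and> enat j < m \<and> (\<exists>r. r k = p \<and> r j = q \<and> run_on T u r k j)"
proof
  have "path (next_step m T u) (states T) x y \<Longrightarrow> snd x < snd y \<and> enat (snd y) < m \<and>
    (\<exists>r. r (snd x) = fst x \<and> r (snd y) = fst y \<and> run_on T u r (snd x) (snd y))" for x y
  proof (induction rule: path.induct)
    case (path_base x y)
    then show ?case
      by (auto simp: next_step_def run_on_def intro!: exI[of _ "\<lambda>i. if i \<le> snd x then fst x else fst y"])
        (metis le_antisym less_Suc_eq_le)
  next
    case (path_step x y z)
    then obtain r where "r (snd x) = fst x" "r (snd y) = fst y" "run_on T u r (snd x) (snd y)"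
      "snd x < snd y" by blast
    then show ?case using path_step.hyps(3)
      by (auto simp: next_step_def run_on_def less_Suc_eq intro!: exI[of _ "r(snd z := fst z)"])
  qed
  from this[of "(p, k)" "(q, j)"]
  show "path (next_step m T u) (states T) (p, k) (q, j) \<Longrightarrow>
    k < j \<and> enat j < m \<and> (\<exists>r. r k = p \<and> r j = q \<and> run_on T u r k j)" by simp
next
  assume "k < j \<and> enat j < m \<and> (\<exists>r. r k = p \<and> r j = q \<and> run_on T u r k j)"
  then obtain r where kj: "Suc k \<le> j" "enat j < m" "r k = p" "r j = q" "run_on T u r k j" by auto
  from kj(1,2,5) have "path (next_step m T u) (states T) (r k, k) (r j, j)"
  proof (induction j rule: dec_induct)
    case base
    then show ?case by (intro path.path_base) (simp add: next_step_def run_on_def)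
  next
    case (step j)
    have e: "(r j, u j, r (Suc j)) \<in> edges T" using step.prems(2) step.hyps by (simp add: run_on_def)
    have "path (next_step m T u) (states T) (r k, k) (r j, j)"
      using step.prems Suc_less_enatD by (intro step.IH) (auto simp: run_on_def)
    then show ?case
    proof (rule path.path_step)
      show "fst (r j, j) \<in> states T" using e T by (auto simp: edges_def is_transducer_def)
      show "next_step m T u (r j, j) (r (Suc j), Suc j)" using e step.prems(1) by (simp add: next_step_def)
    qed
  qed
  then show "path (next_step m T u) (states T) (p, k) (q, j)" using kj by simp
qed

lemma path_prev_iff:
  assumes T: "is_transducer A B T"
  shows "path (prev_step m T u) (states T) (p, k) (q, j) \<longleftrightarrow>
    j < k \<and> enat k < m \<and> (\<exists>r. r k = p \<and> r j = q \<and> run_on T u r j k)"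
proof
  have "path (prev_step m T u) (states T) x y \<Longrightarrow> snd y < snd x \<and> enat (snd x) < m \<and>
    (\<exists>r. r (snd x) = fst x \<and> r (snd y) = fst y \<and> run_on T u r (snd y) (snd x))" for x y
  proof (induction rule: path.induct)
    case (path_base x y)
    then show ?case
      by (auto simp: prev_step_def run_on_def intro!: exI[of _ "\<lambda>i. if i \<le> snd y then fst y else fst x"])
        (metis le_antisym less_Suc_eq_le)
  next
    case (path_step x y z)
    then obtain r where r: "r (snd x) = fst x" "r (snd y) = fst y" "run_on T u r (snd y) (snd x)"
      "snd y < snd x" by blast
    have "run_on T u (r(snd z := fst z)) (snd z) (snd x)"
      using path_step.hyps(3) r unfolding run_on_def prev_step_def
      by (auto simp: Suc_le_eq dest!: le_neq_implies_less)
    then show ?case using path_step r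
      by (auto simp: prev_step_def intro!: exI[of _ "r(snd z := fst z)"])
  qed
  from this[of "(p, k)" "(q, j)"]
  show "path (prev_step m T u) (states T) (p, k) (q, j) \<Longrightarrow>
    j < k \<and> enat k < m \<and> (\<exists>r. r k = p \<and> r j = q \<and> run_on T u r j k)" by simp
next
  assume "j < k \<and> enat k < m \<and> (\<exists>r. r k = p \<and> r j = q \<and> run_on T u r j k)"
  then obtain r where kj: "j < k" "enat k < m" "r k = p" "r j = q" "run_on T u r j k" by auto
  from kj(1) have "path (prev_step m T u) (states T) (r k, k) (r j, j)" using kj(5)
  proof (induction j rule: strict_inc_induct)
    case (base j)
    then show ?case using kj(2)
      by (intro path.path_base) (simp add: prev_step_def run_on_def)
  next
    case (step j)
    have e: "(r j, u j, r (Suc j)) \<in> edges T" using step.prems step.hyps by (simp add: run_on_def)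
    have "path (prev_step m T u) (states T) (r k, k) (r (Suc j), Suc j)"
      using step.prems by (intro step.IH) (auto simp: run_on_def)
    then show ?case
    proof (rule path.path_step)
      show "fst (r (Suc j), Suc j) \<in> states T" using e T by (auto simp: edges_def is_transducer_def)
      show "prev_step m T u (r (Suc j), Suc j) (r j, j)"
        using e kj(2) step.hyps enat_less_mono[of k m "Suc j"] by (simp add: prev_step_def)
    qed
  qed
  then show "path (prev_step m T u) (states T) (p, k) (q, j)" using kj by simp
qed

section \<open>Correctness of the formulas on a plain word\<close>

locale letter_word =
  fixes m :: enat and \<alpha> :: "'a atom \<Rightarrow> nat set" and u :: "nat \<Rightarrow> 'a \<times> marking"
    and \<Gamma> :: "'a set" and g :: "'a \<Rightarrow> nat" and cl :: bool
  assumes g: "inj_on g \<Gamma>"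
    and u: "enat k < m \<Longrightarrow> fst (u k) \<in> \<Gamma>"
    and \<alpha>_P: "enat k < m \<Longrightarrow> k \<in> \<alpha> AtP \<longleftrightarrow> fst (snd (u k))"
    and \<alpha>_S: "enat k < m \<Longrightarrow> k \<in> \<alpha> AtS \<longleftrightarrow> snd (snd (u k))"
    and \<alpha>_first: "enat k < m \<Longrightarrow> k \<in> \<alpha> (first_atom cl) \<longleftrightarrow> k = 0"
    and \<alpha>_last: "enat k < m \<Longrightarrow> k \<in> \<alpha> (last_atom cl) \<longleftrightarrow> \<not> enat (Suc k) < m"
begin

text \<open>Variable \<open>2 * g c\<close> marks the positions that carry \<open>c\<close>. By
  \<open>good_upd_odd\<close> this survives the binding of any odd variable.\<close>

definition good :: "(nat \<Rightarrow> nat set) \<Rightarrow> bool" where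
  "good V \<longleftrightarrow> (\<forall>c \<in> \<Gamma>. \<forall>k. enat k < m \<longrightarrow> (k \<in> V (2 * g c) \<longleftrightarrow> fst (u k) = c))"

lemma good_upd_odd: "good V \<Longrightarrow> good (V(2 * l + 1 := X))"
  unfolding good_def by (auto, presburger+)

abbreviation ws where "ws \<equiv> wsem m \<alpha>"

lemma letter_fm_sem:
  assumes "good V" "fst x \<in> \<Gamma>"
  shows "k \<in> ws (letter_fm g x) V \<longleftrightarrow> enat k < m \<and> u k = x"
  using assms by (cases x; cases "u k") (auto simp: letter_fm_def literal_def good_def \<alpha>_P \<alpha>_S)

text \<open>The set \<open>L\<close> bounds the free variables of \<open>\<phi>\<close> and contains
  none of the variables that the levels of \<open>ss\<close> bind, which rules out capture. It is
  kept general because the inner calls happen below the binder of the current level and add its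
  variable to \<open>L\<close>.\<close>

lemma path_fm_sem:
  assumes st: "\<And>x y. st x y \<Longrightarrow> enat (snd y) < m"
    and E: "\<And>p q \<phi> V k. good V \<Longrightarrow> k \<in> ws (E p q \<phi>) V \<longleftrightarrow> (\<exists>j. st (p, k) (q, j) \<and> j \<in> ws \<phi> V)"
    and pure: "\<And>p q \<phi> L. {x. even x} \<subseteq> L \<Longrightarrow> pure_fm cl L \<phi> \<Longrightarrow> pure_fm cl L (E p q \<phi>)"
  shows "good V \<Longrightarrow> pure_fm cl L \<phi> \<Longrightarrow> (\<And>l. l < length ss \<Longrightarrow> 2 * l + 1 \<notin> L) \<Longrightarrow> {x. even x} \<subseteq> L \<Longrightarrow>
    k \<in> ws (path_fm E ss p q \<phi>) V \<longleftrightarrow> (\<exists>j. path st (set ss) (p, k) (q, j) \<and> j \<in> ws \<phi> V)"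
proof (induction ss arbitrary: p q \<phi> V k L)
  case Nil
  have "path st {} x y \<longleftrightarrow> st x y" for x y
    by (auto intro: path.intros elim: path.cases)
  then show ?case using E Nil.prems(1) by simp
next
  case (Cons s ss)
  let ?x = "2 * length ss + 1"
  let ?\<phi> = "Or (path_fm E ss s q \<phi>) (path_fm E ss s s (Var ?x))"
  let ?P = "path st (set ss)"
  let ?R = "{(k, j). ?P (s, k) (s, j)}"
  have path_less: "enat (snd y) < m" if "?P x y" for x y
    using that by cases (auto dest: st)
  have L': "l < length ss \<Longrightarrow> 2 * l + 1 \<notin> insert ?x L" for l using Cons.prems(3) by simp
  have p\<phi>: "pure_fm cl (insert ?x L) \<phi>" using Cons.prems(2) by (auto simp: pure_fm_def)
  have "pure_fm cl (insert ?x L) (path_fm E ss p' q' \<chi>)" if "pure_fm cl (insert ?x L) \<chi>" for p' q' \<chi>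
    by (rule pure_path_fm[where L\<^sub>0 = "{x. even x}"]) (use pure that Cons.prems(4) in auto)
  then have pM: "pure_fm cl L (Mu ?x ?\<phi>)" using p\<phi> by simp
  have xL: "?x \<notin> fv \<phi>" using Cons.prems(2,3) by (auto simp: pure_fm_def)
  have "ws ?\<phi> (V(?x := Y)) = {k. \<exists>j. ?P (s, k) (q, j) \<and> j \<in> ws \<phi> V} \<union> {k. \<exists>j. (k, j) \<in> ?R \<and> j \<in> Y}" for Y
  proof -
    have gV: "good (V(?x := Y))" using Cons.prems(1) by (rule good_upd_odd)
    have "ws \<phi> (V(?x := Y)) = ws \<phi> V" by (rule wsem_cong_fv) (use xL in auto)
    note eq = this
    have ev: "{x. even x} \<subseteq> insert ?x L" using Cons.prems(4) by blast
    have "k \<in> ws (path_fm E ss s q \<phi>) (V(?x := Y)) \<longleftrightarrow> (\<exists>j. ?P (s, k) (q, j) \<and> j \<in> ws \<phi> V)" for k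
      using Cons.IH[OF gV p\<phi> L' ev, of k s q] by (simp only: eq)
    moreover have "pure_fm cl (insert ?x L) (Var ?x)" by simp
    note Cons.IH[OF gV this L' ev]
    then have "k \<in> ws (path_fm E ss s s (Var ?x)) (V(?x := Y)) \<longleftrightarrow>
        (\<exists>j. (k, j) \<in> ?R \<and> j \<in> Y)" for k
      using path_less by (simp del: fun_upd_apply add: fun_upd_same) fastforce
    ultimately show ?thesis unfolding wsem.simps by blast
  qed
  then have "ws (Mu ?x ?\<phi>) V = lfp (\<lambda>Y. {k. \<exists>j. ?P (s, k) (q, j) \<and> j \<in> ws \<phi> V} \<union>
      {k. \<exists>j. (k, j) \<in> ?R \<and> j \<in> Y})"
    by (simp only: wsem.simps(7))
  also have "\<dots> = {k. \<exists>i. (k, i) \<in> ?R\<^sup>* \<and> (\<exists>j. ?P (s, i) (q, j) \<and> j \<in> ws \<phi> V)}"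
    by (rule trans[OF lfp_reach]) simp
  finally have mu: "ws (Mu ?x ?\<phi>) V = \<dots>" .
  have IH1: "k \<in> ws (path_fm E ss p q \<phi>) V \<longleftrightarrow> (\<exists>j. ?P (p, k) (q, j) \<and> j \<in> ws \<phi> V)"
    by (rule Cons.IH[OF Cons.prems(1,2)]) (use Cons.prems in auto)
  have IH2: "k \<in> ws (path_fm E ss p s (Mu ?x ?\<phi>)) V \<longleftrightarrow>
      (\<exists>j. ?P (p, k) (s, j) \<and> j \<in> ws (Mu ?x ?\<phi>) V)"
    by (rule Cons.IH[OF Cons.prems(1) pM]) (use Cons.prems in auto)
  have "k \<in> ws (path_fm E (s # ss) p q \<phi>) V \<longleftrightarrow>
    (\<exists>j. ?P (p, k) (q, j) \<and> j \<in> ws \<phi> V) \<or>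
    (\<exists>i. ?P (p, k) (s, i) \<and> (\<exists>i'. (i, i') \<in> ?R\<^sup>* \<and> (\<exists>j. ?P (s, i') (q, j) \<and> j \<in> ws \<phi> V)))"
    using IH1 IH2 unfolding mu by (simp only: path_fm.simps wsem.simps Un_iff mem_Collect_eq)
  also have "\<dots> \<longleftrightarrow> (\<exists>j. path st (set (s # ss)) (p, k) (q, j) \<and> j \<in> ws \<phi> V)"
    unfolding list.set path_insert by blast
  finally show ?case .
qed

end

text \<open>The variables that are still free for use outside of \<open>path_fm\<close> on the states of \<open>T\<close>.\<close>

definition outer_vars :: "('i, 'o) transducer \<Rightarrow> nat set" where
  "outer_vars T = {x. even x \<or> 2 * length (state_list T) + 1 \<le> x}"

locale letter_transducer =
  fixes \<Gamma> :: "'a set" and g :: "'a \<Rightarrow> nat" and cl :: bool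
    and T :: "'a letter_transducer" and B :: "'a set"
  assumes T: "is_transducer (\<Gamma> \<times> UNIV) B T"
begin

lemma edge_label: "(p, x, q) \<in> edges T \<Longrightarrow> fst x \<in> \<Gamma>"
  using T by (auto simp: edges_def is_transducer_def)

lemma edge_states: "(p, x, q) \<in> edges T \<Longrightarrow> p \<in> states T \<and> q \<in> states T"
  using T by (auto simp: edges_def is_transducer_def)

lemma finite_states: "finite (states T)" "finite (initial T)" "finite (final T)"
  using T by (auto simp: is_transducer_def intro: finite_subset)

lemma set_state_list: "set (state_list T) = states T"
  by (simp add: state_list_def finite_states)

lemma pure_letter_fm: "(\<lambda>c. 2 * g c) ` \<Gamma> \<subseteq> L \<Longrightarrow> fst x \<in> \<Gamma> \<Longrightarrow> pure_fm cl L (letter_fm g x)"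
  by (auto simp: letter_fm_def literal_def)

lemma pure_next_fm:
  "(\<lambda>c. 2 * g c) ` \<Gamma> \<subseteq> L \<Longrightarrow> pure_fm cl L \<phi> \<Longrightarrow> pure_fm cl L (next_fm g cl T p q \<phi>)"
  unfolding next_fm_def
  by (rule pure_fm_big_or[OF finite_edge_labels[OF T]]) (auto intro: pure_letter_fm dest: edge_label)

lemma pure_prev_fm:
  "(\<lambda>c. 2 * g c) ` \<Gamma> \<subseteq> L \<Longrightarrow> pure_fm cl L \<phi> \<Longrightarrow> pure_fm cl L (prev_fm g cl T p q \<phi>)"
  unfolding prev_fm_def
  by (auto intro!: pure_fm_big_or[OF finite_edge_labels[OF T]] pure_letter_fm dest: edge_label)

lemma pure_path_next:
  "(\<lambda>c. 2 * g c) ` \<Gamma> \<subseteq> L \<Longrightarrow> pure_fm cl L \<phi> \<Longrightarrow>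
   pure_fm cl L (path_fm (next_fm g cl T) ss p q \<phi>)"
  by (rule pure_path_fm[where L\<^sub>0 = "(\<lambda>c. 2 * g c) ` \<Gamma>"]) (auto intro: pure_next_fm)

lemma pure_path_prev:
  "(\<lambda>c. 2 * g c) ` \<Gamma> \<subseteq> L \<Longrightarrow> pure_fm cl L \<phi> \<Longrightarrow>
   pure_fm cl L (path_fm (prev_fm g cl T) ss p q \<phi>)"
  by (rule pure_path_fm[where L\<^sub>0 = "(\<lambda>c. 2 * g c) ` \<Gamma>"]) (auto intro: pure_prev_fm)

lemma pure_before_fm: "(\<lambda>c. 2 * g c) ` \<Gamma> \<subseteq> L \<Longrightarrow> pure_fm cl L (before_fm g cl T p)"
  unfolding before_fm_def rpath_fm_def
  by (rule pure_fm_big_or) (auto simp: finite_states intro!: pure_path_prev)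

lemma finite_end_labels: "finite {x. \<exists>q \<in> final T. (p, x, q) \<in> edges T}"
proof -
  have "{x. \<exists>q \<in> final T. (p, x, q) \<in> edges T} = (\<Union>q \<in> final T. {x. (p, x, q) \<in> edges T})" by auto
  then show ?thesis using finite_states(3) finite_edge_labels[OF T] by simp
qed

lemma pure_end_fm: "(\<lambda>c. 2 * g c) ` \<Gamma> \<subseteq> L \<Longrightarrow> pure_fm cl L (end_fm g cl T p)"
  unfolding end_fm_def
  by (auto intro!: pure_fm_big_or[OF finite_end_labels] pure_letter_fm dest: edge_label)

lemma pure_after_fin_fm: "(\<lambda>c. 2 * g c) ` \<Gamma> \<subseteq> L \<Longrightarrow> pure_fm cl L (after_fin_fm g cl T q)"
  unfolding after_fin_fm_def rpath_fm_def
  by (auto simp: finite_states intro!: pure_fm_big_or pure_path_next pure_end_fm)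

lemma letters_even: "(\<lambda>c. 2 * g c) ` \<Gamma> \<subseteq> outer_vars T"
  by (auto simp: outer_vars_def)

lemma pure_recur_fm: "(\<lambda>c. 2 * g c) ` \<Gamma> \<subseteq> L \<Longrightarrow> pure_fm cl L (recur_fm g cl T f)"
  unfolding recur_fm_def Let_def by (auto intro!: pure_path_next)

lemma pure_after_inf_fm: "(\<lambda>c. 2 * g c) ` \<Gamma> \<subseteq> L \<Longrightarrow> pure_fm cl L (after_inf_fm g cl T q)"
  unfolding after_inf_fm_def rpath_fm_def
  by (auto simp: finite_states intro!: pure_fm_big_or pure_path_next pure_recur_fm)

lemma finite_output_edges: "finite {(p, x, q). (p, x, b, q) \<in> delta T}"
proof -
  have "{(p, x, q). (p, x, b, q) \<in> delta T} \<subseteq> edges T" by (auto simp: edges_def)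
  then show ?thesis using finite_delta(2)[OF T] by (rule finite_subset)
qed

lemma output_label: "(p, x, b, q) \<in> delta T \<Longrightarrow> fst x \<in> \<Gamma>"
  using T by (auto simp: is_transducer_def)

lemma pure_output_fm:
  "(\<lambda>c. 2 * g c) ` \<Gamma> \<subseteq> L \<Longrightarrow> (\<And>q. pure_fm cl L (after q)) \<Longrightarrow> pure_fm cl L (output_fm after g cl T b)"
  unfolding output_fm_def
  by (rule pure_fm_big_or[OF finite_output_edges])
    (auto intro!: pure_letter_fm pure_before_fm dest: output_label)

end

locale letter_word_transducer = letter_word m \<alpha> u \<Gamma> g cl + letter_transducer \<Gamma> g cl T B
  for m :: enat and \<alpha> :: "'a atom \<Rightarrow> nat set" and u :: "nat \<Rightarrow> 'a \<times> marking"
    and \<Gamma> :: "'a set" and g :: "'a \<Rightarrow> nat" and cl :: bool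
    and T :: "'a letter_transducer" and B :: "'a set" +
  fixes V :: "nat \<Rightarrow> nat set"
  assumes V: "good V"
begin

lemma next_fm_sem:
  assumes "good W"
  shows "k \<in> ws (next_fm g cl T p q \<phi>) W \<longleftrightarrow> (\<exists>j. next_step m T u (p, k) (q, j) \<and> j \<in> ws \<phi> W)"
  unfolding next_fm_def wsem_big_or[OF finite_edge_labels[OF T]]
  using letter_fm_sem[OF assms edge_label] wsem_less[of "Suc k" m \<alpha> \<phi> W] Suc_less_enatD[of k m]
  by (simp add: next_step_def) blast

lemma prev_fm_sem:
  assumes "good W"
  shows "k \<in> ws (prev_fm g cl T p q \<phi>) W \<longleftrightarrow> (\<exists>j. prev_step m T u (p, k) (q, j) \<and> j \<in> ws \<phi> W)"
  unfolding prev_fm_def wsem.simps wsem_big_or[OF finite_edge_labels[OF T]]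
  using letter_fm_sem[OF assms edge_label]
  by (cases k) (auto simp: prev_step_def dest: wsem_less)

lemma path_next_sem:
  assumes "good W" "pure_fm cl (outer_vars T) \<phi>"
  shows "k \<in> ws (path_fm (next_fm g cl T) (state_list T) p q \<phi>) W \<longleftrightarrow>
    (\<exists>j > k. j \<in> ws \<phi> W \<and> (\<exists>r. r k = p \<and> r j = q \<and> run_on T u r k j))"
proof -
  have "k \<in> ws (path_fm (next_fm g cl T) (state_list T) p q \<phi>) W \<longleftrightarrow>
    (\<exists>j. path (next_step m T u) (set (state_list T)) (p, k) (q, j) \<and> j \<in> ws \<phi> W)"
  proof (rule path_fm_sem[where st = "next_step m T u" and E = "next_fm g cl T" and L = "outer_vars T"])
    show "k \<in> ws (next_fm g cl T p q \<phi>) V \<longleftrightarrow> (\<exists>j. next_step m T u (p, k) (q, j) \<and> j \<in> ws \<phi> V)"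
      if "good V" for p q \<phi> V k by (rule next_fm_sem[OF that])
    show "pure_fm cl L (next_fm g cl T p q \<phi>)" if "{x. even x} \<subseteq> L" "pure_fm cl L \<phi>" for p q \<phi> L
      by (rule pure_next_fm[OF _ that(2)]) (rule order_trans[OF _ that(1)], auto)
    show "enat (snd y) < m" if "next_step m T u x y" for x y
      using that unfolding next_step_def by blast
    show "2 * l + 1 \<notin> outer_vars T" if "l < length (state_list T)" for l
      using that by (simp add: outer_vars_def)
    show "{x. even x} \<subseteq> outer_vars T" by (auto simp: outer_vars_def)
  qed (fact assms)+
  then show ?thesis unfolding set_state_list path_next_iff[OF T] using wsem_less by blast
qed

lemma path_prev_sem:
  assumes "good W" "pure_fm cl (outer_vars T) \<phi>"
  shows "k \<in> ws (path_fm (prev_fm g cl T) (state_list T) p q \<phi>) W \<longleftrightarrow>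
    enat k < m \<and> (\<exists>j < k. j \<in> ws \<phi> W \<and> (\<exists>r. r k = p \<and> r j = q \<and> run_on T u r j k))"
proof -
  have "k \<in> ws (path_fm (prev_fm g cl T) (state_list T) p q \<phi>) W \<longleftrightarrow>
    (\<exists>j. path (prev_step m T u) (set (state_list T)) (p, k) (q, j) \<and> j \<in> ws \<phi> W)"
  proof (rule path_fm_sem[where st = "prev_step m T u" and E = "prev_fm g cl T" and L = "outer_vars T"])
    show "k \<in> ws (prev_fm g cl T p q \<phi>) V \<longleftrightarrow> (\<exists>j. prev_step m T u (p, k) (q, j) \<and> j \<in> ws \<phi> V)"
      if "good V" for p q \<phi> V k by (rule prev_fm_sem[OF that])
    show "pure_fm cl L (prev_fm g cl T p q \<phi>)" if "{x. even x} \<subseteq> L" "pure_fm cl L \<phi>" for p q \<phi> L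
      by (rule pure_prev_fm[OF _ that(2)]) (rule order_trans[OF _ that(1)], auto)
    show "enat (snd y) < m" if "prev_step m T u x y" for x y
      using that unfolding prev_step_def by (metis Suc_less_enatD)
    show "2 * l + 1 \<notin> outer_vars T" if "l < length (state_list T)" for l
      using that by (simp add: outer_vars_def)
    show "{x. even x} \<subseteq> outer_vars T" by (auto simp: outer_vars_def)
  qed (fact assms)+
  then show ?thesis unfolding set_state_list path_prev_iff[OF T] by blast
qed

lemma run_on_refl [simp]: "run_on T u r k k"
  by (auto simp: run_on_def)

lemma rpath_next_sem:
  assumes "good W" "pure_fm cl (outer_vars T) \<phi>"
  shows "k \<in> ws (rpath_fm (next_fm g cl T) (state_list T) p q \<phi>) W \<longleftrightarrow>
    (\<exists>j \<ge> k. j \<in> ws \<phi> W \<and> (\<exists>r. r k = p \<and> r j = q \<and> run_on T u r k j))"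
proof -
  let ?B = "\<lambda>j. \<exists>r. r k = p \<and> r j = q \<and> run_on T u r k j"
  have "?B k \<longleftrightarrow> p = q" by (auto intro: exI[of _ "\<lambda>_. q"])
  moreover have "(\<exists>j \<ge> k. j \<in> ws \<phi> W \<and> ?B j) \<longleftrightarrow> (\<exists>j > k. j \<in> ws \<phi> W \<and> ?B j) \<or> k \<in> ws \<phi> W \<and> ?B k"
    by (simp only: le_less) blast
  ultimately show ?thesis
    unfolding rpath_fm_def using path_next_sem[OF assms, of k p q] by (cases "p = q") auto
qed

lemma rpath_prev_sem:
  assumes "good W" "pure_fm cl (outer_vars T) \<phi>"
  shows "k \<in> ws (rpath_fm (prev_fm g cl T) (state_list T) p q \<phi>) W \<longleftrightarrow>
    enat k < m \<and> (\<exists>j \<le> k. j \<in> ws \<phi> W \<and> (\<exists>r. r k = p \<and> r j = q \<and> run_on T u r j k))"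
proof -
  let ?B = "\<lambda>j. \<exists>r. r k = p \<and> r j = q \<and> run_on T u r j k"
  have "?B k \<longleftrightarrow> p = q" by (auto intro: exI[of _ "\<lambda>_. q"])
  moreover have "(\<exists>j \<le> k. j \<in> ws \<phi> W \<and> ?B j) \<longleftrightarrow> (\<exists>j < k. j \<in> ws \<phi> W \<and> ?B j) \<or> k \<in> ws \<phi> W \<and> ?B k"
    by (simp only: le_less) blast
  ultimately show ?thesis
    unfolding rpath_fm_def using path_prev_sem[OF assms, of k p q] wsem_less[of k m \<alpha> \<phi> W]
    by (cases "p = q") auto
qed

lemma before_fm_sem:
  "k \<in> ws (before_fm g cl T p) V \<longleftrightarrow>
   enat k < m \<and> (\<exists>r. r 0 \<in> initial T \<and> r k = p \<and> run_on T u r 0 k)"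
proof -
  have "k \<in> ws (before_fm g cl T p) V \<longleftrightarrow> (\<exists>p' \<in> initial T. enat k < m \<and>
    (\<exists>j \<le> k. j \<in> ws (Pos (first_atom cl)) V \<and> (\<exists>r. r k = p \<and> r j = p' \<and> run_on T u r j k)))"
    unfolding before_fm_def wsem_big_or[OF finite_states(2)]
    by (simp add: rpath_prev_sem[OF V] del: wsem.simps)
  moreover have "j \<in> ws (Pos (first_atom cl)) V \<longleftrightarrow> j = 0" if "enat k < m" "j \<le> k" for j
    using \<alpha>_first[of j] enat_less_mono[OF that] by simp
  ultimately show ?thesis by (auto intro: exI[of _ 0])
qed

lemma end_fm_sem:
  "k \<in> ws (end_fm g cl T p) V \<longleftrightarrow> m = enat (Suc k) \<and> (\<exists>q \<in> final T. (p, u k, q) \<in> edges T)"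
proof -
  have "k \<in> ws (big_or (letter_fm g) {x. \<exists>q \<in> final T. (p, x, q) \<in> edges T}) V \<longleftrightarrow>
    enat k < m \<and> (\<exists>q \<in> final T. (p, u k, q) \<in> edges T)"
  proof -
    have "k \<in> ws (letter_fm g x) V \<longleftrightarrow> enat k < m \<and> u k = x" if "(p, x, q) \<in> edges T" for x q
      using letter_fm_sem[OF V edge_label[OF that]] .
    then show ?thesis unfolding wsem_big_or[OF finite_end_labels] by blast
  qed
  then show ?thesis
    unfolding end_fm_def using \<alpha>_last[of k] not_Suc_less_iff[of k m] by auto
qed

lemma after_fin_sem:
  "k \<in> ws (after_fin_fm g cl T q) V \<longleftrightarrow>
   enat k < m \<and> (\<exists>M r. m = enat M \<and> r (Suc k) = q \<and> run_on T u r (Suc k) M \<and> r M \<in> final T)"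
   (is "?L \<longleftrightarrow> ?R")
proof -
  have "?L \<longleftrightarrow> q \<in> final T \<and> m = enat (Suc k) \<or> enat k < m \<and> (\<exists>p \<in> states T. \<exists>j \<ge> Suc k.
    m = enat (Suc j) \<and> (\<exists>q \<in> final T. (p, u j, q) \<in> edges T) \<and>
    (\<exists>r. r (Suc k) = q \<and> r j = p \<and> run_on T u r (Suc k) j))"
    unfolding after_fin_fm_def
    by (simp add: wsem_big_or finite_states rpath_next_sem[OF V] pure_end_fm[OF letters_even]
        end_fm_sem \<alpha>_last not_Suc_less_iff) (use \<alpha>_last[of k] not_Suc_less_iff[of k m] in auto)
  also have "\<dots> \<longleftrightarrow> ?R"
  proof
    assume "q \<in> final T \<and> m = enat (Suc k) \<or> enat k < m \<and> (\<exists>p \<in> states T. \<exists>j \<ge> Suc k.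
      m = enat (Suc j) \<and> (\<exists>q \<in> final T. (p, u j, q) \<in> edges T) \<and>
      (\<exists>r. r (Suc k) = q \<and> r j = p \<and> run_on T u r (Suc k) j))"
    then show ?R
    proof (elim disjE conjE bexE exE)
      assume "q \<in> final T" "m = enat (Suc k)"
      then show ?R by (auto intro!: exI[of _ "\<lambda>_. q"])
    next
      fix p j q' r
      assume *: "Suc k \<le> j" "m = enat (Suc j)" "q' \<in> final T" "(p, u j, q') \<in> edges T"
        "r (Suc k) = q" "r j = p" "run_on T u r (Suc k) j" "enat k < m"
      \<comment> \<open>The last transition is appended: \<open>q'\<close> is placed at index
        \<open>Suc j\<close>, one past the last position.\<close>
      then have "run_on T u (r(Suc j := q')) (Suc k) (Suc j)"
        by (auto simp: run_on_def less_Suc_eq)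
      then show ?R using * by (auto intro!: exI[of _ "r(Suc j := q')"])
    qed
  next
    assume ?R
    then obtain M r where M: "enat k < m" "m = enat M" "r (Suc k) = q" "run_on T u r (Suc k) M"
      "r M \<in> final T" by blast
    show "q \<in> final T \<and> m = enat (Suc k) \<or> enat k < m \<and> (\<exists>p \<in> states T. \<exists>j \<ge> Suc k.
      m = enat (Suc j) \<and> (\<exists>q \<in> final T. (p, u j, q) \<in> edges T) \<and>
      (\<exists>r. r (Suc k) = q \<and> r j = p \<and> run_on T u r (Suc k) j))"
    proof (cases "M = Suc k")
      case False
      then obtain j where j: "M = Suc j" "Suc k \<le> j" using M(1,2) by (cases M) auto
      then have e: "(r j, u j, r (Suc j)) \<in> edges T" using M(4) by (simp add: run_on_def)
      have "run_on T u r (Suc k) j" using M(4) j by (simp add: run_on_def)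
      then show ?thesis using M j e edge_states[OF e] by blast
    qed (use M in auto)
  qed
  finally show ?thesis .
qed

text \<open>Membership in the greatest fixpoint yields a next return, again in the fixpoint, and
  iterating it gives infinitely many returns whose runs are concatenated. Conversely the visits of a
  recurring run form a post-fixed set.\<close>

lemma recur_sem:
  "k \<in> ws (recur_fm g cl T f) V \<longleftrightarrow> m = \<infinity> \<and>
   (\<exists>r. r k = f \<and> (\<forall>i \<ge> k. (r i, u i, r (Suc i)) \<in> edges T) \<and> (\<exists>\<^sub>\<infinity>i. r i = f))"
proof -
  let ?x = "2 * length (state_list T) + 1"
  define F where "F Y = ws (path_fm (next_fm g cl T) (state_list T) f f (Var ?x)) (V(?x := Y))" for Y
  have F: "k \<in> F Y \<longleftrightarrow> (\<exists>j > k. enat j < m \<and> j \<in> Y \<and> (\<exists>r. r k = f \<and> r j = f \<and> run_on T u r k j))" for k Y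
    unfolding F_def
    by (subst path_next_sem[OF good_upd_odd[OF V]]) (auto simp: outer_vars_def)
  have m: "mono F" unfolding F_def by (rule mono_wsem)
  have gfp: "ws (recur_fm g cl T f) V = gfp F"
    unfolding recur_fm_def Let_def wsem.simps F_def[abs_def] ..
  show ?thesis unfolding gfp
  proof safe
    assume k: "k \<in> gfp F"
    have "\<forall>i \<in> gfp F. \<exists>j r. j > i \<and> enat j < m \<and> j \<in> gfp F \<and> r i = f \<and> r j = f \<and> run_on T u r i j"
      using F gfp_unfold[OF m] by blast
    then obtain nx rr where nx: "\<And>i. i \<in> gfp F \<Longrightarrow> nx i > i \<and> enat (nx i) < m \<and> nx i \<in> gfp F \<and>
      rr i i = f \<and> rr i (nx i) = f \<and> run_on T u (rr i) i (nx i)" by metis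
    define K where "K l = (nx ^^ l) k" for l
    have K0: "K 0 = k" and KS: "K (Suc l) = nx (K l)" for l by (simp_all add: K_def)
    have KN: "K l \<in> gfp F" for l by (induction l) (use k nx in \<open>auto simp: K0 KS\<close>)
    have Kk: "k \<le> K l" for l
    proof (induction l)
      case (Suc l)
      then show ?case using nx[OF KN[of l]] by (simp add: KS)
    qed (simp add: K0)
    \<comment> \<open>Shifted by \<open>k\<close> to start at 0, as a factorization must;
      \<open>block h (i - k)\<close> is then the number of the return interval that contains
      \<open>i\<close>.\<close>
    define h where "h l = K l - k" for l
    have h: "factorization h"
      unfolding factorization_def strict_mono_Suc_iff h_def
      using nx[OF KN] Kk by (auto simp: K0 KS intro!: diff_less_mono)
    have Kl: "l < K (Suc l)" for l
      using h strict_mono_imp_increasing[of h "Suc l"] by (simp add: factorization_def h_def)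
    show "m = \<infinity>"
    proof (cases m)
      case (enat M)
      have "enat (K (Suc M)) < m" using nx[OF KN[of M]] by (simp add: KS)
      then show ?thesis using Kl[of M] enat by simp
    qed
    define r where "r i = rr (K (block h (i - k))) i" for i
    have blk: "block h (i - k) = l" if "K l \<le> i" "i < K (Suc l)" for i l
      by (rule block_eq[OF h]) (use that Kk[of l] in \<open>auto simp: h_def\<close>)
    have rK: "r (K l) = f" for l
      using blk[of l "K l"] nx[OF KN[of l]] by (simp add: r_def KS)
    have "(r i, u i, r (Suc i)) \<in> edges T" if "k \<le> i" for i
    proof -
      let ?l = "block h (i - k)"
      have b: "K ?l \<le> i" "i < K (Suc ?l)"
        using block_bounds[OF h, of "i - k"] Kk that by (auto simp: h_def)
      have "run_on T u (rr (K ?l)) (K ?l) (K (Suc ?l))" using nx[OF KN] by (simp add: KS)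
      then have e: "(rr (K ?l) i, u i, rr (K ?l) (Suc i)) \<in> edges T" using b by (simp add: run_on_def)
      have "r (Suc i) = rr (K ?l) (Suc i)"
      proof (cases "Suc i < K (Suc ?l)")
        case True
        then show ?thesis using blk[of ?l "Suc i"] b by (simp add: r_def)
      next
        \<comment> \<open>At the end of an interval the two adjacent runs agree, both being in state
          \<open>f\<close> there.\<close>
        case False
        then have "Suc i = K (Suc ?l)" using b by simp
        then show ?thesis using rK[of "Suc ?l"] nx[OF KN[of ?l]] by (simp add: KS)
      qed
      then show ?thesis using e by (simp add: r_def)
    qed
    moreover have "\<exists>\<^sub>\<infinity>i. r i = f"
      unfolding INFM_nat using Kl rK by blast
    moreover have "r k = f" using rK[of 0] by (simp add: K0)
    ultimately show "\<exists>r. r k = f \<and> (\<forall>i \<ge> k. (r i, u i, r (Suc i)) \<in> edges T) \<and> (\<exists>\<^sub>\<infinity>i. r i = f)"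
      by blast
  next
    fix r assume r: "m = \<infinity>" "\<forall>i \<ge> k. (r i, u i, r (Suc i)) \<in> edges T" "\<exists>\<^sub>\<infinity>i. r i = r k" "f = r k"
    \<comment> \<open>The visits to the recurring state from \<open>k\<close> on form a post-fixed
      set, as each of them is followed by a later one.\<close>
    let ?Y = "{i. k \<le> i \<and> r i = r k}"
    have "?Y \<subseteq> F ?Y"
    proof
      fix i assume i: "i \<in> ?Y"
      obtain j where "j > i" "r j = r k" using r(3) unfolding INFM_nat by blast
      moreover have "run_on T u r i j" using r(2) i by (simp add: run_on_def)
      ultimately show "i \<in> F ?Y" using i r(1,4) unfolding F by auto
    qed
    then have "?Y \<subseteq> gfp F" by (rule gfp_upperbound)
    then show "k \<in> gfp F" by auto
  qed
qed

lemma after_inf_sem: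
  "k \<in> ws (after_inf_fm g cl T q) V \<longleftrightarrow> m = \<infinity> \<and>
   (\<exists>r. r (Suc k) = q \<and> (\<forall>i > k. (r i, u i, r (Suc i)) \<in> edges T) \<and> (\<exists>\<^sub>\<infinity>i. r i \<in> final T))"
   (is "?L \<longleftrightarrow> ?R")
proof -
  have "?L \<longleftrightarrow> enat k < m \<and> (\<exists>f \<in> final T. \<exists>j \<ge> Suc k. m = \<infinity> \<and>
    (\<exists>r. r j = f \<and> (\<forall>i \<ge> j. (r i, u i, r (Suc i)) \<in> edges T) \<and> (\<exists>\<^sub>\<infinity>i. r i = f)) \<and>
    (\<exists>r. r (Suc k) = q \<and> r j = f \<and> run_on T u r (Suc k) j))"
    unfolding after_inf_fm_def
    by (simp add: wsem_big_or finite_states rpath_next_sem[OF V] pure_recur_fm[OF letters_even] recur_sem)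
  also have "\<dots> \<longleftrightarrow> ?R"
  proof safe
    fix j r r'
    assume j: "Suc k \<le> j" and r: "\<forall>i \<ge> j. (r i, u i, r (Suc i)) \<in> edges T" "\<exists>\<^sub>\<infinity>i. r i = r j"
      "r j \<in> final T" and r': "run_on T u r' (Suc k) j" "r' j = r j" and "q = r' (Suc k)"
    \<comment> \<open>Follow the run that reaches the final state up to \<open>j\<close>, then the
      run that keeps returning to it.\<close>
    define s where "s i = (if i < j then r' i else r i)" for i
    have "s (Suc k) = r' (Suc k)" using j r'(2) by (auto simp: s_def le_less)
    moreover have "(s i, u i, s (Suc i)) \<in> edges T" if "k < i" for i
    proof (cases "i < j")
      case True
      then have "(r' i, u i, r' (Suc i)) \<in> edges T" using r'(1) that by (simp add: run_on_def)
      moreover have "s (Suc i) = r' (Suc i)"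
        using True r'(2) by (cases "Suc i = j") (auto simp: s_def)
      ultimately show ?thesis using True by (simp add: s_def)
    qed (use r(1) in \<open>simp add: s_def\<close>)
    moreover have "\<exists>\<^sub>\<infinity>i. s i \<in> final T"
      unfolding INFM_nat
    proof
      fix n
      obtain i where "i > max n j" "r i = r j" using r(2) unfolding INFM_nat by blast
      then show "\<exists>i > n. s i \<in> final T" using r(3) by (intro exI[of _ i]) (auto simp: s_def)
    qed
    ultimately show "\<exists>r. r (Suc k) = r' (Suc k) \<and> (\<forall>i > k. (r i, u i, r (Suc i)) \<in> edges T) \<and>
      (\<exists>\<^sub>\<infinity>i. r i \<in> final T)" by blast
  next
    fix r assume r: "m = \<infinity>" "\<forall>i > k. (r i, u i, r (Suc i)) \<in> edges T" "\<exists>\<^sub>\<infinity>i. r i \<in> final T"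
    \<comment> \<open>Pigeonhole: infinitely many visits to a finite set of final states contain
      infinitely many visits to one of them.\<close>
    from r(3) have "\<exists>\<^sub>\<infinity>i. \<exists>f \<in> final T. r i = f" by simp
    then obtain f where f: "f \<in> final T" "\<exists>\<^sub>\<infinity>i. r i = f"
      using frequently_bex_finite[OF finite_states(3), of "\<lambda>i f. r i = f"] by auto
    then obtain j where j: "j > Suc k" "r j = f" unfolding INFM_nat by blast
    have "run_on T u r (Suc k) j" using r(2) by (simp add: run_on_def)
    then show "\<exists>f \<in> final T. \<exists>j \<ge> Suc k. \<infinity> = \<infinity> \<and>
      (\<exists>r. r j = f \<and> (\<forall>i \<ge> j. (r i, u i, r (Suc i)) \<in> edges T) \<and> (\<exists>\<^sub>\<infinity>i. r i = f)) \<and>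
      (\<exists>r'. r' (Suc k) = r (Suc k) \<and> r' j = f \<and> run_on T u r' (Suc k) j)"
      using r(2) f j by (intro bexI[of _ f] exI[of _ j] conjI exI[of _ r]) auto
  qed auto
  finally show ?thesis .
qed

lemma output_fm_sem:
  "k \<in> ws (output_fm after g cl T b) V \<longleftrightarrow> enat k < m \<and> (\<exists>p q. (p, u k, b, q) \<in> delta T \<and>
     (\<exists>r. r 0 \<in> initial T \<and> r k = p \<and> run_on T u r 0 k) \<and> k \<in> ws (after q) V)"
proof -
  have "k \<in> ws (output_fm after g cl T b) V \<longleftrightarrow> (\<exists>p x q. (p, x, b, q) \<in> delta T \<and>
    k \<in> ws (letter_fm g x) V \<and> k \<in> ws (before_fm g cl T p) V \<and> k \<in> ws (after q) V)"
    unfolding output_fm_def wsem_big_or[OF finite_output_edges] by (simp add: Bex_def)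
  moreover have "k \<in> ws (letter_fm g x) V \<longleftrightarrow> enat k < m \<and> u k = x" if "(p, x, b, q) \<in> delta T" for p x q
    by (rule letter_fm_sem[OF V output_label[OF that]])
  ultimately show ?thesis unfolding before_fm_sem by blast
qed

lemma edge_outputs:
  assumes "run_on T u r i j"
  obtains v where "\<And>l. i \<le> l \<Longrightarrow> l < j \<Longrightarrow> (r l, u l, v l, r (Suc l)) \<in> delta T"
proof -
  have "\<forall>l. \<exists>b. i \<le> l \<and> l < j \<longrightarrow> (r l, u l, b, r (Suc l)) \<in> delta T"
    using assms unfolding run_on_def edges_def by blast
  then obtain v where "\<forall>l. i \<le> l \<and> l < j \<longrightarrow> (r l, u l, v l, r (Suc l)) \<in> delta T"
    using choice[of "\<lambda>l b. i \<le> l \<and> l < j \<longrightarrow> (r l, u l, b, r (Suc l)) \<in> delta T"] by blast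
  then show ?thesis using that[of v] by blast
qed

text \<open>Whether a run succeeds with output \<open>b\<close> at \<open>k\<close> depends on past
  and future only through the two states around \<open>k\<close>, so a past run and a future run may
  be chosen separately and joined by the transition at \<open>k\<close>.\<close>

lemma output_fin_sem:
  "k \<in> ws (output_fm (after_fin_fm g cl T) g cl T b) V \<longleftrightarrow>
   enat k < m \<and> (\<exists>M v. m = enat M \<and> (seg u 0 M, seg v 0 M) \<in> word_rel T \<and> v k = b)"
  unfolding output_fm_sem after_fin_sem word_rel_seg
proof safe
  fix q r M r'
  assume k: "enat k < enat M" and r: "(r k, u k, b, r' (Suc k)) \<in> delta T" "r 0 \<in> initial T"
    "run_on T u r 0 k" and r': "run_on T u r' (Suc k) M" "r' M \<in> final T"
  obtain v where v: "\<And>l. l < k \<Longrightarrow> (r l, u l, v l, r (Suc l)) \<in> delta T"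
    by (rule edge_outputs[OF r(3)]) (rule that, simp)
  obtain v' where v': "\<And>l. Suc k \<le> l \<Longrightarrow> l < M \<Longrightarrow> (r' l, u l, v' l, r' (Suc l)) \<in> delta T"
    by (rule edge_outputs[OF r'(1)]) (rule that)
  \<comment> \<open>The past run owns the states up to \<open>k\<close> inclusive, the future run
    those from \<open>Suc k\<close> on, and the transition between them outputs
    \<open>b\<close>.\<close>
  let ?s = "\<lambda>i. if i \<le> k then r i else r' i"
  let ?v = "\<lambda>i. if i < k then v i else if i = k then b else v' i"
  have "(?s i, u i, ?v i, ?s (Suc i)) \<in> delta T" if "i < M" for i
    using v[of i] v'[of i] r(1) that by (cases i k rule: linorder_cases) auto
  then have "?s 0 \<in> initial T \<and> (\<forall>i<M. (?s i, u i, ?v i, ?s (Suc i)) \<in> delta T) \<and> ?s M \<in> final T"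
    using r(2) r'(2) k by simp
  then show "\<exists>M' v. enat M = enat M' \<and>
    (\<exists>r. r 0 \<in> initial T \<and> (\<forall>i<M'. (r i, u i, v i, r (Suc i)) \<in> delta T) \<and> r M' \<in> final T) \<and> v k = b"
    by (intro exI[of _ M] exI[of _ ?v] conjI refl exI[of _ ?s]) auto
next
  fix M v r
  assume r: "enat k < enat M" "r 0 \<in> initial T" "\<forall>i<M. (r i, u i, v i, r (Suc i)) \<in> delta T" "r M \<in> final T"
  then have "run_on T u r 0 k" "run_on T u r (Suc k) M"
    by (auto simp: run_on_def edges_def) (meson less_trans)
  then show "\<exists>p q. (p, u k, v k, q) \<in> delta T \<and> (\<exists>r. r 0 \<in> initial T \<and> r k = p \<and> run_on T u r 0 k) \<and>
    enat k < enat M \<and> (\<exists>M' r. enat M = enat M' \<and> r (Suc k) = q \<and> run_on T u r (Suc k) M' \<and> r M' \<in> final T)"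
    using r by (intro exI[of _ "r k"] exI[of _ "r (Suc k)"]) auto
qed

lemma output_inf_sem:
  "k \<in> ws (output_fm (after_inf_fm g cl T) g cl T b) V \<longleftrightarrow>
   m = \<infinity> \<and> (\<exists>v. (u, v) \<in> buchi_rel T \<and> v k = b)"
  unfolding output_fm_sem after_inf_sem buchi_rel_def mem_Collect_eq prod.case
proof safe
  fix q r r'
  assume r: "(r k, u k, b, r' (Suc k)) \<in> delta T" "r 0 \<in> initial T"
    "run_on T u r 0 k" and r': "\<forall>i>k. (r' i, u i, r' (Suc i)) \<in> edges T" "\<exists>\<^sub>\<infinity>i. r' i \<in> final T"
  obtain v where v: "\<And>l. l < k \<Longrightarrow> (r l, u l, v l, r (Suc l)) \<in> delta T"
    by (rule edge_outputs[OF r(3)]) (rule that, simp)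
  obtain v' where v': "\<And>l. k < l \<Longrightarrow> (r' l, u l, v' l, r' (Suc l)) \<in> delta T"
  proof -
    have "\<forall>l. \<exists>b. k < l \<longrightarrow> (r' l, u l, b, r' (Suc l)) \<in> delta T"
      using r'(1) unfolding edges_def by blast
    then show ?thesis using that by metis
  qed
  let ?s = "\<lambda>i. if i \<le> k then r i else r' i"
  let ?v = "\<lambda>i. if i < k then v i else if i = k then b else v' i"
  have "(?s i, u i, ?v i, ?s (Suc i)) \<in> delta T" for i
    using v[of i] v'[of i] r(1) by (cases i k rule: linorder_cases) auto
  moreover have "\<exists>\<^sub>\<infinity>i. ?s i \<in> final T"
    unfolding INFM_nat
  proof
    fix n
    obtain i where "i > max n k" "r' i \<in> final T" using r'(2) unfolding INFM_nat by blast
    then show "\<exists>i > n. ?s i \<in> final T" by (intro exI[of _ i]) auto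
  qed
  ultimately have "?s 0 \<in> initial T \<and> (\<forall>i. (?s i, u i, ?v i, ?s (Suc i)) \<in> delta T) \<and>
      (\<exists>\<^sub>\<infinity>i. ?s i \<in> final T)" using r(2) by simp
  then show "\<exists>v. (\<exists>r. r 0 \<in> initial T \<and> (\<forall>i. (r i, u i, v i, r (Suc i)) \<in> delta T) \<and>
      (\<exists>\<^sub>\<infinity>i. r i \<in> final T)) \<and> v k = b"
    by (intro exI[of _ ?v] conjI exI[of _ ?s]) auto
next
  fix v r
  assume r: "r 0 \<in> initial T" "\<forall>i. (r i, u i, v i, r (Suc i)) \<in> delta T" "\<exists>\<^sub>\<infinity>i. r i \<in> final T"
  then have "run_on T u r 0 k" "\<forall>i>k. (r i, u i, r (Suc i)) \<in> edges T"
    by (auto simp: run_on_def edges_def)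
  then show "\<exists>p q. (p, u k, v k, q) \<in> delta T \<and> (\<exists>r. r 0 \<in> initial T \<and> r k = p \<and> run_on T u r 0 k) \<and>
    \<infinity> = \<infinity> \<and> (\<exists>r. r (Suc k) = q \<and> (\<forall>i>k. (r i, u i, r (Suc i)) \<in> edges T) \<and>
      (\<exists>\<^sub>\<infinity>i. r i \<in> final T))"
    using r by (intro exI[of _ "r k"] exI[of _ "r (Suc k)"]) auto
qed auto

end

text \<open>The length of the chain decides which disjunct can hold: the first requires a finite
  chain, the second an infinite one.\<close>

definition layer_output_fm :: "('a \<Rightarrow> nat) \<Rightarrow> 'a uniform_layer \<Rightarrow> 'a \<Rightarrow> 'a fm" where
  "layer_output_fm g L b =
     Or (output_fm (after_fin_fm g (fst L) (fst (snd L))) g (fst L) (fst (snd L)) b)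
        (output_fm (after_inf_fm g (fst L) (snd (snd L))) g (fst L) (snd (snd L)) b)"

section \<open>From cascades to formulas\<close>

lemma trans_rel_cong:
  assumes "trans_rel T T\<^sub>\<omega> m u v" "\<And>k. enat k < m \<Longrightarrow> v k = v' k"
  shows "trans_rel T T\<^sub>\<omega> m u v'"
proof (cases m)
  case (enat M)
  then have "seg v 0 M = seg v' 0 M" using assms(2) by (simp add: seg_eq_iff)
  then show ?thesis using assms(1) enat by (simp add: trans_rel_def)
next
  case infinity
  then have "v = v'" using assms(2) by auto
  then show ?thesis using assms(1) by simp
qed

lemma trans_rel_functional:
  assumes "is_uniform_layer \<Sigma> \<Gamma> L" "trans_rel (fst (snd L)) (snd (snd L)) m u v"
    "trans_rel (fst (snd L)) (snd (snd L)) m u v'" "enat k < m"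
  shows "v k = v' k"
proof (cases m)
  case (enat M)
  then have "seg v 0 M = seg v' 0 M"
    using assms by (auto simp: trans_rel_def is_uniform_layer_def functional_transducer_def dest: single_valuedD)
  then show ?thesis using assms(4) enat by (simp add: seg_eq_iff)
next
  case infinity
  then have "v = v'"
    using assms by (auto simp: trans_rel_def is_uniform_layer_def functional_buchi_def dest: single_valuedD)
  then show ?thesis by simp
qed

lemma trans_rel_output:
  assumes "is_uniform_layer \<Sigma> \<Gamma> L" "trans_rel (fst (snd L)) (snd (snd L)) m u v" "enat k < m"
  shows "v k \<in> \<Gamma>"
proof -
  have "is_transducer (\<Sigma> \<times> UNIV) \<Gamma> (fst (snd L))" "is_transducer (\<Sigma> \<times> UNIV) \<Gamma> (snd (snd L))"
    using assms(1) by (simp_all add: is_uniform_layer_def functional_transducer_def functional_buchi_def)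
  then have out: "(p, x, y, q) \<in> delta (fst (snd L)) \<Longrightarrow> y \<in> \<Gamma>"
    "(p, x, y, q) \<in> delta (snd (snd L)) \<Longrightarrow> y \<in> \<Gamma>" for p x y q
    by (auto simp: is_transducer_def)
  show ?thesis
  proof (cases m)
    case (enat M)
    then obtain r where "\<forall>i < M. (r i, u i, v i, r (Suc i)) \<in> delta (fst (snd L))"
      using assms(2) by (auto simp: trans_rel_def word_rel_seg)
    then have "(r k, u k, v k, r (Suc k)) \<in> delta (fst (snd L))" using assms(3) enat by simp
    then show ?thesis by (rule out(1))
  next
    case infinity
    then obtain r where "\<forall>i. (r i, u i, v i, r (Suc i)) \<in> delta (snd (snd L))"
      using assms(2) by (auto simp: trans_rel_def buchi_rel_def)
    then have "(r k, u k, v k, r (Suc k)) \<in> delta (snd (snd L))" by blast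
    then show ?thesis by (rule out(2))
  qed
qed

lemma layer_transducers:
  assumes "is_uniform_layer \<Gamma> \<Gamma>' L"
  shows "is_transducer (\<Gamma> \<times> UNIV) \<Gamma>' (fst (snd L))" "is_transducer (\<Gamma> \<times> UNIV) \<Gamma>' (snd (snd L))"
  using assms by (simp_all add: is_uniform_layer_def functional_transducer_def functional_buchi_def)

lemma pure_layer_output_fm:
  assumes L: "is_uniform_layer \<Gamma> \<Gamma>' L"
  shows "pure_fm (fst L) ((\<lambda>c. 2 * g c) ` \<Gamma>) (layer_output_fm g L x)"
proof -
  interpret F: letter_transducer \<Gamma> g "fst L" "fst (snd L)" \<Gamma>'
    by unfold_locales (rule layer_transducers[OF L])
  interpret I: letter_transducer \<Gamma> g "fst L" "snd (snd L)" \<Gamma>'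
    by unfold_locales (rule layer_transducers[OF L])
  show ?thesis
    unfolding layer_output_fm_def pure_fm_simps
    by (intro conjI F.pure_output_fm F.pure_after_fin_fm I.pure_output_fm I.pure_after_inf_fm) auto
qed

lemma layer_output_fm_sem:
  assumes L: "is_uniform_layer \<Gamma> \<Gamma>' L" and g: "inj_on g \<Gamma>"
    and b: "\<And>i. enat i < n \<Longrightarrow> b i \<in> \<Gamma>"
    and V: "\<And>i c. enat i < n \<Longrightarrow> c \<in> \<Gamma> \<Longrightarrow> i \<in> V (2 * g c) \<longleftrightarrow> b i = c"
    and C: "C = chain_of (fst L) n d i" and k: "enat k < csize C"
  shows "enum_set C k \<in> sem n a d (layer_output_fm g L x) V \<longleftrightarrow>
    (\<exists>v. trans_rel (fst (snd L)) (snd (snd L)) (csize C)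
      (chain_word (fst L) n d i (\<lambda>j. (b j, tp n d j))) v \<and> v k = x)"
proof -
  let ?\<alpha> = "\<lambda>A. {k. enat k < csize C \<and> holds_atom n a d A (enum_set C k)}"
  let ?V = "\<lambda>x. {k. enat k < csize C \<and> enum_set C k \<in> V x}"
  let ?u = "chain_word (fst L) n d i (\<lambda>j. (b j, tp n d j))"
  have in_n: "enat (enum_set C k) < n" if "enat k < csize C" for k
    using that unfolding C by (rule chain_in_positions)
  interpret W: letter_word "csize C" ?\<alpha> ?u \<Gamma> g "fst L"
    by unfold_locales
      (use g b in_n in \<open>auto simp: chain_word_def tp_def first_on_chain last_on_chain C\<close>)
  have good: "W.good ?V"
    unfolding W.good_def using V in_n by (auto simp: chain_word_def C)
  interpret F: letter_word_transducer "csize C" ?\<alpha> ?u \<Gamma> g "fst L" "fst (snd L)" \<Gamma>' ?V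
    by unfold_locales (rule layer_transducers[OF L] good)+
  interpret I: letter_word_transducer "csize C" ?\<alpha> ?u \<Gamma> g "fst L" "snd (snd L)" \<Gamma>' ?V
    by unfold_locales (rule layer_transducers[OF L] good)+
  have "modalities (layer_output_fm g L x) \<subseteq> {next_mod (fst L), prev_mod (fst L)}"
    using pure_layer_output_fm[OF L] by (auto simp: pure_fm_def)
  then have "enum_set C k \<in> sem n a d (layer_output_fm g L x) V \<longleftrightarrow>
    k \<in> wsem (csize C) ?\<alpha> (layer_output_fm g L x) ?V"
    using C k by (rule sem_on_chain)
  also have "\<dots> \<longleftrightarrow>
    enat k < csize C \<and> (\<exists>M v. csize C = enat M \<and> (seg ?u 0 M, seg v 0 M) \<in> word_rel (fst (snd L)) \<and> v k = x) \<or>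
    csize C = \<infinity> \<and> (\<exists>v. (?u, v) \<in> buchi_rel (snd (snd L)) \<and> v k = x)"
    unfolding layer_output_fm_def wsem.simps Un_iff F.output_fin_sem I.output_inf_sem ..
  also have "\<dots> \<longleftrightarrow> (\<exists>v. trans_rel (fst (snd L)) (snd (snd L)) (csize C) ?u v \<and> v k = x)"
    using k by (cases "csize C") (simp_all add: trans_rel_def)
  finally show ?thesis .
qed

text \<open>Outputs on different chains are chosen independently. Chains partition the positions, so
  the choices combine into one output word.\<close>

lemma chain_output_exists:
  assumes L: "is_uniform_layer \<Gamma> \<Gamma>' L"
    and ex: "\<And>i. enat i < n \<Longrightarrow> \<exists>v. trans_rel (fst (snd L)) (snd (snd L)) (csize (chain_of (fst L) n d i))
      (chain_word (fst L) n d i u) v"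
  obtains b where "\<And>i. enat i < n \<Longrightarrow> trans_rel (fst (snd L)) (snd (snd L))
    (csize (chain_of (fst L) n d i)) (chain_word (fst L) n d i u) (chain_word (fst L) n d i b)"
proof -
  let ?C = "chain_of (fst L) n d"
  \<comment> \<open>The choice depends on the chain as a set and not on a position in it, so all
    positions of a chain use the same output.\<close>
  define w where "w C = (SOME v. trans_rel (fst (snd L)) (snd (snd L)) (csize C)
    (\<lambda>k. u (enum_set C k)) v)" for C
  define b where "b j = w (?C j) (SOME k. enat k < csize (?C j) \<and> enum_set (?C j) k = j)" for j
  have "trans_rel (fst (snd L)) (snd (snd L)) (csize (?C i)) (chain_word (fst L) n d i u)
      (chain_word (fst L) n d i b)" if i: "enat i < n" for i
  proof (rule trans_rel_cong)
    show "trans_rel (fst (snd L)) (snd (snd L)) (csize (?C i)) (chain_word (fst L) n d i u) (w (?C i))"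
      using ex[OF i] unfolding w_def chain_word_def by (rule someI_ex)
    fix k assume k: "enat k < csize (?C i)"
    have eq: "?C (enum_set (?C i) k) = ?C i"
      using enum_set_in[OF k] by (rule chain_of_eq)
    have "(SOME l. enat l < csize (?C i) \<and> enum_set (?C i) l = enum_set (?C i) k) = k"
      using k enum_set_le(2) by (intro some_equality) auto
    then show "w (?C i) k = chain_word (fst L) n d i b k"
      unfolding chain_word_def b_def eq by simp
  qed
  then show ?thesis by (rule that)
qed

text \<open>The formula only says that some successful run on the chain outputs \<open>x\<close>
  here. Functionality identifies this letter with that of the actual output, and an output letter at
  a single position already witnesses a successful run on its chain.\<close>

lemma layer_rel_iff:
  assumes L: "is_uniform_layer \<Gamma> \<Gamma>' L" and g: "inj_on g \<Gamma>"
    and b: "\<And>i. enat i < n \<Longrightarrow> b i \<in> \<Gamma>"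
    and V: "\<And>i c. enat i < n \<Longrightarrow> c \<in> \<Gamma> \<Longrightarrow> i \<in> V (2 * g c) \<longleftrightarrow> b i = c"
  shows "layer_rel n d L b b' \<Longrightarrow> enat i < n \<Longrightarrow>
      b' i \<in> \<Gamma>' \<and> (i \<in> sem n a d (layer_output_fm g L x) V \<longleftrightarrow> b' i = x)"
    and "(\<And>i. enat i < n \<Longrightarrow> \<exists>x. i \<in> sem n a d (layer_output_fm g L x) V) \<Longrightarrow>
      \<exists>b'. layer_rel n d L b b'"
proof -
  let ?C = "chain_of (fst L) n d"
  let ?u = "\<lambda>i. chain_word (fst L) n d i (\<lambda>j. (b j, tp n d j))"
  let ?R = "\<lambda>i. trans_rel (fst (snd L)) (snd (snd L)) (csize (?C i)) (?u i)"
  have sem: "enum_set (?C i) k \<in> sem n a d (layer_output_fm g L x) V \<longleftrightarrow> (\<exists>v. ?R i v \<and> v k = x)"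
    if "enat k < csize (?C i)" for i k x
    by (rule layer_output_fm_sem[OF L g _ _ refl that]) (use b V in auto)
  {
    assume rel: "layer_rel n d L b b'" and i: "enat i < n"
    obtain k where k: "enat k < csize (?C i)" "i = enum_set (?C i) k"
      using self_in_chain[OF i] by (rule enum_set_obtain)
    have R: "?R i (chain_word (fst L) n d i b')" using rel i by (simp add: layer_rel_def)
    have bk: "chain_word (fst L) n d i b' k = b' i" using k(2) by (simp add: chain_word_def)
    have "i \<in> sem n a d (layer_output_fm g L x) V \<longleftrightarrow> (\<exists>v. ?R i v \<and> v k = x)"
      using sem[OF k(1)] k(2) by simp
    also have "\<dots> \<longleftrightarrow> b' i = x"
    proof
      assume "\<exists>v. ?R i v \<and> v k = x"
      then obtain v where "?R i v" "v k = x" by blast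
      then show "b' i = x" using trans_rel_functional[OF L R _ k(1), of v] bk by simp
    qed (intro exI conjI, rule R, simp add: bk)
    finally show "b' i \<in> \<Gamma>' \<and> (i \<in> sem n a d (layer_output_fm g L x) V \<longleftrightarrow> b' i = x)"
      using trans_rel_output[OF L R k(1)] bk by simp
  }
  assume ex: "\<And>i. enat i < n \<Longrightarrow> \<exists>x. i \<in> sem n a d (layer_output_fm g L x) V"
  have ex': "\<exists>v. ?R i v" if i: "enat i < n" for i
  proof -
    obtain k where k: "enat k < csize (?C i)" "i = enum_set (?C i) k"
      using self_in_chain[OF i] by (rule enum_set_obtain)
    then show ?thesis using ex[OF i] sem[OF k(1)] by auto
  qed
  obtain b' where "\<And>i. enat i < n \<Longrightarrow> ?R i (chain_word (fst L) n d i b')"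
    by (rule chain_output_exists[OF L, of n d "\<lambda>j. (b j, tp n d j)"]) (erule ex', rule that)
  then show "\<exists>b'. layer_rel n d L b b'" unfolding layer_rel_def by blast
qed

section \<open>Substitutions that stay inside BMA\<close>

lemma Comp_upto_Suc_mono: "Comp_upto i \<Psi> \<subseteq> Comp_upto (Suc i) \<Psi>"
proof (induction i)
  case (Suc i)
  have "Comp_upto (Suc i) \<Psi> \<subseteq> {subst \<psi> \<sigma> | \<psi> \<sigma>. \<psi> \<in> \<Psi> \<and> (\<forall>x \<in> fv \<psi>. \<sigma> x \<in> Comp_upto (Suc i) \<Psi>)}"
    using Suc by (force simp del: Comp_upto.simps(2) simp: Comp_upto.simps(2)[of i])
  then show ?case unfolding Comp_upto.simps(2)[of "Suc i"] .
qed simp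

lemma Comp_upto_mono: "i \<le> j \<Longrightarrow> Comp_upto i \<Psi> \<subseteq> Comp_upto j \<Psi>"
  by (rule lift_Suc_mono_le[of "\<lambda>i. Comp_upto i \<Psi>", OF Comp_upto_Suc_mono])

text \<open>A formula has finitely many free variables, so the levels of its arguments have a
  maximum.\<close>

lemma subst_in_Comp:
  assumes "\<psi> \<in> \<Psi>" "\<And>x. x \<in> fv \<psi> \<Longrightarrow> \<sigma> x \<in> Comp \<Psi>"
  shows "subst \<psi> \<sigma> \<in> Comp \<Psi>"
proof -
  have "\<forall>x \<in> fv \<psi>. \<exists>i. \<sigma> x \<in> Comp_upto i \<Psi>" using assms(2) by (auto simp: Comp_def)
  then obtain i where i: "\<forall>x \<in> fv \<psi>. \<sigma> x \<in> Comp_upto (i x) \<Psi>" by metis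
  have "\<sigma> x \<in> Comp_upto (Max (i ` fv \<psi>)) \<Psi>" if "x \<in> fv \<psi>" for x
  proof -
    have "i x \<le> Max (i ` fv \<psi>)" using that finite_fv by (intro Max_ge) auto
    then show ?thesis using i that Comp_upto_mono by blast
  qed
  then have "subst \<psi> \<sigma> \<in> Comp_upto (Suc (Max (i ` fv \<psi>))) \<Psi>" using assms(1) by auto
  then show ?thesis unfolding Comp_def by blast
qed

lemma subst_in_BMA:
  assumes "pure_fm cl L \<psi>" "\<And>x. x \<in> L \<Longrightarrow> \<sigma> x \<in> BMA \<Sigma>"
  shows "subst \<psi> \<sigma> \<in> BMA \<Sigma>"
  unfolding BMA_def
proof (rule subst_in_Comp)
  show "\<psi> \<in> Formulas \<Sigma> {Xg, Yg} \<union> Formulas \<Sigma> {Xc, Yc}"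
    using assms(1) by (cases cl) (auto simp: pure_fm_def Formulas_def next_mod_def prev_mod_def)
  show "\<sigma> x \<in> Comp (Formulas \<Sigma> {Xg, Yg} \<union> Formulas \<Sigma> {Xc, Yc})" if "x \<in> fv \<psi>" for x
    using assms that by (auto simp: pure_fm_def BMA_def)
qed

lemma sem_subst_BMA:
  assumes "pure_fm cl L \<psi>" "\<And>x. x \<in> L \<Longrightarrow> \<sigma> x \<in> BMA \<Sigma>"
  shows "sem n a d (subst \<psi> \<sigma>) V = sem n a d \<psi> (\<lambda>x. sem n a d (\<sigma> x) V)"
  by (rule sem_subst_closed) (use assms fv_Comp in \<open>fastforce simp: pure_fm_def BMA_def\<close>)

text \<open>A greatest fixpoint, since on omega-words the atom \<open>LastG\<close> never becomes
  true and the unfolding does not stop. Variable 1 is the place for the property.\<close>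

definition always_fm :: "'a fm" where
  "always_fm = Nu 0 (And (Var 1) (Or (Pos LastG) (Modal Xg (Var 0))))"

lemma pure_always_fm: "pure_fm False {1} always_fm"
  by (simp add: always_fm_def next_mod_def)

lemma always_fm_sem:
  assumes "0 < n"
  shows "0 \<in> sem n a d always_fm V \<longleftrightarrow> (\<forall>i. enat i < n \<longrightarrow> i \<in> V 1)"
proof -
  define f where "f X = sem n a d (And (Var 1) (Or (Pos LastG) (Modal Xg (Var 0)))) (V(0 := X))" for X
  have f: "i \<in> f X \<longleftrightarrow> enat i < n \<and> i \<in> V 1 \<and> (enat (Suc i) < n \<longrightarrow> Suc i \<in> X)" for i X
    by (auto simp: f_def)
  have m: "mono f" unfolding f_def by (rule mono_sem)
  have "sem n a d always_fm V = gfp f" by (simp add: always_fm_def f_def[abs_def])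
  moreover have "0 \<in> gfp f \<longleftrightarrow> (\<forall>i. enat i < n \<longrightarrow> i \<in> V 1)"
  proof
    assume 0: "0 \<in> gfp f"
    have step: "i \<in> gfp f \<Longrightarrow> i \<in> V 1 \<and> (enat (Suc i) < n \<longrightarrow> Suc i \<in> gfp f)" for i
      using gfp_unfold[OF m] f by blast
    have "enat i < n \<Longrightarrow> i \<in> gfp f" for i
      by (induction i) (use 0 step Suc_less_enatD in blast)+
    then show "\<forall>i. enat i < n \<longrightarrow> i \<in> V 1" using step by blast
  next
    assume V: "\<forall>i. enat i < n \<longrightarrow> i \<in> V 1"
    have "positions n \<subseteq> f (positions n)" using V by (auto simp: f)
    then have "positions n \<subseteq> gfp f" by (rule gfp_upperbound)
    then show "0 \<in> gfp f" using assms by (auto simp: zero_enat_def)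
  qed
  ultimately show ?thesis by simp
qed

lemma true_in_BMA: "Or (Pos FirstG) (Neg FirstG) \<in> BMA \<Sigma>"
  using subst_in_BMA[of False "{}" "Or (Pos FirstG) (Neg FirstG)" "\<lambda>_. undefined" \<Sigma>] by simp

lemma letter_in_BMA:
  assumes "c \<in> \<Sigma>"
  shows "Pos (Letter c) \<in> BMA \<Sigma>"
proof -
  have "subst (Pos (Letter c)) (\<lambda>_. undefined) \<in> BMA \<Sigma>"
    unfolding BMA_def by (rule subst_in_Comp) (use assms in \<open>auto simp: Formulas_def\<close>)
  then show ?thesis by simp
qed

lemma always_exists_BMA:
  fixes \<Gamma> :: "'b set" and \<Sigma> :: "'a set"
  assumes "finite \<Gamma>" "\<And>x. x \<in> \<Gamma> \<Longrightarrow> \<theta> x \<in> BMA \<Sigma>"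
  obtains \<phi> where "\<phi> \<in> BMA \<Sigma>"
    and "\<And>n a d. 0 < n \<Longrightarrow> 0 \<in> sem n a (d :: nat \<Rightarrow> 'd) \<phi> (\<lambda>_. {}) \<longleftrightarrow>
      (\<forall>i. enat i < n \<longrightarrow> (\<exists>x \<in> \<Gamma>. i \<in> sem n a d (\<theta> x) (\<lambda>_. {})))"
proof -
  obtain h :: "'b \<Rightarrow> nat" where h: "inj_on h \<Gamma>"
    using finite_imp_inj_to_nat_seg[OF assms(1)] by blast
  define \<sigma> where "\<sigma> y = \<theta> (inv_into \<Gamma> h y)" for y
  have \<sigma>: "\<sigma> (h x) = \<theta> x" if "x \<in> \<Gamma>" for x using h that by (simp add: \<sigma>_def)
  let ?or = "big_or (\<lambda>x. Var (h x)) \<Gamma> :: 'a fm"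
  have pure: "pure_fm False (h ` \<Gamma>) ?or" by (rule pure_fm_big_or[OF assms(1)]) simp
  have \<sigma>B: "y \<in> h ` \<Gamma> \<Longrightarrow> \<sigma> y \<in> BMA \<Sigma>" for y using \<sigma> assms(2) by auto
  let ?\<chi> = "subst ?or \<sigma>"
  have \<chi>: "?\<chi> \<in> BMA \<Sigma>" using pure \<sigma>B by (rule subst_in_BMA)
  have "subst always_fm (\<lambda>_. ?\<chi>) \<in> BMA \<Sigma>"
    by (rule subst_in_BMA[OF pure_always_fm]) (rule \<chi>)
  moreover have "0 \<in> sem n a d (subst always_fm (\<lambda>_. ?\<chi>)) (\<lambda>_. {}) \<longleftrightarrow>
      (\<forall>i. enat i < n \<longrightarrow> (\<exists>x \<in> \<Gamma>. i \<in> sem n a d (\<theta> x) (\<lambda>_. {})))" if "0 < n" for n a and d :: "nat \<Rightarrow> 'd"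
    using that \<chi> sem_subset_positions[of n a d]
    by (simp add: sem_subst_BMA[OF pure_always_fm] always_fm_sem sem_subst_BMA[OF pure \<sigma>B]
        sem_big_or[OF assms(1)] \<sigma>)
  ultimately show ?thesis by (rule that)
qed

text \<open>The induction separates the word \<open>b\<close> on which the remaining cascade runs
  from the original word \<open>a\<close> on which formulas are evaluated. The formulas
  \<open>\<theta> c\<close> link the two by defining the letters of \<open>b\<close> over
  \<open>a\<close>; each layer replaces them by definitions of its output letters.\<close>

theorem BMA_of_cascade:
  fixes \<Sigma> \<Gamma> :: "'a set"
  assumes "is_uniform_cascade \<Gamma> Ls" "\<And>c. c \<in> \<Gamma> \<Longrightarrow> \<theta> c \<in> BMA \<Sigma>"
  shows "\<exists>\<phi> \<in> BMA \<Sigma>. \<forall>n (d :: nat \<Rightarrow> 'd) a b. 0 < n \<longrightarrow>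
    (\<forall>i. enat i < n \<longrightarrow> b i \<in> \<Gamma> \<and> (\<forall>c \<in> \<Gamma>. i \<in> sem n a d (\<theta> c) (\<lambda>_. {}) \<longleftrightarrow> b i = c)) \<longrightarrow>
    (0 \<in> sem n a d \<phi> (\<lambda>_. {}) \<longleftrightarrow> (\<exists>b'. cascade_rel n d Ls b b'))"
  using assms
proof (induction Ls arbitrary: \<Gamma> \<theta>)
  case Nil
  then show ?case by (intro bexI[OF _ true_in_BMA]) (auto simp: zero_enat_def)
next
  case (Cons L' Ls)
  obtain L \<Gamma>' where L': "L' = (L, \<Gamma>')" by (cases L')
  have L: "is_uniform_layer \<Gamma> \<Gamma>' L" and fin: "finite \<Gamma>" and casc: "is_uniform_cascade \<Gamma>' Ls"
    using Cons.prems(1) by (simp_all add: L')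
  have fin': "finite \<Gamma>'" using layer_transducers[OF L] by (simp add: is_transducer_def)
  obtain g :: "'a \<Rightarrow> nat" where g: "inj_on g \<Gamma>"
    using finite_imp_inj_to_nat_seg[OF fin] by blast
  \<comment> \<open>Undoes the coding of the letter \<open>c\<close> as variable
    \<open>2 * g c\<close>.\<close>
  define \<sigma> where "\<sigma> y = \<theta> (inv_into \<Gamma> g (y div 2))" for y
  have \<sigma>: "\<sigma> (2 * g c) = \<theta> c" if "c \<in> \<Gamma>" for c using g that by (simp add: \<sigma>_def)
  have \<sigma>B: "y \<in> (\<lambda>c. 2 * g c) ` \<Gamma> \<Longrightarrow> \<sigma> y \<in> BMA \<Sigma>" for y using \<sigma> Cons.prems(2) by auto
  note pure = pure_layer_output_fm[OF L, of g]
  define \<theta>' where "\<theta>' x = subst (layer_output_fm g L x) \<sigma>" for x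
  have \<theta>': "\<theta>' x \<in> BMA \<Sigma>" for x unfolding \<theta>'_def using pure \<sigma>B by (rule subst_in_BMA)
  have sem_\<theta>': "sem n a d (\<theta>' x) V = sem n a d (layer_output_fm g L x) (\<lambda>y. sem n a d (\<sigma> y) V)"
    for n a x V and d :: "nat \<Rightarrow> 'd" unfolding \<theta>'_def using pure \<sigma>B by (rule sem_subst_BMA)
  obtain \<phi> where \<phi>: "\<phi> \<in> BMA \<Sigma>" and \<phi>_sem: "\<And>n (d :: nat \<Rightarrow> 'd) a b. 0 < n \<Longrightarrow>
    (\<forall>i. enat i < n \<longrightarrow> b i \<in> \<Gamma>' \<and> (\<forall>c \<in> \<Gamma>'. i \<in> sem n a d (\<theta>' c) (\<lambda>_. {}) \<longleftrightarrow> b i = c)) \<Longrightarrow>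
    0 \<in> sem n a d \<phi> (\<lambda>_. {}) \<longleftrightarrow> (\<exists>b'. cascade_rel n d Ls b b')"
    using Cons.IH[OF casc, of \<theta>'] \<theta>' by blast
  obtain \<chi> where \<chi>: "\<chi> \<in> BMA \<Sigma>" and \<chi>_sem: "\<And>n a (d :: nat \<Rightarrow> 'd). 0 < n \<Longrightarrow>
      0 \<in> sem n a d \<chi> (\<lambda>_. {}) \<longleftrightarrow>
      (\<forall>i. enat i < n \<longrightarrow> (\<exists>x \<in> \<Gamma>'. i \<in> sem n a d (\<theta>' x) (\<lambda>_. {})))"
    by (rule always_exists_BMA[OF fin' \<theta>', where 'd = 'd]) (rule that)
  \<comment> \<open>A conjunction of two members of BMA is obtained by substituting them into a
    modality-free pure formula. Here \<open>\<chi>\<close> says that the layer succeeds; only then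
    do the \<open>\<theta>'\<close> describe an output word and \<open>\<phi>\<close> speak about
    the remaining cascade.\<close>
  define \<tau> where "\<tau> y = (if y = 0 then \<chi> else \<phi>)" for y :: nat
  let ?and = "And (Var 0) (Var 1) :: 'a fm"
  have pand: "pure_fm False {0, 1} ?and" by simp
  have \<tau>: "\<tau> y \<in> BMA \<Sigma>" for y using \<chi> \<phi> by (simp add: \<tau>_def)
  have "subst ?and \<tau> \<in> BMA \<Sigma>" by (rule subst_in_BMA[OF pand]) (rule \<tau>)
  moreover have "0 \<in> sem n a d (subst ?and \<tau>) (\<lambda>_. {}) \<longleftrightarrow> (\<exists>b'. cascade_rel n d (L' # Ls) b b')"
    if n: "0 < n" and b: "\<forall>i. enat i < n \<longrightarrow> b i \<in> \<Gamma> \<and>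
      (\<forall>c \<in> \<Gamma>. i \<in> sem n a d (\<theta> c) (\<lambda>_. {}) \<longleftrightarrow> b i = c)" for n a b and d :: "nat \<Rightarrow> 'd"
  proof -
    let ?V = "\<lambda>y. sem n a d (\<sigma> y) (\<lambda>_. {})"
    have bV: "\<And>i. enat i < n \<Longrightarrow> b i \<in> \<Gamma>"
      "\<And>i c. enat i < n \<Longrightarrow> c \<in> \<Gamma> \<Longrightarrow> i \<in> ?V (2 * g c) \<longleftrightarrow> b i = c"
      using b \<sigma> by auto
    have rel\<theta>: "b' i \<in> \<Gamma>' \<and> (i \<in> sem n a d (\<theta>' x) (\<lambda>_. {}) \<longleftrightarrow> b' i = x)"
      if "layer_rel n d L b b'" "enat i < n" for b' i x
      unfolding sem_\<theta>' by (rule layer_rel_iff(1)[OF L g _ _ that]) (use bV in auto)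
    have ind: "0 \<in> sem n a d \<phi> (\<lambda>_. {}) \<longleftrightarrow> (\<exists>b''. cascade_rel n d Ls b' b'')"
      if "layer_rel n d L b b'" for b'
      by (rule \<phi>_sem[OF n]) (use rel\<theta>[OF that] in blast)
    have all: "0 \<in> sem n a d \<chi> (\<lambda>_. {}) \<longleftrightarrow> (\<exists>b'. layer_rel n d L b b')"
    proof
      assume "0 \<in> sem n a d \<chi> (\<lambda>_. {})"
      then show "\<exists>b'. layer_rel n d L b b'"
        using \<chi>_sem[OF n, of a d] unfolding sem_\<theta>' by (intro layer_rel_iff(2)[OF L g, of n b ?V a d]) (use bV in auto)
    qed (use \<chi>_sem[OF n] rel\<theta> in blast)
    have "0 \<in> sem n a d (subst ?and \<tau>) (\<lambda>_. {}) \<longleftrightarrow>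
      0 \<in> sem n a d \<chi> (\<lambda>_. {}) \<and> 0 \<in> sem n a d \<phi> (\<lambda>_. {})"
      by (simp add: \<tau>_def)
    also have "\<dots> \<longleftrightarrow> (\<exists>b'. layer_rel n d L b b' \<and> (\<exists>b''. cascade_rel n d Ls b' b''))"
      unfolding all using ind by blast
    finally show ?thesis by (auto simp: L')
  qed
  ultimately show ?case by blast
qed

section \<open>Lists and omega-words\<close>

lemma enum_set_positions: "enat k < csize (positions n) \<Longrightarrow> enum_set (positions n) k = k"
proof (induction k)
  case 0
  then show ?case
    using first_on_chain[of 0 False n "\<lambda>_. ()" 0] by (simp add: chain_of_def first_atom_def)
next
  case (Suc k)
  then have k: "enat k < csize (positions n)" by (blast intro: Suc_less_enatD)
  then show ?case
    using Suc move_on_chain[of k False n "\<lambda>_. ()" 0 Xg "enum_set (positions n) (Suc k)"]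
    by (simp add: chain_of_def next_mod_def is_forward_def)
qed

lemma csize_positions: "csize (positions n) = n"
  by (cases n) (simp_all add: csize_def positions_def flip: lessThan_def)

lemma class_succ_cong:
  assumes "\<And>i. enat i < n \<Longrightarrow> d i = d' i"
  shows "class_succ n d i j \<longleftrightarrow> class_succ n d' i j"
  unfolding class_succ_def positions_iff using assms
  by (metis enat_less_mono less_imp_le)

lemma class_pred_cong:
  assumes "\<And>i. enat i < n \<Longrightarrow> d i = d' i"
  shows "class_pred n d i j \<longleftrightarrow> class_pred n d' i j"
  unfolding class_pred_def positions_iff using assms
  by (metis enat_less_mono less_imp_le)

lemma tp_cong:
  assumes "\<And>i. enat i < n \<Longrightarrow> d i = d' i"
  shows "tp n d = tp n d'"
  using class_succ_cong[of n d d', OF assms] class_pred_cong[of n d d', OF assms]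
  by (auto simp: fun_eq_iff tp_def is_S_def is_P_def)

lemma class_of_cong:
  assumes "\<And>i. enat i < n \<Longrightarrow> d i = d' i" "enat i < n"
  shows "class_of n d i = class_of n d' i"
  using assms by (auto simp: class_of_def)

section \<open>Uniform layers and the layers of a cascade\<close>

definition layer_of :: "'a uniform_layer \<Rightarrow> 'a layer" where
  "layer_of L = (if fst L then Class (fst (snd L)) else Global (fst (snd L)))"

definition layer_omega_of :: "'a uniform_layer \<Rightarrow> 'a layer_omega" where
  "layer_omega_of L = (if fst L then Class_omega (fst (snd L)) (snd (snd L)) else Global_omega (snd (snd L)))"

definition empty_transducer :: "('i, 'o) transducer" where
  "empty_transducer = \<lparr>states = {}, initial = {}, delta = {}, final = {}\<rparr>"

lemma functional_empty_transducer:
  assumes "finite A" "finite B"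
  shows "functional_transducer A B empty_transducer" "functional_buchi A B empty_transducer"
  using assms
  by (auto simp: functional_transducer_def functional_buchi_def is_transducer_def empty_transducer_def
      word_rel_def buchi_rel_def intro: single_valuedI)

text \<open>A layer over finite data words has no transducer for infinite chains; the empty
  transducer, whose relation is empty and hence functional, takes that place.\<close>

lemma uniform_layer_exists:
  assumes "is_layer \<Sigma> \<Gamma> A"
  obtains L where "is_uniform_layer \<Sigma> \<Gamma> L" "layer_of L = A"
proof -
  obtain T where T: "A = Global T \<or> A = Class T" "functional_transducer (\<Sigma> \<times> UNIV) \<Gamma> T"
    using assms by (cases A) auto
  then have "finite (\<Sigma> \<times> (UNIV :: marking set))" "finite \<Gamma>"
    by (auto simp: functional_transducer_def is_transducer_def)
  then have "is_uniform_layer \<Sigma> \<Gamma> (A = Class T, T, empty_transducer)"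
    using T(2) functional_empty_transducer by (simp add: is_uniform_layer_def)
  moreover have "layer_of (A = Class T, T, empty_transducer) = A"
    using T(1) by (auto simp: layer_of_def)
  ultimately show ?thesis by (rule that)
qed

lemma uniform_layer_omega_exists:
  assumes "is_layer_omega \<Sigma> \<Gamma> A"
  obtains L where "is_uniform_layer \<Sigma> \<Gamma> L" "layer_omega_of L = A"
proof (cases A)
  case (Global_omega T)
  then have T: "functional_buchi (\<Sigma> \<times> UNIV) \<Gamma> T" using assms by simp
  then have "finite (\<Sigma> \<times> (UNIV :: marking set))" "finite \<Gamma>"
    by (auto simp: functional_buchi_def is_transducer_def)
  then have "is_uniform_layer \<Sigma> \<Gamma> (False, empty_transducer, T)"
    using T functional_empty_transducer by (simp add: is_uniform_layer_def)
  then show ?thesis using that Global_omega by (simp add: layer_omega_of_def)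
next
  case (Class_omega T T\<^sub>\<omega>)
  then show ?thesis using assms that[of "(True, T, T\<^sub>\<omega>)"]
    by (simp add: layer_omega_of_def is_uniform_layer_def)
qed

lemma is_cascade_of_uniform:
  "is_uniform_cascade \<Sigma> Ls \<Longrightarrow> is_cascade \<Sigma> (map (apfst layer_of) Ls)"
proof (induction \<Sigma> Ls rule: is_uniform_cascade.induct)
  case (2 \<Sigma> L \<Gamma> Ls)
  then show ?case by (cases "fst L") (auto simp: layer_of_def is_uniform_layer_def)
qed simp

lemma is_cascade_omega_of_uniform:
  "is_uniform_cascade \<Sigma> Ls \<Longrightarrow> is_cascade_omega \<Sigma> (map (apfst layer_omega_of) Ls)"
proof (induction \<Sigma> Ls rule: is_uniform_cascade.induct)
  case (2 \<Sigma> L \<Gamma> Ls)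
  then show ?case by (cases "fst L") (auto simp: layer_omega_of_def is_uniform_layer_def)
qed simp

lemma uniform_cascade_exists:
  "is_cascade \<Sigma> As \<Longrightarrow> \<exists>Ls. is_uniform_cascade \<Sigma> Ls \<and> As = map (apfst layer_of) Ls"
proof (induction \<Sigma> As rule: is_cascade.induct)
  case (1 \<Sigma>)
  then show ?case by (intro exI[of _ "[]"]) simp
next
  case (2 \<Sigma> A \<Gamma> As)
  then obtain Ls where Ls: "is_uniform_cascade \<Gamma> Ls" "As = map (apfst layer_of) Ls" by auto
  obtain L where "is_uniform_layer \<Sigma> \<Gamma> L" "layer_of L = A"
    using 2 by (auto elim: uniform_layer_exists)
  then show ?case using Ls 2 by (intro exI[of _ "(L, \<Gamma>) # Ls"]) simp
qed

lemma uniform_cascade_omega_exists: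
  "is_cascade_omega \<Sigma> As \<Longrightarrow> \<exists>Ls. is_uniform_cascade \<Sigma> Ls \<and> As = map (apfst layer_omega_of) Ls"
proof (induction \<Sigma> As rule: is_cascade_omega.induct)
  case (1 \<Sigma>)
  then show ?case by (intro exI[of _ "[]"]) simp
next
  case (2 \<Sigma> A \<Gamma> As)
  then obtain Ls where Ls: "is_uniform_cascade \<Gamma> Ls" "As = map (apfst layer_omega_of) Ls" by auto
  obtain L where "is_uniform_layer \<Sigma> \<Gamma> L" "layer_omega_of L = A"
    using 2 by (auto elim: uniform_layer_omega_exists)
  then show ?case using Ls 2 by (intro exI[of _ "(L, \<Gamma>) # Ls"]) simp
qed

section \<open>Agreement of the uniform relations with runs on lists and sequences\<close>

lemma seg_nth_map: "seg (\<lambda>k. f (xs ! k)) 0 (length xs) = map f xs"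
  by (auto simp: seg_def intro: nth_equalityI)

lemma trans_rel_finite_set:
  assumes "finite C"
  shows "trans_rel T T\<^sub>\<omega> (csize C) (\<lambda>k. u (enum_set C k)) (\<lambda>k. v (enum_set C k)) \<longleftrightarrow>
    (map u (sorted_list_of_set C), map v (sorted_list_of_set C)) \<in> word_rel T"
proof -
  have "card C = length (sorted_list_of_set C)" by simp
  then show ?thesis
    using assms seg_nth_map[of u "sorted_list_of_set C"] seg_nth_map[of v "sorted_list_of_set C"]
    by (simp add: trans_rel_def csize_def enum_set_def)
qed

lemma trans_rel_infinite_set:
  assumes "infinite C"
  shows "trans_rel T T\<^sub>\<omega> (csize C) (\<lambda>k. u (enum_set C k)) (\<lambda>k. v (enum_set C k)) \<longleftrightarrow>
    (u \<circ> enumerate C, v \<circ> enumerate C) \<in> buchi_rel T\<^sub>\<omega>"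
  using assms by (simp add: trans_rel_def csize_def enum_set_def comp_def)

lemma word_rel_map_cong:
  assumes "\<And>j. j \<in> set xs \<Longrightarrow> u j = u' j"
  shows "(map u xs, v) \<in> word_rel T \<longleftrightarrow> (map u' xs, v) \<in> word_rel T"
  using assms by (metis map_cong)

text \<open>The list is compared with functions \<open>a\<close> and \<open>d\<close> that agree
  with it below its length only. Thus one and the same \<open>d\<close> can accompany all words of a
  cascade while the letters change.\<close>

lemma produces_iff_layer_rel:
  assumes w: "w \<noteq> []" "\<And>i. i < length w \<Longrightarrow> w ! i = (a i, d i)"
  shows "produces (layer_of L) w w' \<longleftrightarrow>
    map snd w' = map snd w \<and> layer_rel (enat (length w)) d L a (\<lambda>i. fst (w' ! i))"
proof -
  let ?n = "enat (length w)"
  let ?u = "\<lambda>j. (a j, tp ?n d j)"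
  have d: "snd (w ! i) = d i" if "enat i < ?n" for i using w(2) that by simp
  have marked: "marked w i = ?u i" if "i < length w" for i
    using tp_cong[of ?n "\<lambda>j. snd (w ! j)" d] d w(2)[OF that] by (simp add: marked_def)
  show ?thesis
  proof (cases "fst L")
    case True
    have "(map (marked w) xs, map (\<lambda>j. fst (w' ! j)) xs) \<in> word_rel (fst (snd L)) \<longleftrightarrow>
      trans_rel (fst (snd L)) (snd (snd L)) (csize (class_of ?n d i))
        (\<lambda>k. ?u (enum_set (class_of ?n d i) k)) (\<lambda>k. fst (w' ! enum_set (class_of ?n d i) k))"
      if i: "i < length w" and xs: "xs = sorted_list_of_set (class_of ?n (\<lambda>j. snd (w ! j)) i)" for i xs
    proof -
      have sub: "class_of ?n d i \<subseteq> {..<length w}" by (auto simp: class_of_def)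
      then have fin: "finite (class_of ?n d i)" by (rule finite_subset) simp
      have "class_of ?n (\<lambda>j. snd (w ! j)) i = class_of ?n d i"
        by (rule class_of_cong) (use d i in auto)
      then have xs: "xs = sorted_list_of_set (class_of ?n d i)" by (simp add: xs)
      have "marked w j = ?u j" if "j \<in> set xs" for j
        using that sub fin by (intro marked) (auto simp: xs)
      then have "(map (marked w) xs, map (\<lambda>j. fst (w' ! j)) xs) \<in> word_rel (fst (snd L)) \<longleftrightarrow>
        (map ?u xs, map (\<lambda>j. fst (w' ! j)) xs) \<in> word_rel (fst (snd L))"
        by (rule word_rel_map_cong)
      then show ?thesis
        using trans_rel_finite_set[OF fin, of "fst (snd L)" "snd (snd L)" ?u "\<lambda>j. fst (w' ! j)"]
        unfolding xs by blast
    qed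
    then show ?thesis
      using True by (simp add: layer_of_def layer_rel_def chain_of_def chain_word_def)
  next
    case False
    have pos: "positions ?n = {0..<length w}" by auto
    have len: "length w' = length w" if "map snd w' = map snd w" using that by (metis length_map)
    have "map fst w' = map (\<lambda>j. fst (w' ! j)) [0..<length w]" if "map snd w' = map snd w"
      using len[OF that] by (metis (no_types, lifting) map_nth map_map comp_def map_eq_conv)
    moreover have "(map (marked w) [0..<length w], map (\<lambda>j. fst (w' ! j)) [0..<length w]) \<in> word_rel T \<longleftrightarrow>
      trans_rel T T' (csize (positions ?n)) (\<lambda>k. ?u (enum_set (positions ?n) k))
        (\<lambda>k. fst (w' ! enum_set (positions ?n) k))" for T T'
      unfolding pos by (subst trans_rel_finite_set) (auto intro!: word_rel_map_cong simp: marked)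
    ultimately show ?thesis
      using False w(1) by (auto simp: layer_of_def layer_rel_def chain_of_def chain_word_def)
  qed
qed

lemma layer_rel_cong:
  assumes "layer_rel n d L a b" "\<And>i. enat i < n \<Longrightarrow> b i = b' i"
  shows "layer_rel n d L a b'"
  unfolding layer_rel_def
proof (intro allI impI)
  fix i assume "enat i < n"
  then have "trans_rel (fst (snd L)) (snd (snd L)) (csize (chain_of (fst L) n d i))
    (chain_word (fst L) n d i (\<lambda>j. (a j, tp n d j))) (chain_word (fst L) n d i b)"
    using assms(1) by (simp add: layer_rel_def)
  then show "trans_rel (fst (snd L)) (snd (snd L)) (csize (chain_of (fst L) n d i))
    (chain_word (fst L) n d i (\<lambda>j. (a j, tp n d j))) (chain_word (fst L) n d i b')"
    by (rule trans_rel_cong) (simp add: chain_word_def assms(2) chain_in_positions)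
qed

lemma accepts_iff:
  assumes "w \<noteq> []" "\<And>i. i < length w \<Longrightarrow> w ! i = (a i, d i)"
  shows "accepts (map (apfst layer_of) Ls) w \<longleftrightarrow> (\<exists>b. cascade_rel (enat (length w)) d Ls a b)"
  using assms
proof (induction Ls arbitrary: w a)
  case (Cons L' Ls)
  obtain L \<Gamma> where L': "L' = (L, \<Gamma>)" by (cases L')
  have "(\<exists>w'. produces (layer_of L) w w' \<and> accepts (map (apfst layer_of) Ls) w') \<longleftrightarrow>
    (\<exists>c. layer_rel (enat (length w)) d L a c \<and> (\<exists>b. cascade_rel (enat (length w)) d Ls c b))"
  proof safe
    fix w' assume w': "produces (layer_of L) w w'" "accepts (map (apfst layer_of) Ls) w'"
    have p: "map snd w' = map snd w" "layer_rel (enat (length w)) d L a (\<lambda>i. fst (w' ! i))"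
      using w'(1) produces_iff_layer_rel[OF Cons.prems] by auto
    have len: "length w' = length w" using p(1) by (metis length_map)
    have "w' ! i = (fst (w' ! i), d i)" if "i < length w'" for i
      using that len p(1) Cons.prems(2)[of i] by (metis nth_map prod.collapse snd_conv)
    then have "\<exists>b. cascade_rel (enat (length w)) d Ls (\<lambda>i. fst (w' ! i)) b"
    proof -
      assume "\<And>i. i < length w' \<Longrightarrow> w' ! i = (fst (w' ! i), d i)"
      moreover have "w' \<noteq> []" using len Cons.prems(1) by auto
      ultimately show ?thesis using Cons.IH[of w' "\<lambda>i. fst (w' ! i)"] w'(2) len by simp
    qed
    then show "\<exists>c. layer_rel (enat (length w)) d L a c \<and> (\<exists>b. cascade_rel (enat (length w)) d Ls c b)"
      using p(2) by blast
  next
    fix c b assume c: "layer_rel (enat (length w)) d L a c" "cascade_rel (enat (length w)) d Ls c b"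
    \<comment> \<open>The function \<open>c\<close> is cut off at the length of \<open>w\<close>;
      what it does beyond that length is invisible to the layers.\<close>
    let ?w' = "map (\<lambda>i. (c i, d i)) [0..<length w]"
    have "map snd ?w' = map snd w"
      by (rule nth_equalityI) (use Cons.prems(2) in auto)
    moreover have "layer_rel (enat (length w)) d L a (\<lambda>i. fst (?w' ! i))"
      using c(1) by (rule layer_rel_cong) simp
    ultimately have "produces (layer_of L) w ?w'"
      using produces_iff_layer_rel[OF Cons.prems] by blast
    moreover have "accepts (map (apfst layer_of) Ls) ?w'"
      using Cons.IH[of ?w' c] c(2) Cons.prems(1) by auto
    ultimately show "\<exists>w'. produces (layer_of L) w w' \<and> accepts (map (apfst layer_of) Ls) w'" by blast
  qed
  then show ?case by (auto simp: L')
next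
  case Nil
  have "cascade_rel (enat (length w)) d [] a a" by simp
  then show ?case unfolding list.map accepts.simps by blast
qed

lemma produces_omega_iff_layer_rel:
  "produces_omega (layer_omega_of L) w w' \<longleftrightarrow>
    snd \<circ> w' = snd \<circ> w \<and> layer_rel \<infinity> (snd \<circ> w) L (fst \<circ> w) (fst \<circ> w')"
proof -
  have marked: "marked_omega w = (\<lambda>j. ((fst \<circ> w) j, tp \<infinity> (snd \<circ> w) j))"
    by (simp add: marked_omega_def fun_eq_iff)
  show ?thesis
  proof (cases "fst L")
    case True
    have "trans_rel (fst (snd L)) (snd (snd L)) (csize C) (\<lambda>k. marked_omega w (enum_set C k))
        (\<lambda>k. (fst \<circ> w') (enum_set C k)) \<longleftrightarrow>
      (if finite C
        then (map (marked_omega w) (sorted_list_of_set C), map (fst \<circ> w') (sorted_list_of_set C))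
               \<in> word_rel (fst (snd L))
        else (marked_omega w \<circ> enumerate C, fst \<circ> w' \<circ> enumerate C) \<in> buchi_rel (snd (snd L)))" for C
      using trans_rel_finite_set[of C "fst (snd L)" "snd (snd L)" "marked_omega w" "fst \<circ> w'"]
        trans_rel_infinite_set[of C "fst (snd L)" "snd (snd L)" "marked_omega w" "fst \<circ> w'"] by simp
    then show ?thesis
      using True unfolding layer_rel_def marked[symmetric] chain_word_def
      by (simp add: layer_omega_of_def chain_of_def Let_def)
  next
    case False
    have pos: "csize (positions \<infinity>) = \<infinity>" "enum_set (positions \<infinity>) = (\<lambda>k. k)"
      using enum_set_positions[of _ \<infinity>] by (auto simp: csize_positions)
    then show ?thesis
      using False unfolding layer_rel_def marked[symmetric] chain_word_def
      by (simp add: layer_omega_of_def chain_of_def trans_rel_def comp_def)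
  qed
qed

lemma accepts_omega_iff:
  "accepts_omega (map (apfst layer_omega_of) Ls) w \<longleftrightarrow>
   (\<exists>b. cascade_rel \<infinity> (snd \<circ> w) Ls (fst \<circ> w) b)"
proof (induction Ls arbitrary: w)
  case (Cons L' Ls)
  obtain L \<Gamma> where L': "L' = (L, \<Gamma>)" by (cases L')
  have "(\<exists>w'. produces_omega (layer_omega_of L) w w' \<and> (\<exists>b. cascade_rel \<infinity> (snd \<circ> w') Ls (fst \<circ> w') b)) \<longleftrightarrow>
    (\<exists>c. layer_rel \<infinity> (snd \<circ> w) L (fst \<circ> w) c \<and> (\<exists>b. cascade_rel \<infinity> (snd \<circ> w) Ls c b))"
    (is "?L \<longleftrightarrow> ?R")
  proof
    assume ?R
    then obtain c where c: "layer_rel \<infinity> (snd \<circ> w) L (fst \<circ> w) c"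
      "\<exists>b. cascade_rel \<infinity> (snd \<circ> w) Ls c b" by blast
    let ?w' = "\<lambda>i. (c i, snd (w i))"
    have "snd \<circ> ?w' = snd \<circ> w" "fst \<circ> ?w' = c" by (auto simp: comp_def)
    then show ?L using c by (intro exI[of _ ?w']) (simp add: produces_omega_iff_layer_rel)
  next
    assume ?L
    then show ?R unfolding produces_omega_iff_layer_rel by metis
  qed
  then show ?case
    unfolding L' list.map apfst_conv accepts_omega.simps cascade_rel.simps Cons.IH by blast
next
  case Nil
  have "cascade_rel \<infinity> (snd \<circ> w) [] (fst \<circ> w) (fst \<circ> w)" by simp
  then show ?case unfolding list.map accepts_omega.simps by blast
qed

theorem theorem8:
  fixes \<Sigma> :: "'a set"
  assumes "infinite (UNIV :: 'a set)" and "infinite (UNIV :: 'd set)" and "finite \<Sigma>"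
  shows
    "(\<forall>\<phi> \<in> BMA \<Sigma>. sentence \<phi> \<longrightarrow>
        (\<exists>As. is_cascade \<Sigma> As \<and>
           (\<forall>w \<in> (data_words \<Sigma> :: ('a \<times> 'd) list set). accepts As w \<longleftrightarrow> models w \<phi>))) \<and>
     (\<forall>As. is_cascade \<Sigma> As \<longrightarrow>
        (\<exists>\<phi> \<in> BMA \<Sigma>. sentence \<phi> \<and>
           (\<forall>w \<in> (data_words \<Sigma> :: ('a \<times> 'd) list set). models w \<phi> \<longleftrightarrow> accepts As w))) \<and>
     (\<forall>\<phi> \<in> BMA \<Sigma>. sentence \<phi> \<longrightarrow>
        (\<exists>As. is_cascade_omega \<Sigma> As \<and>
           (\<forall>w \<in> (data_omega_words \<Sigma> :: (nat \<Rightarrow> 'a \<times> 'd) set).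
              accepts_omega As w \<longleftrightarrow> models_omega w \<phi>))) \<and>
     (\<forall>As. is_cascade_omega \<Sigma> As \<longrightarrow>
        (\<exists>\<phi> \<in> BMA \<Sigma>. sentence \<phi> \<and>
           (\<forall>w \<in> (data_omega_words \<Sigma> :: (nat \<Rightarrow> 'a \<times> 'd) set).
              models_omega w \<phi> \<longleftrightarrow> accepts_omega As w)))"
proof -
  have fin: "accepts (map (apfst layer_of) Ls) w \<longleftrightarrow>
      (\<exists>b. cascade_rel (enat (length w)) (\<lambda>i. snd (w ! i)) Ls (\<lambda>i. fst (w ! i)) b)"
    "0 < enat (length w)" "\<And>i. enat i < enat (length w) \<Longrightarrow> fst (w ! i) \<in> \<Sigma>"
    if "w \<in> data_words \<Sigma>" for Ls and w :: "('a \<times> 'd) list"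
    using that by (auto intro!: accepts_iff simp: data_words_def zero_enat_def)
  have inf: "fst (w i) \<in> \<Sigma>" if "w \<in> data_omega_words \<Sigma>" for i and w :: "nat \<Rightarrow> 'a \<times> 'd"
    using that by (simp add: data_omega_words_def)
  have sentence: "sentence \<phi>" if "\<phi> \<in> BMA \<Sigma>" for \<phi>
    using that fv_Comp by (auto simp: sentence_def BMA_def)
  \<comment> \<open>One uniform cascade serves all lengths, so it yields both the cascade for data
    words and the one for data omega-words.\<close>
  have cascade: "\<exists>Ls. is_uniform_cascade \<Sigma> Ls \<and> (\<forall>n (d :: nat \<Rightarrow> 'd) a. 0 < n \<longrightarrow>
      (\<forall>i. enat i < n \<longrightarrow> a i \<in> \<Sigma>) \<longrightarrow>
      ((\<exists>b. cascade_rel n d Ls a b) \<longleftrightarrow> 0 \<in> sem n a d \<phi> (\<lambda>_. {})))" if "\<phi> \<in> BMA \<Sigma>" for \<phi>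
    by (rule cascade_of_BMA[OF assms(1,3) that, where 'd = 'd]) blast
  have formula: "\<exists>\<phi> \<in> BMA \<Sigma>. \<forall>n (d :: nat \<Rightarrow> 'd) a. 0 < n \<longrightarrow> (\<forall>i. enat i < n \<longrightarrow> a i \<in> \<Sigma>) \<longrightarrow>
      (0 \<in> sem n a d \<phi> (\<lambda>_. {}) \<longleftrightarrow> (\<exists>b. cascade_rel n d Ls a b))" if Ls: "is_uniform_cascade \<Sigma> Ls" for Ls
  proof -
    have "\<exists>\<phi> \<in> BMA \<Sigma>. \<forall>n (d :: nat \<Rightarrow> 'd) a b. 0 < n \<longrightarrow>
      (\<forall>i. enat i < n \<longrightarrow> b i \<in> \<Sigma> \<and>
        (\<forall>c \<in> \<Sigma>. i \<in> sem n a d (Pos (Letter c)) (\<lambda>_. {}) \<longleftrightarrow> b i = c)) \<longrightarrow>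
      (0 \<in> sem n a d \<phi> (\<lambda>_. {}) \<longleftrightarrow> (\<exists>b'. cascade_rel n d Ls b b'))"
      by (rule BMA_of_cascade[OF Ls]) (rule letter_in_BMA)
    then obtain \<phi> where \<phi>: "\<phi> \<in> BMA \<Sigma>" "\<forall>n (d :: nat \<Rightarrow> 'd) a b. 0 < n \<longrightarrow>
      (\<forall>i. enat i < n \<longrightarrow> b i \<in> \<Sigma> \<and>
        (\<forall>c \<in> \<Sigma>. i \<in> sem n a d (Pos (Letter c)) (\<lambda>_. {}) \<longleftrightarrow> b i = c)) \<longrightarrow>
      (0 \<in> sem n a d \<phi> (\<lambda>_. {}) \<longleftrightarrow> (\<exists>b'. cascade_rel n d Ls b b'))"
      by (elim bexE)
    show ?thesis
    proof (intro bexI[OF _ \<phi>(1)] allI impI)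
      fix n a and d :: "nat \<Rightarrow> 'd"
      assume "0 < n" "\<forall>i. enat i < n \<longrightarrow> a i \<in> \<Sigma>"
      then show "0 \<in> sem n a d \<phi> (\<lambda>_. {}) \<longleftrightarrow> (\<exists>b. cascade_rel n d Ls a b)"
        using \<phi>(2)[rule_format, of n a a d] by simp
    qed
  qed
  show ?thesis
  proof (intro conjI ballI allI impI)
    fix \<phi> assume "\<phi> \<in> BMA \<Sigma>"
    then obtain Ls where Ls: "is_uniform_cascade \<Sigma> Ls" "\<And>n (d :: nat \<Rightarrow> 'd) a. 0 < n \<Longrightarrow>
      (\<forall>i. enat i < n \<longrightarrow> a i \<in> \<Sigma>) \<Longrightarrow> (\<exists>b. cascade_rel n d Ls a b) \<longleftrightarrow> 0 \<in> sem n a d \<phi> (\<lambda>_. {})"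
      using cascade by meson
    show "\<exists>As. is_cascade \<Sigma> As \<and>
        (\<forall>w \<in> (data_words \<Sigma> :: ('a \<times> 'd) list set). accepts As w \<longleftrightarrow> models w \<phi>)"
    proof (intro exI[of _ "map (apfst layer_of) Ls"] conjI ballI)
      show "is_cascade \<Sigma> (map (apfst layer_of) Ls)" using Ls(1) by (rule is_cascade_of_uniform)
      fix w :: "('a \<times> 'd) list" assume w: "w \<in> data_words \<Sigma>"
      show "accepts (map (apfst layer_of) Ls) w \<longleftrightarrow> models w \<phi>"
        unfolding fin(1)[OF w] models_def by (rule Ls(2)) (use fin(2,3)[OF w] in blast)+
    qed
    show "\<exists>As. is_cascade_omega \<Sigma> As \<and>
        (\<forall>w \<in> (data_omega_words \<Sigma> :: (nat \<Rightarrow> 'a \<times> 'd) set). accepts_omega As w \<longleftrightarrow> models_omega w \<phi>)"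
    proof (intro exI[of _ "map (apfst layer_omega_of) Ls"] conjI ballI)
      show "is_cascade_omega \<Sigma> (map (apfst layer_omega_of) Ls)"
        using Ls(1) by (rule is_cascade_omega_of_uniform)
      fix w :: "nat \<Rightarrow> 'a \<times> 'd" assume w: "w \<in> data_omega_words \<Sigma>"
      show "accepts_omega (map (apfst layer_omega_of) Ls) w \<longleftrightarrow> models_omega w \<phi>"
        unfolding accepts_omega_iff models_omega_def by (rule Ls(2)) (use inf[OF w] in simp_all)
    qed
  next
    fix As assume "is_cascade \<Sigma> As"
    then obtain Ls where Ls: "is_uniform_cascade \<Sigma> Ls" "As = map (apfst layer_of) Ls"
      using uniform_cascade_exists by blast
    obtain \<phi> where \<phi>: "\<phi> \<in> BMA \<Sigma>" "\<And>n (d :: nat \<Rightarrow> 'd) a. 0 < n \<Longrightarrow>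
      (\<forall>i. enat i < n \<longrightarrow> a i \<in> \<Sigma>) \<Longrightarrow> 0 \<in> sem n a d \<phi> (\<lambda>_. {}) \<longleftrightarrow> (\<exists>b. cascade_rel n d Ls a b)"
      using formula[OF Ls(1)] by meson
    show "\<exists>\<phi> \<in> BMA \<Sigma>. sentence \<phi> \<and>
        (\<forall>w \<in> (data_words \<Sigma> :: ('a \<times> 'd) list set). models w \<phi> \<longleftrightarrow> accepts As w)"
    proof (intro bexI[of _ \<phi>] conjI ballI)
      fix w :: "('a \<times> 'd) list" assume w: "w \<in> data_words \<Sigma>"
      show "models w \<phi> \<longleftrightarrow> accepts As w"
        unfolding Ls(2) fin(1)[OF w] models_def by (rule \<phi>(2)) (use fin(2,3)[OF w] in blast)+
    qed (use \<phi>(1) sentence in blast)+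
  next
    fix As assume "is_cascade_omega \<Sigma> As"
    then obtain Ls where Ls: "is_uniform_cascade \<Sigma> Ls" "As = map (apfst layer_omega_of) Ls"
      using uniform_cascade_omega_exists by blast
    obtain \<phi> where \<phi>: "\<phi> \<in> BMA \<Sigma>" "\<And>n (d :: nat \<Rightarrow> 'd) a. 0 < n \<Longrightarrow>
      (\<forall>i. enat i < n \<longrightarrow> a i \<in> \<Sigma>) \<Longrightarrow> 0 \<in> sem n a d \<phi> (\<lambda>_. {}) \<longleftrightarrow> (\<exists>b. cascade_rel n d Ls a b)"
      using formula[OF Ls(1)] by meson
    show "\<exists>\<phi> \<in> BMA \<Sigma>. sentence \<phi> \<and>
        (\<forall>w \<in> (data_omega_words \<Sigma> :: (nat \<Rightarrow> 'a \<times> 'd) set). models_omega w \<phi> \<longleftrightarrow> accepts_omega As w)"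
    proof (intro bexI[of _ \<phi>] conjI ballI)
      fix w :: "nat \<Rightarrow> 'a \<times> 'd" assume w: "w \<in> data_omega_words \<Sigma>"
      show "models_omega w \<phi> \<longleftrightarrow> accepts_omega As w"
        unfolding Ls(2) accepts_omega_iff models_omega_def by (rule \<phi>(2)) (use inf[OF w] in simp_all)
    qed (use \<phi>(1) sentence in blast)+
  qed
qed

end
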